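(* Let $A$ be a commutative unital real algebra, $T\subseteq A$ a linear subspace such that $T\cup\{1\}$ generates $A$ as an algebra, and $S$ a vector space basis of $T$. Let $\mathcal{T}$ denote $T$ equipped with some locally convex Hausdorff topology, with continuous dual $\mathcal{T}'$. Let $L$ be a linear functional on $A$ such that $L(1)=1$. Suppose that one of the following assumptions is satisfied: (i) $L$ is $A_+$-positive, that is, $L(a)\geq 0$ for all $a\in A_+$; (ii) $L$ is positive, that is, $L(a^2)\geq 0$ for all $a\in A$, and Carleman's condition $\sum_{n=1}^\infty L(t^{2n})^{-\frac{1}{2n}}=+\infty$ holds for all $t\in S$. Then there exists a cylinder measure $\mu$ on $\mathcal{T}'$ such that $$L(f)=\int_{\mathcal{T}'} f(\chi)\,d\mu(\chi)\quad\text{for all } f\in A,$$ i.e. for all $k\in\mathbb{N}$, $t_1,\dots,t_k\in T$ and $p\in\mathbb{R}[x_1,\dots,x_k]$ the function $\chi\mapsto p(\chi(t_1),\dots,\chi(t_k))$ is $\mu$-integrable and $L(p(t_1,\dots,t_k))=\int_{\mathcal{T}'}p(\chi(t_1),\dots,\chi(t_k))\,d\mu(\chi)$. If there exists a continuous seminorm $q$ on $\mathcal{T}$ such that $L(t^2)\leq q(t)^2$ for all $t\in\mathcal{T}$, then there is a continuous cylinder measure $\mu$ on $\mathcal{T}'$ with this property. Further, if in addition $\mathcal{T}'\subseteq\{\chi\lceil T:\chi\in\hat{A}\}$, then $L$ is a moment functional on $A$.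
   Context: Characters: $\hat{A}$ is the set of algebra homomorphisms $\chi:A\to\mathbb{R}$ with $\chi(1)=1$; for $f\in A$, $\chi\in\hat{A}$ write $f(\chi):=\chi(f)$. $A_+:=\{f\in A: f(\chi)\geq 0 \text{ for all }\chi\in\hat{A}\}$. A character is determined by its restriction $\chi\lceil T$ to $T$, and $\chi\in\hat{A}$ is identified with $\chi\lceil T$. For a general $\chi\in\mathcal{T}'$ and $f=p(t_1,\dots,t_k)$ with $t_i\in T$ and $p$ a real polynomial, $f(\chi)$ stands for $p(\chi(t_1),\dots,\chi(t_k))$ (the integral formula is asserted for every such representation of $f$); if $\chi$ is the restriction of a character this equals $\chi(f)$. Carleman's condition: a term with $L(t^{2n})=0$ is read as $+\infty$. Cylinder measures: let $V$ be a real locally convex Hausdorff space with continuous dual $V'$. For a finite-dimensional subspace $F\subseteq V$ put $F^\circ=\{\ell\in V':\ell(f)=0 \text{ for } f\in F\}$; then $V'/F^\circ\cong F^*$ is finite-dimensional. For a Borel set $M\subseteq V'/F^\circ$, the set $\{\ell\in V':\ell+F^\circ\in M\}$ is the cylinder set with base $M$ and generating subspace $V'/F^\circ$. The cylinder sets (over all $F$, $M$) form an algebra of sets $\mathcal{C}(V)$. A cylinder measure on $V'$ is a function $\mu:\mathcal{C}(V)\to[0,1]$ with $\mu(V')=1$ such that $\mu(N)=\sum_n\mu(N_n)$ whenever $N$ is the union of pairwise disjoint cylinder sets $N_n$, $n\in\mathbb{N}$, with a common generating subspace. It induces for each $F$ a Borel probability measure $\nu_F$ on $V'/F^\circ$ by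 $\nu_F(M):=\mu(N)$, $N$ the cylinder set with base $M$. A function on $V'$ of the form $g(\ell)=h(\ell+F^\circ)$ with $h$ Borel on $V'/F^\circ$ is $\mu$-integrable if $h$ is $\nu_F$-integrable, and then $\int_{V'}g\,d\mu:=\int h\,d\nu_F$. The cylinder measure $\mu$ is continuous if for each $\varepsilon>0$ and $a>0$ there is a zero neighbourhood $U$ in $V$ such that $\mu(\{\chi\in V':|\chi(t)|\geq a\})\leq\varepsilon$ for all $t\in U$. These notions are applied with $V=\mathcal{T}$. Moment functional: when $\mathcal{T}'\subseteq\{\chi\lceil T:\chi\in\hat{A}\}$, a linear functional $L$ on $A$ is a moment functional on $A$ if there is a cylinder measure $\mu$ on $\mathcal{T}'$ (a representing cylinder measure) such that $\chi\mapsto f(\chi)$ is $\mu$-integrable on $\mathcal{T}'$ and $L(f)=\int_{\mathcal{T}'}f(\chi)\,d\mu(\chi)$ for all $f\in A$. *)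

theory Defs
  imports "HOL-Analysis.Analysis" "HOL-Library.Poly_Mapping"
begin

definition is_subalgebra :: "'a::{real_algebra_1, comm_ring_1} set \<Rightarrow> bool" where
  "is_subalgebra B \<longleftrightarrow> subspace B \<and> 1 \<in> B \<and> (\<forall>x\<in>B. \<forall>y\<in>B. x * y \<in> B)"

definition characters :: "('a::{real_algebra_1, comm_ring_1} \<Rightarrow> real) set" where
  "characters = {\<phi>. linear \<phi> \<and> (\<forall>x y. \<phi> (x * y) = \<phi> x * \<phi> y) \<and> \<phi> 1 = 1}"

definition nonneg_on_characters :: "'a::{real_algebra_1, comm_ring_1} set" where
  "nonneg_on_characters = {f. \<forall>\<phi>\<in>characters. 0 \<le> \<phi> f}"

text \<open>
  Terms with \<open>L (t ^ (2 * n)) = 0\<close> count as infinity; the index of the series is shifted by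
  one so that it ranges over \<open>n \<ge> 1\<close>.
\<close>

definition carleman :: "('a::{real_algebra_1, comm_ring_1} \<Rightarrow> real) \<Rightarrow> 'a \<Rightarrow> bool" where
  "carleman L t \<longleftrightarrow>
     suminf (\<lambda>n. if L (t ^ (2 * Suc n)) = 0 then \<infinity>
                  else ennreal (L (t ^ (2 * Suc n)) powr (- (1 / (2 * real (Suc n)))))) = (\<infinity>::ennreal)"

text \<open>
  A real polynomial in the variables \<open>x\<^sub>0, x\<^sub>1, \<dots>\<close> is a finitely supported map from exponent
  vectors to coefficients.
\<close>

type_synonym real_mpoly = "(nat \<Rightarrow>\<^sub>0 nat) \<Rightarrow>\<^sub>0 real"

definition mpoly_in :: "nat \<Rightarrow> real_mpoly set" where
  "mpoly_in k = {p. \<forall>m\<in>Poly_Mapping.keys p. Poly_Mapping.keys m \<subseteq> {..<k}}"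

definition mpoly_eval :: "real_mpoly \<Rightarrow> (nat \<Rightarrow> 'a) \<Rightarrow> 'a::{real_algebra_1, comm_ring_1}" where
  "mpoly_eval p x =
     (\<Sum>m\<in>Poly_Mapping.keys p. Poly_Mapping.lookup p m *\<^sub>R
        (\<Prod>i\<in>Poly_Mapping.keys m. x i ^ Poly_Mapping.lookup m i))"

text \<open>
  A locally convex space is given by a topology \<open>\<tau>\<close> whose carrier \<open>topspace \<tau>\<close> is a linear
  subspace of the ambient vector space.
\<close>

definition locally_convex_hausdorff :: "'a::real_vector topology \<Rightarrow> bool" where
  "locally_convex_hausdorff \<tau> \<longleftrightarrow>
     subspace (topspace \<tau>) \<and>
     Hausdorff_space \<tau> \<and>
     continuous_map (prod_topology \<tau> \<tau>) \<tau> (\<lambda>(x, y). x + y) \<and>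
     continuous_map (prod_topology euclideanreal \<tau>) \<tau> (\<lambda>(c, x). c *\<^sub>R x) \<and>
     (\<forall>U. openin \<tau> U \<and> 0 \<in> U \<longrightarrow> (\<exists>W. openin \<tau> W \<and> convex W \<and> 0 \<in> W \<and> W \<subseteq> U))"

definition continuous_seminorm :: "'a::real_vector topology \<Rightarrow> ('a \<Rightarrow> real) \<Rightarrow> bool" where
  "continuous_seminorm \<tau> q \<longleftrightarrow>
     (\<forall>x\<in>topspace \<tau>. 0 \<le> q x) \<and>
     (\<forall>c. \<forall>x\<in>topspace \<tau>. q (c *\<^sub>R x) = \<bar>c\<bar> * q x) \<and>
     (\<forall>x\<in>topspace \<tau>. \<forall>y\<in>topspace \<tau>. q (x + y) \<le> q x + q y) \<and>
     continuous_map \<tau> euclideanreal q"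

text \<open>
  Functionals on \<open>topspace \<tau>\<close> are represented by functions that are \<open>undefined\<close> elsewhere, so that
  equality of functionals is equality of functions.
\<close>

definition continuous_dual :: "'a::real_vector topology \<Rightarrow> ('a \<Rightarrow> real) set" where
  "continuous_dual \<tau> =
     {l \<in> extensional (topspace \<tau>).
        (\<forall>x\<in>topspace \<tau>. \<forall>y\<in>topspace \<tau>. l (x + y) = l x + l y) \<and>
        (\<forall>c. \<forall>x\<in>topspace \<tau>. l (c *\<^sub>R x) = c * l x) \<and>
        continuous_map \<tau> euclideanreal l}"

definition finite_dim_subspaces :: "'a::real_vector topology \<Rightarrow> 'a set set" where
  "finite_dim_subspaces \<tau> = {F. F \<subseteq> topspace \<tau> \<and> (\<exists>B. finite B \<and> F = span B)}"

definition annihilator :: "'a::real_vector topology \<Rightarrow> 'a set \<Rightarrow> ('a \<Rightarrow> real) set" where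
  "annihilator \<tau> F = {l \<in> continuous_dual \<tau>. \<forall>f\<in>F. l f = 0}"

definition dual_coset :: "'a::real_vector topology \<Rightarrow> 'a set \<Rightarrow> ('a \<Rightarrow> real) \<Rightarrow> ('a \<Rightarrow> real) set" where
  "dual_coset \<tau> F l = (\<lambda>m. \<lambda>x\<in>topspace \<tau>. l x + m x) ` annihilator \<tau> F"

definition dual_quotient :: "'a::real_vector topology \<Rightarrow> 'a set \<Rightarrow> ('a \<Rightarrow> real) set set" where
  "dual_quotient \<tau> F = dual_coset \<tau> F ` continuous_dual \<tau>"

text \<open>
  For finite-dimensional \<open>F\<close> the linear functionals on the finite-dimensional space
  \<open>dual_quotient \<tau> F\<close> are exactly the evaluations at the points of \<open>F\<close>. They separate points,
  so the coarsest topology making them continuous is the unique Hausdorff vector space topology.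
\<close>

definition dual_quotient_topology ::
    "'a::real_vector topology \<Rightarrow> 'a set \<Rightarrow> ('a \<Rightarrow> real) set topology" where
  "dual_quotient_topology \<tau> F =
     topology_generated_by
       {dual_coset \<tau> F ` {l \<in> continuous_dual \<tau>. l f \<in> W} | f W. f \<in> F \<and> open W}"

definition dual_quotient_borel ::
    "'a::real_vector topology \<Rightarrow> 'a set \<Rightarrow> ('a \<Rightarrow> real) set measure" where
  "dual_quotient_borel \<tau> F = sigma (dual_quotient \<tau> F) {U. openin (dual_quotient_topology \<tau> F) U}"

definition cylinder_set ::
    "'a::real_vector topology \<Rightarrow> 'a set \<Rightarrow> ('a \<Rightarrow> real) set set \<Rightarrow> ('a \<Rightarrow> real) set" where
  "cylinder_set \<tau> F M = {l \<in> continuous_dual \<tau>. dual_coset \<tau> F l \<in> M}"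

definition cylinder_sets_over ::
    "'a::real_vector topology \<Rightarrow> 'a set \<Rightarrow> ('a \<Rightarrow> real) set set" where
  "cylinder_sets_over \<tau> F = cylinder_set \<tau> F ` sets (dual_quotient_borel \<tau> F)"

definition cylinder_sets :: "'a::real_vector topology \<Rightarrow> ('a \<Rightarrow> real) set set" where
  "cylinder_sets \<tau> = (\<Union>F\<in>finite_dim_subspaces \<tau>. cylinder_sets_over \<tau> F)"

text \<open>The values of \<open>\<mu>\<close> outside \<open>cylinder_sets \<tau>\<close> are irrelevant.\<close>

definition cylinder_measure ::
    "'a::real_vector topology \<Rightarrow> (('a \<Rightarrow> real) set \<Rightarrow> real) \<Rightarrow> bool" where
  "cylinder_measure \<tau> \<mu> \<longleftrightarrow>
     (\<forall>N\<in>cylinder_sets \<tau>. 0 \<le> \<mu> N \<and> \<mu> N \<le> 1) \<and>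
     \<mu> (continuous_dual \<tau>) = 1 \<and>
     (\<forall>F\<in>finite_dim_subspaces \<tau>. \<forall>N :: nat \<Rightarrow> ('a \<Rightarrow> real) set.
        range N \<subseteq> cylinder_sets_over \<tau> F \<and> disjoint_family N \<longrightarrow>
        (\<lambda>n. \<mu> (N n)) sums \<mu> (\<Union>n. N n))"

definition continuous_cylinder_measure ::
    "'a::real_vector topology \<Rightarrow> (('a \<Rightarrow> real) set \<Rightarrow> real) \<Rightarrow> bool" where
  "continuous_cylinder_measure \<tau> \<mu> \<longleftrightarrow>
     cylinder_measure \<tau> \<mu> \<and>
     (\<forall>\<epsilon>>0. \<forall>a>0. \<exists>U. openin \<tau> U \<and> 0 \<in> U \<and>
        (\<forall>t\<in>U. \<mu> {\<phi> \<in> continuous_dual \<tau>. a \<le> \<bar>\<phi> t\<bar>} \<le> \<epsilon>))"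

definition induced_measure ::
    "'a::real_vector topology \<Rightarrow> (('a \<Rightarrow> real) set \<Rightarrow> real) \<Rightarrow> 'a set \<Rightarrow> ('a \<Rightarrow> real) set measure" where
  "induced_measure \<tau> \<mu> F =
     measure_of (dual_quotient \<tau> F) (sets (dual_quotient_borel \<tau> F))
       (\<lambda>M. ennreal (\<mu> (cylinder_set \<tau> F M)))"

definition has_cylinder_integral ::
    "'a::real_vector topology \<Rightarrow> (('a \<Rightarrow> real) set \<Rightarrow> real) \<Rightarrow>
     (('a \<Rightarrow> real) \<Rightarrow> real) \<Rightarrow> real \<Rightarrow> bool" where
  "has_cylinder_integral \<tau> \<mu> g I \<longleftrightarrow>
     (\<exists>F\<in>finite_dim_subspaces \<tau>. \<exists>h\<in>borel_measurable (dual_quotient_borel \<tau> F).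
        (\<forall>l\<in>continuous_dual \<tau>. g l = h (dual_coset \<tau> F l)) \<and>
        integrable (induced_measure \<tau> \<mu> F) h \<and>
        I = integral\<^sup>L (induced_measure \<tau> \<mu> F) h)"

definition cylinder_integrable ::
    "'a::real_vector topology \<Rightarrow> (('a \<Rightarrow> real) set \<Rightarrow> real) \<Rightarrow> (('a \<Rightarrow> real) \<Rightarrow> real) \<Rightarrow> bool" where
  "cylinder_integrable \<tau> \<mu> g \<longleftrightarrow> (\<exists>I. has_cylinder_integral \<tau> \<mu> g I)"

text \<open>
  For a cylinder measure on the dual of a locally convex Hausdorff space the value does not depend
  on the subspace \<open>F\<close> through which \<open>g\<close> factors.
\<close>

definition cylinder_integral ::
    "'a::real_vector topology \<Rightarrow> (('a \<Rightarrow> real) set \<Rightarrow> real) \<Rightarrow> (('a \<Rightarrow> real) \<Rightarrow> real) \<Rightarrow> real" where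
  "cylinder_integral \<tau> \<mu> g = (THE I. has_cylinder_integral \<tau> \<mu> g I)"

definition represents ::
    "'a::{real_algebra_1, comm_ring_1} topology \<Rightarrow> ('a \<Rightarrow> real) \<Rightarrow> (('a \<Rightarrow> real) set \<Rightarrow> real) \<Rightarrow> bool" where
  "represents \<tau> L \<mu> \<longleftrightarrow>
     (\<forall>k. \<forall>t. \<forall>p\<in>mpoly_in k. (\<forall>i<k. t i \<in> topspace \<tau>) \<longrightarrow>
        cylinder_integrable \<tau> \<mu> (\<lambda>\<phi>. mpoly_eval p (\<lambda>i. \<phi> (t i))) \<and>
        L (mpoly_eval p t) = cylinder_integral \<tau> \<mu> (\<lambda>\<phi>. mpoly_eval p (\<lambda>i. \<phi> (t i))))"

text \<open>
  If \<open>topspace \<tau>\<close> and 1 generate the algebra, then a character is determined by its restriction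
  to \<open>topspace \<tau>\<close>.
\<close>

definition character_of ::
    "'a::{real_algebra_1, comm_ring_1} topology \<Rightarrow> ('a \<Rightarrow> real) \<Rightarrow> ('a \<Rightarrow> real)" where
  "character_of \<tau> \<phi> = (THE \<psi>. \<psi> \<in> characters \<and> restrict \<psi> (topspace \<tau>) = \<phi>)"

text \<open>
  Meaningful for linear \<open>L\<close>, and when every element of the continuous dual is the restriction of
  a character.
\<close>

definition moment_functional ::
    "'a::{real_algebra_1, comm_ring_1} topology \<Rightarrow> ('a \<Rightarrow> real) \<Rightarrow> bool" where
  "moment_functional \<tau> L \<longleftrightarrow>
     (\<exists>\<mu>. cylinder_measure \<tau> \<mu> \<and>
        (\<forall>f. cylinder_integrable \<tau> \<mu> (\<lambda>\<phi>. character_of \<tau> \<phi> f) \<and>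
             L f = cylinder_integral \<tau> \<mu> (\<lambda>\<phi>. character_of \<tau> \<phi> f)))"

end

theory Submission
  imports Defs "HOL-Library.Function_Algebras" "HOL-Probability.Probability"
begin

text \<open>
  Both assumptions imply that \<open>L\<close> is nonnegative on every polynomial expression in elements of \<open>T\<close> whose
  value is nonnegative at all linear functionals on \<open>T\<close>. For (i) this is immediate, as characters are
  linear. For (ii), Carleman's condition makes \<open>t \<mapsto> exp (i * t * x)\<close>, read modulo the closure of the
  polynomials in an \<open>L\<^sup>p\<close> seminorm of the functional \<open>p \<mapsto> L (p s)\<close>, a quasianalytic function all of whose
  derivatives vanish at \<open>0\<close>. Bang's argument shows that it vanishes, so trigonometric polynomials are limits
  of polynomials. Hence every power of \<open>s\<close> is a limit of quadrature sums whose weights are squares, and by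
  the Cauchy--Schwarz inequality one may multiply the quadratures of several generators.

  By M. Riesz, such an \<open>L\<close> extends to a positive functional on all functions of a linear functional that are
  dominated by polynomials, hence to a finitely additive probability. On functionals rounded to a grid it
  is given by countably many atoms because its moments are finite. Kolmogorov's theorem realizes the rounded
  functionals simultaneously, and their limit is a random linear functional with the moments of \<open>L\<close>. Since
  the continuous dual restricts onto the dual of every finite-dimensional subspace (Hahn--Banach), the
  distribution of this random functional is a cylinder measure on the continuous dual.
\<close>

section \<open>Pointwise algebra of functions\<close>

text \<open>The obstacle under (ii) is that a nonnegative polynomial in several variables need not
  be a sum of squares, so positivity on squares does not apply to it directly. In one variable the
  two notions agree; hence only the functionals \<open>p \<mapsto> L (p s)\<close> of a single
  generator extend at once, and the general case must be assembled from them inside the algebra.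
  This is why the quadrature weights have to be squares: in a commutative algebra products of
  squares are squares again, and \<open>L\<close> is nonnegative there. Multiplying approximations
  requires a mode of convergence that is stable under products: \<open>L (u ^ (2 * i))\<close> has
  to tend to 0 for every \<open>i \<ge> 1\<close>, not for \<open>i = 1\<close> alone. Consequently
  density of the polynomials is needed in all seminorms of exponent \<open>2 * r\<close>, and
  Carleman's condition must be passed on to each of them. The second obstacle is that the extended
  functional is only finitely additive. Dyadic rounding makes its finite-dimensional laws discrete,
  and for these finite moments already force countable additivity.\<close>

instantiation "fun" :: (type, real_vector) real_vector
begin

definition scaleR_fun :: "real \<Rightarrow> ('a \<Rightarrow> 'b) \<Rightarrow> 'a \<Rightarrow> 'b" where
  "c *\<^sub>R f = (\<lambda>x. c *\<^sub>R f x)"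

instance
  by standard (auto simp: scaleR_fun_def fun_eq_iff algebra_simps)

end

lemma scaleR_fun_apply [simp]: "(c *\<^sub>R f) x = c *\<^sub>R f x"
  by (simp add: scaleR_fun_def)

text \<open>With these instances one locale of positive functionals covers both the given algebra
  and the algebras of functions on functionals or on the line.\<close>

instance "fun" :: (type, real_algebra) real_algebra
  by standard (simp_all add: fun_eq_iff)

instance "fun" :: (type, real_algebra_1) real_algebra_1 ..

lemma power_fun_apply [simp]: "(f ^ n) x = (f x :: real) ^ n"
  by (induction n) simp_all

lemma sum_fun_apply: "(\<Sum>i\<in>I. f i) x = (\<Sum>i\<in>I. f i x :: real)"
  by (induction I rule: infinite_finite_induct) simp_all

lemma abs_le_one_plus_square: "\<bar>x\<bar> \<le> 1 + x * x" for x :: real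
proof -
  have "0 \<le> (\<bar>x\<bar> - 1)\<^sup>2 + x\<^sup>2" by simp
  then show ?thesis by (simp add: power2_eq_square algebra_simps abs_mult_self_eq)
qed

section \<open>Extension of positive functionals\<close>

text \<open>A functional on a subspace is encoded by its graph \<open>G\<close>, so Zorn's lemma
  applies to inclusion of graphs. Single-valuedness comes from \<open>pos\<close> applied to
  differences, because \<open>0 \<in> K\<close>. The cofinality \<open>cof\<close> bounds the
  admissible values at a new vector from both sides.\<close>

lemma riesz_extension:
  fixes G :: "('v::real_vector \<times> real) set" and K W :: "'v set"
  assumes G: "subspace G"
    and K_add: "\<And>x y. x \<in> K \<Longrightarrow> y \<in> K \<Longrightarrow> x + y \<in> K"
    and K_scale: "\<And>c x. c \<ge> 0 \<Longrightarrow> x \<in> K \<Longrightarrow> c *\<^sub>R x \<in> K"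
    and K_0: "0 \<in> K"
    and W: "subspace W" and GW: "fst ` G \<subseteq> W"
    and pos: "\<And>v r. (v, r) \<in> G \<Longrightarrow> v \<in> K \<Longrightarrow> 0 \<le> r"
    and cof: "\<And>w. w \<in> W \<Longrightarrow> \<exists>v r. (v, r) \<in> G \<and> v - w \<in> K"
  obtains \<Lambda> :: "'v \<Rightarrow> real" where "\<And>v r. (v, r) \<in> G \<Longrightarrow> \<Lambda> v = r"
    and "\<And>x y. x \<in> W \<Longrightarrow> y \<in> W \<Longrightarrow> \<Lambda> (x + y) = \<Lambda> x + \<Lambda> y"
    and "\<And>c x. x \<in> W \<Longrightarrow> \<Lambda> (c *\<^sub>R x) = c * \<Lambda> x"
    and "\<And>x. x \<in> W \<Longrightarrow> x \<in> K \<Longrightarrow> 0 \<le> \<Lambda> x"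
proof -
  define A where "A = {H. subspace H \<and> G \<subseteq> H \<and> fst ` H \<subseteq> W \<and> (\<forall>v r. (v, r) \<in> H \<longrightarrow> v \<in> K \<longrightarrow> 0 \<le> r)}"
  have "\<exists>M\<in>A. \<forall>X\<in>A. M \<subseteq> X \<longrightarrow> X = M"
  proof (rule subset_Zorn_nonempty)
    show "A \<noteq> {}" using G GW pos by (auto simp: A_def)
    fix C assume C: "C \<noteq> {}" "subset.chain A C"
    have CA: "C \<subseteq> A" using C by (auto simp: subset_chain_def)
    have tot: "X \<subseteq> Y \<or> Y \<subseteq> X" if "X \<in> C" "Y \<in> C" for X Y
      using C that by (auto simp: subset_chain_def)
    have sub: "subspace X" if "X \<in> C" for X using CA that by (auto simp: A_def)
    have "subspace (\<Union>C)"
      unfolding subspace_def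
    proof (intro conjI ballI allI)
      show "0 \<in> \<Union>C" using C(1) sub subspace_0 by blast
      fix x y assume "x \<in> \<Union>C" "y \<in> \<Union>C"
      then obtain X Y where "x \<in> X" "y \<in> Y" "X \<in> C" "Y \<in> C" by blast
      then show "x + y \<in> \<Union>C" using tot[of X Y] sub subspace_add by blast
    next
      fix c x assume "x \<in> \<Union>C"
      then show "c *\<^sub>R x \<in> \<Union>C" using sub subspace_scale by blast
    qed
    moreover have "G \<subseteq> \<Union>C"
    proof -
      obtain X where "X \<in> C" using C(1) by blast
      then have "X \<in> A" using CA by blast
      then have "G \<subseteq> X" by (simp add: A_def)
      with \<open>X \<in> C\<close> show ?thesis by blast
    qed
    moreover have "fst ` X \<subseteq> W \<and> (\<forall>v r. (v, r) \<in> X \<longrightarrow> v \<in> K \<longrightarrow> 0 \<le> r)" if "X \<in> C" for X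
    proof -
      have "X \<in> A" using CA that by blast
      then show ?thesis by (simp add: A_def)
    qed
    then have "fst ` \<Union>C \<subseteq> W" "\<forall>v r. (v, r) \<in> \<Union>C \<longrightarrow> v \<in> K \<longrightarrow> 0 \<le> r" by blast+
    ultimately show "\<Union>C \<in> A" by (simp add: A_def)
  qed
  then obtain M where MA: "M \<in> A" and max: "\<And>X. X \<in> A \<Longrightarrow> M \<subseteq> X \<Longrightarrow> X = M" by blast
  have M: "subspace M" and GM: "G \<subseteq> M" and MW: "fst ` M \<subseteq> W"
    and Mpos: "\<And>v r. (v, r) \<in> M \<Longrightarrow> v \<in> K \<Longrightarrow> 0 \<le> r"
    using MA by (auto simp: A_def)
  have Mdiff: "(v - v', r - r') \<in> M" if "(v, r) \<in> M" "(v', r') \<in> M" for v v' r r'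
    using subspace_diff[OF M that] by simp
  have Mscale: "(c *\<^sub>R v, c * r) \<in> M" if "(v, r) \<in> M" for c v r
    using subspace_scale[OF M that, of c] by simp
  have Madd: "(v + v', r + r') \<in> M" if "(v, r) \<in> M" "(v', r') \<in> M" for v v' r r'
    using subspace_add[OF M that] by simp
  have Mle: "r \<le> r'" if "(v, r) \<in> M" "(v', r') \<in> M" "v' - v \<in> K" for v v' r r'
    using Mpos[OF Mdiff[OF that(2,1)] that(3)] by simp
  have uniq: "r = r'" if "(v, r) \<in> M" "(v, r') \<in> M" for v r r'
    using Mle[OF that] Mle[OF that(2,1)] K_0 by simp
  have dom: "\<exists>r. (w, r) \<in> M" if w: "w \<in> W" for w
  proof (rule ccontr)
    assume nd: "\<nexists>r. (w, r) \<in> M"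
    \<comment> \<open>\<open>B\<close> collects the values forced on \<open>w\<close> from below.
      Cofinality at \<open>- w\<close> makes it nonempty, cofinality at \<open>w\<close> bounds it,
      and its supremum becomes the value at \<open>w\<close>.\<close>
    define B where "B = {r. \<exists>v. (v, r) \<in> M \<and> w - v \<in> K}"
    have "- w \<in> W" using w W by (simp add: subspace_neg)
    then obtain v r where vr: "(v, r) \<in> G" "v - (- w) \<in> K" using cof by blast
    have "(- v, - r) \<in> M" using Mscale[of v r "-1"] vr GM by auto
    then have B_ne: "B \<noteq> {}" using vr(2) by (auto simp: B_def intro!: exI[of _ "-r"] exI[of _ "-v"] simp: algebra_simps)
    have B_le: "b \<le> r" if "b \<in> B" "(v, r) \<in> M" "v - w \<in> K" for b v r
    proof -
      obtain u where u: "(u, b) \<in> M" "w - u \<in> K" using \<open>b \<in> B\<close> by (auto simp: B_def)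
      have "v - u \<in> K" using K_add[OF that(3) u(2)] by simp
      then show ?thesis using Mle[OF u(1) that(2)] by simp
    qed
    obtain v0 r0 where v0: "(v0, r0) \<in> M" "v0 - w \<in> K" using cof[OF w] GM by blast
    have bdd: "bdd_above B" using B_le[OF _ v0] by (auto simp: bdd_above_def)
    define a where "a = Sup B"
    define M' where "M' = {x + y |x y. x \<in> M \<and> y \<in> span {(w, a)}}"
    have M'I: "(v + c *\<^sub>R w, r + c * a) \<in> M'" if "(v, r) \<in> M" for v r c
    proof -
      have "(v + c *\<^sub>R w, r + c * a) = (v, r) + c *\<^sub>R (w, a)" by simp
      moreover have "c *\<^sub>R (w, a) \<in> span {(w, a)}" by (rule span_scale[OF span_base]) simp
      ultimately show ?thesis using that unfolding M'_def by blast
    qed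
    have M'E: "\<exists>v r c. (v, r) \<in> M \<and> p = (v + c *\<^sub>R w, r + c * a)" if "p \<in> M'" for p
      using that by (auto simp: M'_def span_singleton)
    have "M' \<in> A"
      unfolding A_def mem_Collect_eq
    proof (intro conjI allI impI)
      show "subspace M'" unfolding M'_def by (rule subspace_sums) (auto simp: M)
      have "M \<subseteq> M'" using M'I[of _ _ 0] by auto
      then show "G \<subseteq> M'" using GM by blast
      show "fst ` M' \<subseteq> W"
        using MW w W by (fastforce dest!: M'E intro: subspace_add subspace_scale)
      fix u s assume "(u, s) \<in> M'" and uK: "u \<in> K"
      then obtain v r c where vr: "(v, r) \<in> M" and u: "u = v + c *\<^sub>R w" and s: "s = r + c * a"
        using M'E by blast
      \<comment> \<open>Dividing by \<open>\<bar>c\<bar>\<close> turns membership in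
        \<open>K\<close> into a comparison of \<open>w\<close> with an element of the old domain,
        from below or from above according to the sign of \<open>c\<close>.\<close>
      consider "c = 0" | "c > 0" | "c < 0" by linarith
      then show "0 \<le> s"
      proof cases
        case 1 then show ?thesis using Mpos vr u s uK by simp
      next
        case 2
        have "(1 / c) *\<^sub>R u \<in> K" using K_scale[OF _ uK, of "1/c"] 2 by simp
        also have "(1 / c) *\<^sub>R u = w - (- (1/c)) *\<^sub>R v" using 2 by (simp add: u algebra_simps)
        finally have "(- (1/c)) * r \<in> B" using Mscale[OF vr, of "- (1/c)"] unfolding B_def by blast
        then have "(- (1/c)) * r \<le> a" unfolding a_def by (rule cSup_upper[OF _ bdd])
        then show ?thesis using 2 by (simp add: s field_simps)
      next
        case 3
        have "(- 1 / c) *\<^sub>R u \<in> K" using K_scale[OF _ uK, of "-1/c"] 3 by simp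
        also have "(- 1 / c) *\<^sub>R u = (- 1/c) *\<^sub>R v - w" using 3 by (simp add: u algebra_simps)
        finally have "b \<le> (- 1/c) * r" if "b \<in> B" for b
          using B_le[OF that Mscale[OF vr, of "- 1/c"]] by simp
        then have "a \<le> (- 1/c) * r" unfolding a_def by (intro cSup_least B_ne)
        then show ?thesis using 3 by (simp add: s field_simps)
      qed
    qed
    moreover have "M \<subseteq> M'" using M'I[of _ _ 0] by auto
    ultimately have "M' = M" using max by blast
    moreover have "(0, 0) \<in> M" using subspace_0[OF M] by (simp add: zero_prod_def)
    then have "(w, a) \<in> M'" using M'I[of 0 0 1] by simp
    ultimately show False using nd by blast
  qed
  define \<Lambda> where "\<Lambda> w = (THE r. (w, r) \<in> M)" for w
  have \<Lambda>I: "\<Lambda> v = r" if "(v, r) \<in> M" for v r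
    unfolding \<Lambda>_def using that uniq by blast
  show ?thesis
  proof (rule that)
    show "\<Lambda> v = r" if "(v, r) \<in> G" for v r using that GM \<Lambda>I by blast
    show "\<Lambda> (x + y) = \<Lambda> x + \<Lambda> y" if "x \<in> W" "y \<in> W" for x y
      using dom[OF that(1)] dom[OF that(2)] Madd \<Lambda>I by metis
    show "\<Lambda> (c *\<^sub>R x) = c * \<Lambda> x" if "x \<in> W" for c x
      using dom[OF that] Mscale \<Lambda>I by metis
    show "0 \<le> \<Lambda> x" if "x \<in> W" "x \<in> K" for x
      using dom[OF that(1)] Mpos that(2) \<Lambda>I by metis
  qed
qed

section \<open>Positive functionals: Cauchy--Schwarz and convergence in all even moments\<close>

locale positive_functional =
  fixes B :: "'b::{real_algebra_1, comm_ring_1} set" and L :: "'b \<Rightarrow> real"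
  assumes subalgebra: "is_subalgebra B"
    and L_add: "a \<in> B \<Longrightarrow> b \<in> B \<Longrightarrow> L (a + b) = L a + L b"
    and L_scale: "a \<in> B \<Longrightarrow> L (c *\<^sub>R a) = c * L a"
    and L_square: "a \<in> B \<Longrightarrow> 0 \<le> L (a * a)"
    and L_one: "L 1 = 1"
begin

lemma B_subspace: "subspace B"
  and B_one [simp]: "1 \<in> B"
  and B_mult [simp]: "a \<in> B \<Longrightarrow> b \<in> B \<Longrightarrow> a * b \<in> B"
  using subalgebra by (auto simp: is_subalgebra_def)

lemma B_zero [simp]: "0 \<in> B"
  and B_add [simp]: "a \<in> B \<Longrightarrow> b \<in> B \<Longrightarrow> a + b \<in> B"
  and B_diff [simp]: "a \<in> B \<Longrightarrow> b \<in> B \<Longrightarrow> a - b \<in> B"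
  and B_scale [simp]: "a \<in> B \<Longrightarrow> c *\<^sub>R a \<in> B"
  and B_sum: "(\<And>i. i \<in> I \<Longrightarrow> f i \<in> B) \<Longrightarrow> sum f I \<in> B"
  using B_subspace by (simp_all add: subspace_0 subspace_add subspace_diff subspace_scale subspace_sum)

lemma B_power [simp]: "a \<in> B \<Longrightarrow> a ^ n \<in> B"
  by (induction n) simp_all

lemma L_zero [simp]: "L 0 = 0"
  using L_scale[of 0 0] by simp

lemma L_diff: "a \<in> B \<Longrightarrow> b \<in> B \<Longrightarrow> L (a - b) = L a - L b"
  using L_add[of a "- b"] L_scale[of b "-1"] B_scale[of b "-1"] by simp

lemma L_sum: "(\<And>i. i \<in> I \<Longrightarrow> f i \<in> B) \<Longrightarrow> L (sum f I) = (\<Sum>i\<in>I. L (f i))"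
proof (induction I rule: infinite_finite_induct)
  case (insert i I)
  then show ?case by (simp add: L_add B_sum)
qed simp_all

lemma L_even_power: "a \<in> B \<Longrightarrow> 0 \<le> L (a ^ (2 * i))"
  using L_square[of "a ^ i"] by (simp add: power_add[symmetric] mult_2)

lemma cauchy_schwarz:
  assumes a: "a \<in> B" and b: "b \<in> B"
  shows "(L (a * b))\<^sup>2 \<le> L (a * a) * L (b * b)"
proof -
  have q: "0 \<le> L (a * a) + 2 * t * L (a * b) + t\<^sup>2 * L (b * b)" for t
  proof -
    have "(a + t *\<^sub>R b) * (a + t *\<^sub>R b) = a * a + (2 * t) *\<^sub>R (a * b) + t\<^sup>2 *\<^sub>R (b * b)"
      by (simp add: algebra_simps power2_eq_square scaleR_2 flip: scaleR_scaleR)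
    then show ?thesis
      using L_square[of "a + t *\<^sub>R b"] a b by (simp add: L_add L_scale)
  qed
  show ?thesis
  proof (cases "L (b * b) = 0")
    case True
    have "L (a * b) = 0"
    proof (rule ccontr)
      assume ne: "L (a * b) \<noteq> 0"
      \<comment> \<open>With \<open>L (b * b) = 0\<close> the quadratic is affine in
        \<open>t\<close>; this is the \<open>t\<close> at which it equals -1.\<close>
      have "L (a * a) + 2 * (- (L (a * a) + 1) / (2 * L (a * b))) * L (a * b) = - 1"
        using ne by (simp add: field_simps)
      then show False using q[of "- (L (a * a) + 1) / (2 * L (a * b))"] True by simp
    qed
    then show ?thesis using True by simp
  next
    case False
    then have p: "L (b * b) > 0" using L_square[OF b] by simp
    have "L (a * a) + 2 * (- L (a * b) / L (b * b)) * L (a * b) + (- L (a * b) / L (b * b))\<^sup>2 * L (b * b)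
      = L (a * a) - (L (a * b))\<^sup>2 / L (b * b)"
      using p by (simp add: field_simps power2_eq_square)
    with q[of "- L (a * b) / L (b * b)"] have "(L (a * b))\<^sup>2 / L (b * b) \<le> L (a * a)" by simp
    then show ?thesis using p by (simp add: field_simps)
  qed
qed

lemma cauchy_schwarz_powers:
  assumes "u \<in> B" "v \<in> B"
  shows "\<bar>L (u ^ k * v ^ j)\<bar> \<le> sqrt (L (u ^ (2 * k)) * L (v ^ (2 * j)))"
  using cauchy_schwarz[of "u ^ k" "v ^ j"] assms
  by (intro real_le_rsqrt) (simp add: power_add[symmetric] mult_2)

text \<open>With all even powers in the condition, Cauchy--Schwarz makes null sequences absorb
  products with bounded ones, which a condition on the second power alone would not give.\<close>

definition null_seq :: "(nat \<Rightarrow> 'b) \<Rightarrow> bool" where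
  "null_seq u \<longleftrightarrow> range u \<subseteq> B \<and> (\<forall>i\<ge>1. (\<lambda>n. L (u n ^ (2 * i))) \<longlonglongrightarrow> 0)"

definition bounded_seq :: "(nat \<Rightarrow> 'b) \<Rightarrow> bool" where
  "bounded_seq u \<longleftrightarrow> range u \<subseteq> B \<and> (\<forall>i. Bseq (\<lambda>n. L (u n ^ (2 * i))))"

lemma null_seq_in: "null_seq u \<Longrightarrow> u n \<in> B"
  and bounded_seq_in: "bounded_seq u \<Longrightarrow> u n \<in> B"
  by (auto simp: null_seq_def bounded_seq_def)

lemma null_imp_bounded: "null_seq u \<Longrightarrow> bounded_seq u"
  unfolding bounded_seq_def
proof (intro conjI allI)
  fix i assume u: "null_seq u"
  show "Bseq (\<lambda>n. L (u n ^ (2 * i)))"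
    using u by (cases i) (auto simp: null_seq_def intro!: convergent_imp_Bseq convergentI)
qed (simp add: null_seq_def)

lemma bounded_const: "a \<in> B \<Longrightarrow> bounded_seq (\<lambda>_. a)"
  by (auto simp: bounded_seq_def)

lemma null_zero: "null_seq (\<lambda>_. 0)"
  by (auto simp: null_seq_def power_0_left)

lemma tendsto_null_bounded:
  assumes u: "null_seq u" and v: "bounded_seq v" and "k \<ge> 1"
  shows "(\<lambda>n. L (u n ^ k * v n ^ j)) \<longlonglongrightarrow> 0"
proof -
  have "(\<lambda>n. L (u n ^ (2 * k)) * L (v n ^ (2 * j))) \<longlonglongrightarrow> 0"
  proof -
    have "Bseq (\<lambda>n. L (v n ^ (2 * j)))" using v by (simp add: bounded_seq_def)
    then obtain C where "\<And>n. norm (L (v n ^ (2 * j))) \<le> C" by (rule BseqE) blast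
    then show ?thesis
      using u \<open>k \<ge> 1\<close>
      by (intro lim_null_mult_right_bounded[where B = C]) (auto simp: null_seq_def)
  qed
  then have "(\<lambda>n. sqrt (L (u n ^ (2 * k)) * L (v n ^ (2 * j)))) \<longlonglongrightarrow> 0"
    using tendsto_real_sqrt by fastforce
  then show ?thesis
    by (rule Lim_null_comparison[rotated])
       (simp add: cauchy_schwarz_powers null_seq_in[OF u] bounded_seq_in[OF v])
qed

lemma tendsto_null:
  assumes "null_seq u"
  shows "(\<lambda>n. L (u n)) \<longlonglongrightarrow> 0"
  using tendsto_null_bounded[OF assms bounded_const[OF B_one], of 1 0] by simp

lemma Bseq_bounded:
  assumes u: "bounded_seq u" and v: "bounded_seq v"
  shows "Bseq (\<lambda>n. L (u n ^ k * v n ^ j))"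
proof -
  have "Bseq (\<lambda>n. L (u n ^ (2 * k)))" "Bseq (\<lambda>n. L (v n ^ (2 * j)))"
    using u v by (simp_all add: bounded_seq_def)
  then obtain C D where C: "\<And>n. \<bar>L (u n ^ (2 * k))\<bar> \<le> C" and D: "\<And>n. \<bar>L (v n ^ (2 * j))\<bar> \<le> D"
    unfolding Bseq_def real_norm_def by blast
  show ?thesis
  proof (rule BseqI')
    fix n
    have "\<bar>L (u n ^ k * v n ^ j)\<bar> \<le> sqrt (L (u n ^ (2 * k)) * L (v n ^ (2 * j)))"
      by (intro cauchy_schwarz_powers bounded_seq_in u v)
    also have "\<dots> \<le> sqrt (C * D)"
      using C[of n] D[of n] L_even_power[OF bounded_seq_in[OF v]]
      by (intro real_sqrt_le_mono mult_mono) auto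
    finally show "norm (L (u n ^ k * v n ^ j)) \<le> sqrt (C * D)" by simp
  qed
qed

lemma L_binomial:
  assumes "a \<in> B" "b \<in> B"
  shows "L ((a + b) ^ m) = (\<Sum>k\<le>m. real (m choose k) * L (a ^ k * b ^ (m - k)))"
proof -
  have *: "of_nat n * x = real n *\<^sub>R x" for n and x :: 'b
    by (simp add: scaleR_conv_of_real)
  have "(a + b) ^ m = (\<Sum>k\<le>m. real (m choose k) *\<^sub>R (a ^ k * b ^ (m - k)))"
    by (simp add: binomial_ring mult.assoc *)
  then show ?thesis using assms by (simp add: L_sum L_scale)
qed

text \<open>In every term of the binomial expansion of a positive power at least one exponent is
  positive; that factor is null, the other one bounded.\<close>

lemma null_add:
  assumes u: "null_seq u" and v: "null_seq v"
  shows "null_seq (\<lambda>n. u n + v n)"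
  unfolding null_seq_def
proof (intro conjI allI impI)
  show "range (\<lambda>n. u n + v n) \<subseteq> B" using u v by (auto simp: null_seq_in)
  fix i :: nat assume i: "i \<ge> 1"
  have "(\<lambda>n. L (u n ^ k * v n ^ (2 * i - k))) \<longlonglongrightarrow> 0" for k
  proof (cases "k \<ge> 1")
    case True then show ?thesis using tendsto_null_bounded[OF u null_imp_bounded[OF v]] by blast
  next
    case False
    then have "2 * i - k \<ge> 1" using i by simp
    then show ?thesis
      using tendsto_null_bounded[OF v null_imp_bounded[OF u], of "2 * i - k" k] by (simp add: mult.commute)
  qed
  then have "(\<lambda>n. \<Sum>k\<le>2 * i. real (2 * i choose k) * L (u n ^ k * v n ^ (2 * i - k))) \<longlonglongrightarrow> 0"
    by (intro tendsto_null_sum tendsto_mult_right_zero)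
  then show "(\<lambda>n. L ((u n + v n) ^ (2 * i))) \<longlonglongrightarrow> 0"
    using u v by (simp add: L_binomial null_seq_in)
qed

lemma bounded_add:
  assumes u: "bounded_seq u" and v: "bounded_seq v"
  shows "bounded_seq (\<lambda>n. u n + v n)"
  unfolding bounded_seq_def
proof (intro conjI allI)
  show "range (\<lambda>n. u n + v n) \<subseteq> B" using u v by (auto simp: bounded_seq_in)
  fix i :: nat
  have "Bseq (\<lambda>n. \<Sum>k\<in>K. real (2 * i choose k) * L (u n ^ k * v n ^ (2 * i - k)))" for K
  proof (induction K rule: infinite_finite_induct)
    case (insert x F)
    have "Bseq (\<lambda>n. real (2 * i choose x) * L (u n ^ x * v n ^ (2 * i - x)))"
      by (intro Bseq_mult Bseq_bounded u v) simp
    then obtain C D where "\<And>n. \<bar>real (2 * i choose x) * L (u n ^ x * v n ^ (2 * i - x))\<bar> \<le> C"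
      "\<And>n. \<bar>\<Sum>k\<in>F. real (2 * i choose k) * L (u n ^ k * v n ^ (2 * i - k))\<bar> \<le> D"
      using insert unfolding Bseq_def real_norm_def by blast
    then show ?case using insert.hyps
      by (intro BseqI'[of _ "C + D"]) (simp add: order_trans[OF abs_triangle_ineq add_mono])
  qed simp_all
  then show "Bseq (\<lambda>n. L ((u n + v n) ^ (2 * i)))"
    using u v by (simp add: L_binomial bounded_seq_in)
qed

lemma null_mult:
  assumes u: "null_seq u" and v: "bounded_seq v"
  shows "null_seq (\<lambda>n. u n * v n)"
  using tendsto_null_bounded[OF u v] null_seq_in[OF u] bounded_seq_in[OF v]
  by (auto simp: null_seq_def power_mult_distrib)

lemma null_scale: "null_seq u \<Longrightarrow> null_seq (\<lambda>n. c *\<^sub>R u n)"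
  using null_mult[OF _ bounded_const[OF B_scale[OF B_one]], of u c] by simp

lemma null_sum: "(\<And>i. i \<in> I \<Longrightarrow> null_seq (u i)) \<Longrightarrow> null_seq (\<lambda>n. \<Sum>i\<in>I. u i n)"
  by (induction I rule: infinite_finite_induct) (simp_all add: null_zero null_add)

lemma bounded_if_null_diff:
  assumes "a \<in> B" "null_seq (\<lambda>n. a - v n)"
  shows "bounded_seq v"
  using bounded_add[OF bounded_const[OF assms(1)]
      null_imp_bounded[OF null_scale[OF assms(2), of "-1"]]] by simp

lemma null_diff_mult:
  assumes a: "a \<in> B" "null_seq (\<lambda>n. a - u n)" and b: "b \<in> B" "null_seq (\<lambda>n. b - v n)"
  shows "null_seq (\<lambda>n. a * b - u n * v n)"
proof -
  have "null_seq (\<lambda>n. (a - u n) * b + (b - v n) * u n)"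
    by (intro null_add null_mult a b bounded_const bounded_if_null_diff[OF a])
  moreover have "(a - u n) * b + (b - v n) * u n = a * b - u n * v n" for n
    by (simp add: algebra_simps)
  ultimately show ?thesis by simp
qed

lemma null_diff_prod:
  assumes "finite S" "\<And>s. s \<in> S \<Longrightarrow> a s \<in> B" "\<And>s. s \<in> S \<Longrightarrow> null_seq (\<lambda>n. a s - u s n)"
  shows "prod a S \<in> B \<and> null_seq (\<lambda>n. prod a S - (\<Prod>s\<in>S. u s n))"
  using assms by (induction S rule: finite_induct) (auto simp: null_zero intro!: null_diff_mult)

end

text \<open>\<open>solid\<close> puts every function bounded on \<open>X\<close> into
  \<open>W\<close>, in particular all indicators; thus \<open>\<Lambda>\<close> behaves as
  integration against a finitely additive probability on \<open>X\<close>, and values off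
  \<open>X\<close> do not matter.\<close>

locale dominated_functional = positive_functional W \<Lambda>
  for X :: "'x set" and W :: "('x \<Rightarrow> real) set" and \<Lambda> :: "('x \<Rightarrow> real) \<Rightarrow> real" +
  assumes solid: "f \<in> W \<Longrightarrow> (\<And>x. x \<in> X \<Longrightarrow> \<bar>g x\<bar> \<le> \<bar>f x\<bar>) \<Longrightarrow> g \<in> W"
    and nonneg: "f \<in> W \<Longrightarrow> (\<And>x. x \<in> X \<Longrightarrow> 0 \<le> f x) \<Longrightarrow> 0 \<le> \<Lambda> f"
begin

lemma mono: "f \<in> W \<Longrightarrow> g \<in> W \<Longrightarrow> (\<And>x. x \<in> X \<Longrightarrow> f x \<le> g x) \<Longrightarrow> \<Lambda> f \<le> \<Lambda> g"
  using nonneg[of "g - f"] by (simp add: L_diff)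

lemma cong: "f \<in> W \<Longrightarrow> g \<in> W \<Longrightarrow> (\<And>x. x \<in> X \<Longrightarrow> f x = g x) \<Longrightarrow> \<Lambda> f = \<Lambda> g"
  by (intro antisym mono) auto

lemma W_const: "(\<lambda>_. c) \<in> W" and L_const: "\<Lambda> (\<lambda>_. c) = c"
proof -
  have *: "(\<lambda>_::'x. c) = c *\<^sub>R 1" by (simp add: fun_eq_iff)
  show "(\<lambda>_. c) \<in> W" "\<Lambda> (\<lambda>_. c) = c" unfolding * by (simp_all add: L_scale L_one)
qed

lemma W_plus: "f \<in> W \<Longrightarrow> g \<in> W \<Longrightarrow> (\<lambda>x. f x + g x) \<in> W"
  and L_plus: "f \<in> W \<Longrightarrow> g \<in> W \<Longrightarrow> \<Lambda> (\<lambda>x. f x + g x) = \<Lambda> f + \<Lambda> g"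
  using B_add[of f g] L_add[of f g] by (simp_all add: plus_fun_def)

lemma W_cmult: "f \<in> W \<Longrightarrow> (\<lambda>x. c * f x) \<in> W"
  and L_cmult: "f \<in> W \<Longrightarrow> \<Lambda> (\<lambda>x. c * f x) = c * \<Lambda> f"
  using B_scale[of f c] L_scale[of f c] by (simp_all add: scaleR_fun_def)

lemma W_times: "f \<in> W \<Longrightarrow> g \<in> W \<Longrightarrow> (\<lambda>x. f x * g x) \<in> W"
  using B_mult[of f g] by (simp add: times_fun_def)

lemma W_power: "f \<in> W \<Longrightarrow> (\<lambda>x. f x ^ n) \<in> W"
  by (induction n) (simp_all add: W_const W_times)

lemma W_bounded: "(\<And>x. x \<in> X \<Longrightarrow> \<bar>g x\<bar> \<le> c) \<Longrightarrow> g \<in> W"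
  by (rule solid[OF W_const[of c]]) force

end

text \<open>\<open>W\<close> is taken as the functions dominated on \<open>X\<close> by some
  function of \<open>G\<close>, which supplies the cofinality for \<open>riesz_extension\<close>.
  The bound \<open>\<bar>f x\<bar> \<le> 1 + f x * f x\<close> puts the functions of
  \<open>G\<close> themselves inside, and products of dominating functions make \<open>W\<close> an
  algebra.\<close>

lemma positive_extension:
  fixes G :: "(('x \<Rightarrow> real) \<times> real) set" and X :: "'x set"
  assumes G: "subspace G" and one: "(1, 1) \<in> G"
    and mult: "\<And>f g r s. (f, r) \<in> G \<Longrightarrow> (g, s) \<in> G \<Longrightarrow> f * g \<in> fst ` G"
    and pos: "\<And>f r. (f, r) \<in> G \<Longrightarrow> (\<And>x. x \<in> X \<Longrightarrow> 0 \<le> f x) \<Longrightarrow> 0 \<le> r"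
  obtains W \<Lambda> where "dominated_functional X W \<Lambda>" "\<And>f r. (f, r) \<in> G \<Longrightarrow> f \<in> W \<and> \<Lambda> f = r"
    "\<And>f. f \<in> W \<Longrightarrow> \<exists>g\<in>fst ` G. \<forall>x\<in>X. \<bar>f x\<bar> \<le> g x"
proof -
  define W where "W = {f. \<exists>g\<in>fst ` G. \<forall>x\<in>X. \<bar>f x\<bar> \<le> g x}"
  define K where "K = {f. \<forall>x\<in>X. 0 \<le> (f x :: real)}"
  have fG: "subspace (fst ` G)" by (rule linear_subspace_image[OF linear_fst G])
  have one': "1 \<in> fst ` G" using one by force
  have mult': "f * g \<in> fst ` G" if "f \<in> fst ` G" "g \<in> fst ` G" for f g using that mult by auto
  have sub: "subspace W"
    unfolding subspace_def
  proof (intro conjI ballI allI)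
    show "0 \<in> W" unfolding W_def using subspace_0[OF fG] by (intro CollectI bexI[of _ 0]) simp_all
    fix f g assume "f \<in> W" "g \<in> W"
    then obtain f' g' where "f' \<in> fst ` G" "g' \<in> fst ` G" "\<forall>x\<in>X. \<bar>f x\<bar> \<le> f' x" "\<forall>x\<in>X. \<bar>g x\<bar> \<le> g' x"
      by (auto simp: W_def)
    then show "f + g \<in> W" unfolding W_def mem_Collect_eq
      by (intro bexI[of _ "f' + g'"] subspace_add[OF fG] ballI) fastforce+
  next
    fix c f assume "f \<in> W"
    then obtain f' where "f' \<in> fst ` G" "\<forall>x\<in>X. \<bar>f x\<bar> \<le> f' x" by (auto simp: W_def)
    then show "c *\<^sub>R f \<in> W" unfolding W_def mem_Collect_eq
      by (intro bexI[of _ "\<bar>c\<bar> *\<^sub>R f'"] subspace_scale[OF fG]) (auto simp: abs_mult intro: mult_left_mono)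
  qed
  have oneW: "1 \<in> W" unfolding W_def using one' by force
  have multW: "f * g \<in> W" if fg: "f \<in> W" "g \<in> W" for f g
  proof -
    obtain f' g' where "f' \<in> fst ` G" "g' \<in> fst ` G" "\<forall>x\<in>X. \<bar>f x\<bar> \<le> f' x" "\<forall>x\<in>X. \<bar>g x\<bar> \<le> g' x"
      using fg by (auto simp: W_def)
    then show ?thesis unfolding W_def mem_Collect_eq
      by (intro bexI[of _ "f' * g'"] mult') (simp_all add: abs_mult mult_mono')
  qed
  have GW: "fst ` G \<subseteq> W"
  proof
    fix f assume f: "f \<in> fst ` G"
    have "\<bar>f x\<bar> \<le> (1 + f * f) x" for x
      using abs_le_one_plus_square[of "f x"] by simp
    moreover have "1 + f * f \<in> fst ` G" by (intro subspace_add[OF fG] one' mult' f)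
    ultimately show "f \<in> W" unfolding W_def by blast
  qed
  obtain \<Lambda> where \<Lambda>: "\<And>v r. (v, r) \<in> G \<Longrightarrow> \<Lambda> v = r"
    "\<And>x y. x \<in> W \<Longrightarrow> y \<in> W \<Longrightarrow> \<Lambda> (x + y) = \<Lambda> x + \<Lambda> y"
    "\<And>c x. x \<in> W \<Longrightarrow> \<Lambda> (c *\<^sub>R x) = c * \<Lambda> x"
    "\<And>x. x \<in> W \<Longrightarrow> x \<in> K \<Longrightarrow> 0 \<le> \<Lambda> x"
  proof (rule riesz_extension[OF G, of K W])
    show "\<And>x y. x \<in> K \<Longrightarrow> y \<in> K \<Longrightarrow> x + y \<in> K" "\<And>c x. c \<ge> 0 \<Longrightarrow> x \<in> K \<Longrightarrow> c *\<^sub>R x \<in> K" "0 \<in> K"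
      by (auto simp: K_def)
    show "\<And>v r. (v, r) \<in> G \<Longrightarrow> v \<in> K \<Longrightarrow> 0 \<le> r" using pos by (auto simp: K_def)
    show "\<exists>v r. (v, r) \<in> G \<and> v - w \<in> K" if w: "w \<in> W" for w
    proof -
      obtain g where g: "g \<in> fst ` G" "\<forall>x\<in>X. \<bar>w x\<bar> \<le> g x" using w unfolding W_def by blast
      from g(1) obtain r where r: "(g, r) \<in> G" by (metis imageE prod.collapse)
      have "0 \<le> (g - w) x" if "x \<in> X" for x using bspec[OF g(2) that] by simp
      then have "g - w \<in> K" by (simp add: K_def)
      with r show ?thesis by blast
    qed
  qed (use sub GW in auto)
  have "is_subalgebra W" unfolding is_subalgebra_def using sub oneW multW by blast
  then have "dominated_functional X W \<Lambda>"
  proof (unfold_locales)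
    show "0 \<le> \<Lambda> (a * a)" if "a \<in> W" for a
      by (rule \<Lambda>(4)) (use multW that in \<open>auto simp: K_def\<close>)
    show "\<Lambda> 1 = 1" using \<Lambda>(1)[OF one] .
    show "g \<in> W" if "f \<in> W" "\<And>x. x \<in> X \<Longrightarrow> \<bar>g x\<bar> \<le> \<bar>f x\<bar>" for f g
      using that by (force simp: W_def)
    show "0 \<le> \<Lambda> f" if "f \<in> W" "\<And>x. x \<in> X \<Longrightarrow> 0 \<le> f x" for f
      using that by (intro \<Lambda>(4)) (auto simp: K_def)
  qed (auto simp: \<Lambda>)
  then show ?thesis
  proof (rule that)
    show "f \<in> W \<and> \<Lambda> f = r" if "(f, r) \<in> G" for f r
      using that \<Lambda>(1) GW by (metis fst_conv imageI subsetD)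
    show "\<exists>g\<in>fst ` G. \<forall>x\<in>X. \<bar>f x\<bar> \<le> g x" if "f \<in> W" for f
      using that by (simp add: W_def)
  qed
qed

section \<open>Polynomial functions on the linear functionals\<close>

text \<open>
  \<open>polyrel B f a\<close>: some polynomial expression in elements of \<open>B\<close> has the value \<open>a\<close> in the algebra and
  defines the function \<open>f\<close> when each \<open>t \<in> B\<close> is replaced by \<open>\<omega> t\<close>. Neither of \<open>f\<close> and \<open>a\<close> determines the other.
\<close>

inductive polyrel :: "'a::{real_algebra_1, comm_ring_1} set \<Rightarrow> (('a \<Rightarrow> real) \<Rightarrow> real) \<Rightarrow> 'a \<Rightarrow> bool"
  for B where
  const: "polyrel B (\<lambda>_. c) (c *\<^sub>R 1)"
| gen: "t \<in> B \<Longrightarrow> polyrel B (\<lambda>\<omega>. \<omega> t) t"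
| add: "polyrel B f a \<Longrightarrow> polyrel B g b \<Longrightarrow> polyrel B (\<lambda>\<omega>. f \<omega> + g \<omega>) (a + b)"
| mult: "polyrel B f a \<Longrightarrow> polyrel B g b \<Longrightarrow> polyrel B (\<lambda>\<omega>. f \<omega> * g \<omega>) (a * b)"

lemma polyrel_cong:
  assumes "polyrel B f a" "\<And>t. t \<in> B \<Longrightarrow> \<omega> t = \<omega>' t"
  shows "f \<omega> = f \<omega>'"
  using assms by induction auto

lemma polyrel_mono:
  assumes "polyrel B f a" "B \<subseteq> C"
  shows "polyrel C f a"
  using assms by induction (auto intro: polyrel.intros)

lemma polyrel_finite:
  assumes "polyrel B f a"
  obtains F where "finite F" "F \<subseteq> B" "polyrel F f a"
proof -
  have "\<exists>F. finite F \<and> F \<subseteq> B \<and> polyrel F f a"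
    using assms
  proof induction
    case (const c)
    show ?case by (intro exI[of _ "{}"]) (auto intro: polyrel.const)
  next
    case (gen t)
    then show ?case by (intro exI[of _ "{t}"]) (auto intro: polyrel.gen)
  next
    case (add f a g b)
    then obtain F G where "finite F" "F \<subseteq> B" "polyrel F f a" "finite G" "G \<subseteq> B" "polyrel G g b" by blast
    then show ?case by (intro exI[of _ "F \<union> G"]) (auto intro!: polyrel.add elim: polyrel_mono)
  next
    case (mult f a g b)
    then obtain F G where "finite F" "F \<subseteq> B" "polyrel F f a" "finite G" "G \<subseteq> B" "polyrel G g b" by blast
    then show ?case by (intro exI[of _ "F \<union> G"]) (auto intro!: polyrel.mult elim: polyrel_mono)
  qed
  then show ?thesis using that by blast
qed

lemma polyrel_scale:
  assumes "polyrel B f a"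
  shows "polyrel B (\<lambda>\<omega>. c * f \<omega>) (c *\<^sub>R a)"
  using polyrel.mult[OF polyrel.const[of B c] assms] by simp

lemma polyrel_measurable:
  assumes "polyrel B f a" "\<And>t. t \<in> B \<Longrightarrow> (\<lambda>\<xi>. V \<xi> t) \<in> borel_measurable M"
  shows "(\<lambda>\<xi>. f (V \<xi>)) \<in> borel_measurable M"
  using assms by induction auto

lemma polyrel_dominated:
  assumes "polyrel B f a"
  obtains g b where "polyrel B g b" "\<And>\<omega>. \<bar>f \<omega>\<bar> \<le> g \<omega>"
proof (rule that)
  show "polyrel B (\<lambda>\<omega>. 1 + f \<omega> * f \<omega>) (1 *\<^sub>R 1 + a * a)"
    by (intro polyrel.intros assms)
qed (rule abs_le_one_plus_square)

text \<open>The bound \<open>h\<close> depends on \<open>\<omega>\<close> only and is again a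
  polynomial function, so its own change under rounding can be estimated by a second application.
  For products the bounds combine as in the product rule.\<close>

lemma polyrel_lipschitz:
  assumes "polyrel B f a"
  shows "\<exists>h b. polyrel B h b \<and> (\<forall>\<omega>. 0 \<le> h \<omega>) \<and>
    (\<forall>\<omega> \<omega>' \<delta>. 0 \<le> \<delta> \<longrightarrow> \<delta> \<le> 1 \<longrightarrow> (\<forall>t\<in>B. \<bar>\<omega> t - \<omega>' t\<bar> \<le> \<delta>) \<longrightarrow> \<bar>f \<omega> - f \<omega>'\<bar> \<le> \<delta> * h \<omega>)"
  using assms
proof induction
  case (const c)
  show ?case by (intro exI[of _ "\<lambda>_. 0"] exI[of _ "0 *\<^sub>R 1"]) (use polyrel.const[of B 0] in simp_all)
next
  case (gen t)
  show ?case using polyrel.const[of B 1] gen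
    by (intro exI[of _ "\<lambda>_. 1"] exI[of _ "1 *\<^sub>R 1"]) auto
next
  case (add f a g b)
  obtain h c h' c' where h: "polyrel B h c" "\<And>\<omega>. 0 \<le> h \<omega>"
    "\<And>\<omega> \<omega>' \<delta>. 0 \<le> \<delta> \<Longrightarrow> \<delta> \<le> 1 \<Longrightarrow> \<forall>t\<in>B. \<bar>\<omega> t - \<omega>' t\<bar> \<le> \<delta> \<Longrightarrow> \<bar>f \<omega> - f \<omega>'\<bar> \<le> \<delta> * h \<omega>"
    and h': "polyrel B h' c'" "\<And>\<omega>. 0 \<le> h' \<omega>"
    "\<And>\<omega> \<omega>' \<delta>. 0 \<le> \<delta> \<Longrightarrow> \<delta> \<le> 1 \<Longrightarrow> \<forall>t\<in>B. \<bar>\<omega> t - \<omega>' t\<bar> \<le> \<delta> \<Longrightarrow> \<bar>g \<omega> - g \<omega>'\<bar> \<le> \<delta> * h' \<omega>"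
    using add.IH by metis
  show ?case
  proof (intro exI conjI allI impI)
    show "polyrel B (\<lambda>\<omega>. h \<omega> + h' \<omega>) (c + c')" by (intro polyrel.add h h')
    show "0 \<le> h \<omega> + h' \<omega>" for \<omega> by (simp add: h(2) h'(2))
    fix \<omega> \<omega>' and \<delta> :: real
    assume "0 \<le> \<delta>" "\<delta> \<le> 1" "\<forall>t\<in>B. \<bar>\<omega> t - \<omega>' t\<bar> \<le> \<delta>"
    from h(3)[OF this] h'(3)[OF this]
    show "\<bar>f \<omega> + g \<omega> - (f \<omega>' + g \<omega>')\<bar> \<le> \<delta> * (h \<omega> + h' \<omega>)" by (simp add: algebra_simps)
  qed
next
  case (mult f a g b)
  obtain h c h' c' where h: "polyrel B h c" "\<And>\<omega>. 0 \<le> h \<omega>"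
    "\<And>\<omega> \<omega>' \<delta>. 0 \<le> \<delta> \<Longrightarrow> \<delta> \<le> 1 \<Longrightarrow> \<forall>t\<in>B. \<bar>\<omega> t - \<omega>' t\<bar> \<le> \<delta> \<Longrightarrow> \<bar>f \<omega> - f \<omega>'\<bar> \<le> \<delta> * h \<omega>"
    and h': "polyrel B h' c'" "\<And>\<omega>. 0 \<le> h' \<omega>"
    "\<And>\<omega> \<omega>' \<delta>. 0 \<le> \<delta> \<Longrightarrow> \<delta> \<le> 1 \<Longrightarrow> \<forall>t\<in>B. \<bar>\<omega> t - \<omega>' t\<bar> \<le> \<delta> \<Longrightarrow> \<bar>g \<omega> - g \<omega>'\<bar> \<le> \<delta> * h' \<omega>"
    using mult.IH by metis
  obtain f1 a1 g1 b1 where f1: "polyrel B f1 a1" "\<And>\<omega>. \<bar>f \<omega>\<bar> \<le> f1 \<omega>" and g1: "polyrel B g1 b1" "\<And>\<omega>. \<bar>g \<omega>\<bar> \<le> g1 \<omega>"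
    using polyrel_dominated[OF mult.hyps(1)] polyrel_dominated[OF mult.hyps(2)] by metis
  have pos: "0 \<le> f1 \<omega>" "0 \<le> g1 \<omega>" for \<omega> using f1(2)[of \<omega>] g1(2)[of \<omega>] by linarith+
  show ?case
  proof (intro exI conjI allI impI)
    show "polyrel B (\<lambda>\<omega>. h \<omega> * g1 \<omega> + (f1 \<omega> + h \<omega>) * h' \<omega>) (c * b1 + (a1 + c) * c')"
      by (intro polyrel.intros h h' f1 g1)
    show "0 \<le> h \<omega> * g1 \<omega> + (f1 \<omega> + h \<omega>) * h' \<omega>" for \<omega> by (simp add: h(2) h'(2) pos)
    fix \<omega> \<omega>' and \<delta> :: real
    assume \<delta>: "0 \<le> \<delta>" "\<delta> \<le> 1" "\<forall>t\<in>B. \<bar>\<omega> t - \<omega>' t\<bar> \<le> \<delta>"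
    have 1: "\<bar>f \<omega> - f \<omega>'\<bar> * \<bar>g \<omega>\<bar> \<le> \<delta> * h \<omega> * g1 \<omega>"
      using h(3)[OF \<delta>] g1(2)[of \<omega>] by (intro mult_mono) (use \<delta> h(2) in auto)
    \<comment> \<open>Here \<open>\<delta> \<le> 1\<close> is used: it bounds the value at the
      perturbed point by a function of the unperturbed one.\<close>
    have "\<delta> * h \<omega> \<le> 1 * h \<omega>" using \<delta> h(2) by (intro mult_right_mono)
    then have "\<bar>f \<omega>'\<bar> \<le> f1 \<omega> + h \<omega>" using h(3)[OF \<delta>] f1(2)[of \<omega>] by linarith
    then have 2: "\<bar>f \<omega>'\<bar> * \<bar>g \<omega> - g \<omega>'\<bar> \<le> (f1 \<omega> + h \<omega>) * (\<delta> * h' \<omega>)"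
      using h'(3)[OF \<delta>] by (intro mult_mono) (use pos h(2) in auto)
    have "f \<omega> * g \<omega> - f \<omega>' * g \<omega>' = (f \<omega> - f \<omega>') * g \<omega> + f \<omega>' * (g \<omega> - g \<omega>')" by (simp add: algebra_simps)
    then have "\<bar>f \<omega> * g \<omega> - f \<omega>' * g \<omega>'\<bar> \<le> \<bar>f \<omega> - f \<omega>'\<bar> * \<bar>g \<omega>\<bar> + \<bar>f \<omega>'\<bar> * \<bar>g \<omega> - g \<omega>'\<bar>"
      by (metis abs_mult abs_triangle_ineq)
    then show "\<bar>f \<omega> * g \<omega> - f \<omega>' * g \<omega>'\<bar> \<le> \<delta> * (h \<omega> * g1 \<omega> + (f1 \<omega> + h \<omega>) * h' \<omega>)"
      using 1 2 by (simp add: algebra_simps)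
  qed
qed

lemma polyrel_sum:
  assumes "\<And>i. i \<in> I \<Longrightarrow> polyrel B (f i) (a i)"
  shows "polyrel B (\<lambda>\<omega>. \<Sum>i\<in>I. f i \<omega>) (\<Sum>i\<in>I. a i)"
  using assms
proof (induction I rule: infinite_finite_induct)
  case (insert i I)
  then show ?case by (simp add: polyrel.add)
qed (use polyrel.const[of B 0] in simp_all)

lemma polyrel_power:
  assumes "polyrel B f a"
  shows "polyrel B (\<lambda>\<omega>. f \<omega> ^ n) (a ^ n)"
proof (induction n)
  case (Suc n)
  then show ?case using polyrel.mult[OF assms] by simp
qed (use polyrel.const[of B 1] in simp)

lemma polyrel_prod:
  assumes "\<And>i. i \<in> I \<Longrightarrow> polyrel B (f i) (a i)"
  shows "polyrel B (\<lambda>\<omega>. \<Prod>i\<in>I. f i \<omega>) (\<Prod>i\<in>I. a i)"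
  using assms
proof (induction I rule: infinite_finite_induct)
  case (insert i I)
  then show ?case by (simp add: polyrel.mult)
qed (use polyrel.const[of B 1] in simp_all)

lemma polyrel_mpoly_eval:
  assumes "p \<in> mpoly_in k" "\<And>i. i < k \<Longrightarrow> t i \<in> B"
  shows "polyrel B (\<lambda>\<omega>. mpoly_eval p (\<lambda>i. \<omega> (t i))) (mpoly_eval p t)"
  unfolding mpoly_eval_def real_scaleR_def
  using assms by (intro polyrel_sum polyrel_scale polyrel_prod polyrel_power polyrel.gen) (auto simp: mpoly_in_def)

text \<open>Over \<open>span S\<close> linearly dependent generators act as unrelated variables, so
  expressing them through \<open>S\<close> preserves the function only at linear
  \<open>\<omega>\<close>; the algebra element stays the same.\<close>

lemma polyrel_span:
  fixes S :: "'a::{real_algebra_1, comm_ring_1} set"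
  assumes "polyrel (span S) f a"
  shows "\<exists>g. polyrel S g a \<and> (\<forall>\<omega>. linear \<omega> \<longrightarrow> f \<omega> = g \<omega>)"
  using assms
proof induction
  case (const c)
  show ?case using polyrel.const[of S c] by blast
next
  case (gen t)
  then show ?case
  proof (induction rule: span_induct_alt)
    case base
    have "polyrel S (\<lambda>_. 0) 0" using polyrel.const[of S 0] by simp
    then show ?case using linear_0 by blast
  next
    case (step c x y)
    then obtain g where g: "polyrel S g y" "\<forall>\<omega>. linear \<omega> \<longrightarrow> \<omega> y = g \<omega>" by blast
    have "polyrel S (\<lambda>\<omega>. c * \<omega> x + g \<omega>) (c *\<^sub>R x + y)"
      by (intro polyrel.add polyrel_scale polyrel.gen step g)
    moreover have "\<omega> (c *\<^sub>R x + y) = c * \<omega> x + g \<omega>" if "linear \<omega>" for \<omega>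
      using g(2) that by (simp add: linear_add linear_scale)
    ultimately show ?case by blast
  qed
next
  case (add f a g b)
  then obtain f' g' where "polyrel S f' a" "\<forall>\<omega>. linear \<omega> \<longrightarrow> f \<omega> = f' \<omega>"
    "polyrel S g' b" "\<forall>\<omega>. linear \<omega> \<longrightarrow> g \<omega> = g' \<omega>" by blast
  then show ?case by (intro exI[of _ "\<lambda>\<omega>. f' \<omega> + g' \<omega>"]) (simp add: polyrel.add)
next
  case (mult f a g b)
  then obtain f' g' where "polyrel S f' a" "\<forall>\<omega>. linear \<omega> \<longrightarrow> f \<omega> = f' \<omega>"
    "polyrel S g' b" "\<forall>\<omega>. linear \<omega> \<longrightarrow> g \<omega> = g' \<omega>" by blast
  then show ?case by (intro exI[of _ "\<lambda>\<omega>. f' \<omega> * g' \<omega>"]) (simp add: polyrel.mult)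
qed

text \<open>The function and its value in the algebra are kept together as a pair, so that a linear
  statement about both needs checking on monomials only.\<close>

definition monomials :: "'a::{real_algebra_1, comm_ring_1} set \<Rightarrow> ((('a \<Rightarrow> real) \<Rightarrow> real) \<times> 'a) set" where
  "monomials B = range (\<lambda>m. ((\<lambda>\<omega>. \<Prod>s\<in>B. \<omega> s ^ m s), (\<Prod>s\<in>B. s ^ m s)))"

lemma span_monomials_mult:
  assumes x: "x \<in> span (monomials B)" and y: "y \<in> span (monomials B)"
  shows "(fst x * fst y, snd x * snd y) \<in> span (monomials B)"
proof -
  define P where "P x y = (fst x * fst y, snd x * snd y)" for x y :: "(('a \<Rightarrow> real) \<Rightarrow> real) \<times> 'a"
  have mono: "P x y \<in> span (monomials B)" if xy: "x \<in> monomials B" "y \<in> monomials B" for x y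
  proof -
    obtain m where m: "x = ((\<lambda>\<omega>. \<Prod>s\<in>B. \<omega> s ^ m s), (\<Prod>s\<in>B. s ^ m s))"
      using xy(1) by (auto simp: monomials_def)
    obtain l where l: "y = ((\<lambda>\<omega>. \<Prod>s\<in>B. \<omega> s ^ l s), (\<Prod>s\<in>B. s ^ l s))"
      using xy(2) by (auto simp: monomials_def)
    have "P x y = ((\<lambda>\<omega>. \<Prod>s\<in>B. \<omega> s ^ (m s + l s)), (\<Prod>s\<in>B. s ^ (m s + l s)))"
      by (simp add: P_def m l fun_eq_iff power_add prod.distrib)
    then have "P x y \<in> monomials B" 
      unfolding monomials_def by (intro range_eqI[of _ _ "\<lambda>s. m s + l s"])
    then show ?thesis by (rule span_base)
  qed
  have 1: "P x y \<in> span (monomials B)" if x: "x \<in> monomials B" and y: "y \<in> span (monomials B)" for x y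
    using y
  proof (induction rule: span_induct_alt)
    case base
    have "P x 0 = 0" by (simp add: P_def zero_prod_def)
    then show ?case by (simp add: span_zero)
  next
    case (step c z y)
    have "P x (c *\<^sub>R z + y) = c *\<^sub>R P x z + P x y"
      by (simp add: P_def fun_eq_iff algebra_simps)
    then show ?case using step mono[OF x] by (simp add: span_add span_scale)
  qed
  have "P x y \<in> span (monomials B)"
    using x
  proof (induction rule: span_induct_alt)
    case base
    have "P 0 y = 0" by (simp add: P_def zero_prod_def)
    then show ?case by (simp add: span_zero)
  next
    case (step c z x)
    have "P (c *\<^sub>R z + x) y = c *\<^sub>R P z y + P x y"
      by (simp add: P_def fun_eq_iff algebra_simps)
    then show ?case using step 1[OF step.hyps(1) y] by (simp add: span_add span_scale)
  qed
  then show ?thesis by (simp add: P_def)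
qed

lemma prod_power_unit:
  assumes "finite B" "t \<in> B"
  shows "(\<Prod>s\<in>B. g s ^ (if s = t then 1 else 0)) = (g t :: 'b::comm_monoid_mult)"
proof -
  have "(\<Prod>s\<in>B. g s ^ (if s = t then 1 else 0)) = (\<Prod>s\<in>B. if s = t then g s else 1)"
    by (intro prod.cong) auto
  then show ?thesis using assms by simp
qed

lemma polyrel_in_span_monomials:
  assumes "finite B" "polyrel B f a"
  shows "(f, a) \<in> span (monomials B)"
  using assms(2)
proof induction
  case (const c)
  have "((\<lambda>\<omega>. \<Prod>s\<in>B. \<omega> s ^ 0), (\<Prod>s\<in>B. s ^ 0)) \<in> monomials B"
    unfolding monomials_def by (rule range_eqI[of _ _ "\<lambda>_. 0"]) simp
  then have "c *\<^sub>R ((\<lambda>\<omega>. 1), 1) \<in> span (monomials B)" by (intro span_scale span_base) simp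
  then show ?case by (simp add: scaleR_fun_def)
next
  case (gen t)
  have "((\<lambda>\<omega>. \<omega> t), t) \<in> monomials B"
    unfolding monomials_def
    by (intro range_eqI[of _ _ "\<lambda>s. if s = t then 1 else 0"]) (simp only: prod_power_unit[OF assms(1) gen])
  then show ?case by (rule span_base)
next
  case (add f a g b)
  from span_add[OF add.IH] show ?case by (simp add: plus_fun_def)
next
  case (mult f a g b)
  from span_monomials_mult[OF mult.IH] show ?case by (simp add: times_fun_def)
qed

section \<open>Realization by a random functional\<close>

context dominated_functional
begin

definition mass :: "'x set \<Rightarrow> real" where
  "mass A = \<Lambda> (indicator A)"

lemma indicator_in_W: "indicator A \<in> W"
  by (rule W_bounded[of _ 1]) (simp add: indicator_def)

lemma mass_mono: "A \<inter> X \<subseteq> B \<Longrightarrow> mass A \<le> mass B"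
  unfolding mass_def by (intro mono indicator_in_W) (auto simp: indicator_def)

lemma mass_nonneg: "0 \<le> mass A"
  unfolding mass_def by (intro nonneg indicator_in_W) (auto simp: indicator_def)

lemma W_indicator_mult: "f \<in> W \<Longrightarrow> (\<lambda>x. f x * indicator A x) \<in> W"
  using B_mult[OF _ indicator_in_W] by (simp add: times_fun_def)

text \<open>The part of the integral outside a finite set \<open>C\<close> is bounded by
  Cauchy--Schwarz against the indicator of the complement: the second moment exists because
  \<open>W\<close> is an algebra, and the mass of the complement is small by tightness.\<close>

lemma tight_has_sum:
  fixes Z :: "'x \<Rightarrow> 'c"
  assumes tight: "\<And>e. e > 0 \<Longrightarrow> \<exists>C. finite C \<and> mass {x. Z x \<notin> C} \<le> e"
    and f: "(\<lambda>x. f (Z x)) \<in> W"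
  shows "((\<lambda>z. f z * mass {x. Z x = z}) has_sum \<Lambda> (\<lambda>x. f (Z x))) UNIV"
  unfolding has_sum_def tendsto_iff
proof (intro allI impI)
  fix e :: real assume e: "e > 0"
  define K where "K = \<Lambda> ((\<lambda>x. f (Z x)) * (\<lambda>x. f (Z x)))"
  have K: "K \<ge> 0" unfolding K_def by (rule L_square[OF f])
  \<comment> \<open>The target is \<open>K * \<delta> < e ^ 2\<close>; the summand 1 covers
    \<open>K = 0\<close>.\<close>
  define \<delta> where "\<delta> = e\<^sup>2 / (2 * (K + 1))"
  have \<delta>: "\<delta> > 0" using e K by (simp add: \<delta>_def)
  have K\<delta>: "K * \<delta> < e\<^sup>2"
  proof -
    have "K * \<delta> \<le> (K + 1) * \<delta>" using \<delta> by (simp add: mult_right_mono)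
    also have "\<dots> = e\<^sup>2 / 2" using K by (simp add: \<delta>_def field_simps)
    also have "\<dots> < e\<^sup>2" using e by simp
    finally show ?thesis .
  qed
  obtain C0 where C0: "finite C0" "mass {x. Z x \<notin> C0} \<le> \<delta>" using tight[OF \<delta>] by blast
  show "\<forall>\<^sub>F C in finite_subsets_at_top UNIV. dist (\<Sum>z\<in>C. f z * mass {x. Z x = z}) (\<Lambda> (\<lambda>x. f (Z x))) < e"
    unfolding eventually_finite_subsets_at_top
  proof (intro exI[of _ C0] conjI allI impI C0(1) subset_UNIV)
    fix C assume C: "finite C \<and> C0 \<subseteq> C \<and> C \<subseteq> UNIV"
    have "(\<Sum>z\<in>C. f z * mass {x. Z x = z}) = \<Lambda> (\<Sum>z\<in>C. f z *\<^sub>R indicator {x. Z x = z})"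
      by (simp add: L_sum L_scale indicator_in_W mass_def)
    also have "(\<Sum>z\<in>C. f z *\<^sub>R indicator {x. Z x = z}) = (\<lambda>x. f (Z x) * indicator {x. Z x \<in> C} x)"
    proof
      fix x
      have "(\<Sum>z\<in>C. f z *\<^sub>R indicator {x. Z x = z}) x = (\<Sum>z\<in>C. if Z x = z then f z else 0)"
        by (auto simp: sum_fun_apply indicator_def intro!: sum.cong)
      then show "(\<Sum>z\<in>C. f z *\<^sub>R indicator {x. Z x = z}) x = f (Z x) * indicator {x. Z x \<in> C} x"
        using C by (simp add: indicator_def)
    qed
    finally have 1: "(\<Sum>z\<in>C. f z * mass {x. Z x = z}) = \<Lambda> (\<lambda>x. f (Z x) * indicator {x. Z x \<in> C} x)" .
    have 2: "(\<lambda>x. f (Z x)) - (\<lambda>x. f (Z x) * indicator {x. Z x \<in> C} x) =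
        (\<lambda>x. f (Z x)) * indicator {x. Z x \<notin> C}"
      by (auto simp: fun_eq_iff indicator_def)
    have "\<Lambda> (\<lambda>x. f (Z x)) - (\<Sum>z\<in>C. f z * mass {x. Z x = z}) = \<Lambda> ((\<lambda>x. f (Z x)) * indicator {x. Z x \<notin> C})"
      unfolding 1 using L_diff[OF f W_indicator_mult[OF f, of "{x. Z x \<in> C}"]] by (simp only: 2)
    moreover have "(\<Lambda> ((\<lambda>x. f (Z x)) * indicator {x. Z x \<notin> C}))\<^sup>2 \<le> K * mass {x. Z x \<notin> C}"
    proof -
      have "indicator {x. Z x \<notin> C} * indicator {x. Z x \<notin> C} = (indicator {x. Z x \<notin> C} :: 'x \<Rightarrow> real)"
        by (auto simp: fun_eq_iff indicator_def)
      then show ?thesis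
        using cauchy_schwarz[OF f indicator_in_W[of "{x. Z x \<notin> C}"]] by (simp add: K_def mass_def)
    qed
    moreover have "mass {x. Z x \<notin> C} \<le> \<delta>"
      using mass_mono[of "{x. Z x \<notin> C}" "{x. Z x \<notin> C0}"] C C0(2) by fastforce
    then have "K * mass {x. Z x \<notin> C} \<le> K * \<delta>" using K by (rule mult_left_mono)
    ultimately have "\<bar>\<Lambda> (\<lambda>x. f (Z x)) - (\<Sum>z\<in>C. f z * mass {x. Z x = z})\<bar>\<^sup>2 < e\<^sup>2"
      using K\<delta> by simp
    then show "dist (\<Sum>z\<in>C. f z * mass {x. Z x = z}) (\<Lambda> (\<lambda>x. f (Z x))) < e"
      using e by (simp add: dist_real_def abs_minus_commute power2_less_imp_less)
  qed
qed

text \<open>Tightness excludes any loss of mass: the atoms sum to \<open>\<Lambda>\<close> of the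
  constant 1, so the finitely additive law of \<open>Z\<close> is countably additive. Summing the
  absolute value as well gives integrability.\<close>

lemma discrete_law:
  fixes Z :: "'x \<Rightarrow> 'c"
  assumes tight: "\<And>e. e > 0 \<Longrightarrow> \<exists>C. finite C \<and> mass {x. Z x \<notin> C} \<le> e"
  obtains Q :: "'c pmf" where
    "\<And>A. measure (measure_pmf Q) A = mass {x. Z x \<in> A}"
    "\<And>f. (\<lambda>x. f (Z x)) \<in> W \<Longrightarrow> integrable (measure_pmf Q) f \<and> integral\<^sup>L (measure_pmf Q) f = \<Lambda> (\<lambda>x. f (Z x))"
proof -
  define p where "p z = mass {x. Z x = z}" for z
  have p0: "p z \<ge> 0" for z by (simp add: p_def mass_nonneg)
  have int: "integrable (count_space UNIV) (\<lambda>z. f z * p z) \<and>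
      integral\<^sup>L (count_space UNIV) (\<lambda>z. f z * p z) = \<Lambda> (\<lambda>x. f (Z x))" if f: "(\<lambda>x. f (Z x)) \<in> W" for f
  proof -
    have "(\<lambda>x. \<bar>f (Z x)\<bar>) \<in> W" by (rule solid[OF f]) simp
    from tight_has_sum[OF tight this] have "(\<lambda>z. norm (f z * p z)) summable_on UNIV"
      by (auto simp: summable_on_def p_def abs_mult mass_nonneg)
    then have a: "Infinite_Set_Sum.abs_summable_on (\<lambda>z. f z * p z) UNIV" by (simp only: abs_summable_equivalent)
    have "infsetsum (\<lambda>z. f z * p z) UNIV = infsum (\<lambda>z. f z * p z) UNIV" by (rule infsetsum_infsum[OF a])
    also have "\<dots> = \<Lambda> (\<lambda>x. f (Z x))"
      using tight_has_sum[OF tight f] by (simp add: p_def infsumI)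
    finally show ?thesis using a by (simp add: abs_summable_on_def infsetsum_def)
  qed
  have "(\<integral>\<^sup>+z. ennreal (p z) \<partial>count_space UNIV) = 1"
    using int[OF W_const[of 1]] p0 by (subst nn_integral_eq_integral) (auto simp: L_const)
  then have pmf: "pmf (embed_pmf p) z = p z" for z using p0 by (intro pmf_embed_pmf) auto
  define Q where "Q = embed_pmf p"
  have Qint: "integrable (measure_pmf Q) f \<and> integral\<^sup>L (measure_pmf Q) f = \<Lambda> (\<lambda>x. f (Z x))"
    if f: "(\<lambda>x. f (Z x)) \<in> W" for f
    unfolding measure_pmf_eq_density Q_def
    using int[OF f] p0 by (simp add: integrable_density integral_density pmf mult.commute)
  show ?thesis
  proof (rule that[of Q])
    show "measure (measure_pmf Q) A = mass {x. Z x \<in> A}" for A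
    proof -
      have "(\<lambda>x. indicator A (Z x)) = (indicator {x. Z x \<in> A} :: 'x \<Rightarrow> real)"
        by (auto simp: indicator_def)
      then show ?thesis
        using Qint[of "indicator A"] indicator_in_W[of "{x. Z x \<in> A}"] by (simp add: mass_def)
    qed
  qed (rule Qint)
qed

end

text \<open>All dyadic resolutions of all generators are realized jointly, so that the resolutions
  of one generator almost surely form a Cauchy sequence. The Lipschitz bound for polynomial
  functions carries the moments to the limit.\<close>

proposition kolmogorov_realization:
  fixes S :: "'a::{real_algebra_1, comm_ring_1} set" and L :: "'a \<Rightarrow> real"
  assumes dom: "dominated_functional {\<omega>::'a \<Rightarrow> real. linear \<omega>} W \<Lambda>"
    and poly: "\<And>f a. polyrel S f a \<Longrightarrow> f \<in> W \<and> \<Lambda> f = L a"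
    and S: "independent S"
  obtains M :: "('a \<times> nat \<Rightarrow> real) measure" and V :: "('a \<times> nat \<Rightarrow> real) \<Rightarrow> 'a \<Rightarrow> real"
  where "prob_space M" "\<And>\<xi>. linear (V \<xi>)" "\<And>s. s \<in> S \<Longrightarrow> (\<lambda>\<xi>. V \<xi> s) \<in> borel_measurable M"
    "\<And>f a. polyrel S f a \<Longrightarrow> integrable M (\<lambda>\<xi>. f (V \<xi>)) \<and> (\<integral>\<xi>. f (V \<xi>) \<partial>M) = L a"
proof -
  interpret dominated_functional "{\<omega>::'a \<Rightarrow> real. linear \<omega>}" W \<Lambda> by (rule dom)
  \<comment> \<open>Coordinate \<open>(s, n)\<close> rounds \<open>\<omega> s\<close> down to a
    multiple of \<open>1 / 2 ^ n\<close>. The product space is indexed by the whole type, hence the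
    value 0 off \<open>S\<close>.\<close>
  define z where "z i \<omega> = (if fst i \<in> S then real_of_int \<lfloor>2 ^ snd i * \<omega> (fst i)\<rfloor> / 2 ^ snd i else 0)"
    for i :: "'a \<times> nat" and \<omega> :: "'a \<Rightarrow> real"
  have z_le: "z (s, n) \<omega> \<le> \<omega> s" and z_ge: "\<omega> s \<le> z (s, n) \<omega> + 1 / 2 ^ n" if "s \<in> S" for s n \<omega>
  proof -
    have "real_of_int \<lfloor>2 ^ n * \<omega> s\<rfloor> \<le> 2 ^ n * \<omega> s" "2 ^ n * \<omega> s \<le> real_of_int \<lfloor>2 ^ n * \<omega> s\<rfloor> + 1" by linarith+
    then show "z (s, n) \<omega> \<le> \<omega> s" "\<omega> s \<le> z (s, n) \<omega> + 1 / 2 ^ n"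
      using that by (simp_all add: z_def field_simps)
  qed
  have z_close: "\<bar>\<omega> s - z (s, n) \<omega>\<bar> \<le> 1 / 2 ^ n" if "s \<in> S" for s n \<omega>
    using z_le[OF that, of n \<omega>] z_ge[OF that, of \<omega> n] by linarith
  have pow: "1 / 2 ^ k \<le> 1 / (2::real) ^ n" if "n \<le> k" for n k
    using that by (intro divide_left_mono power_increasing) auto
  have z_cauchy: "\<bar>z (s, n) \<omega> - z (s, k) \<omega>\<bar> \<le> 1 / 2 ^ n" if "s \<in> S" "n \<le> k" for s n k \<omega>
    using z_le[OF that(1), of n \<omega>] z_le[OF that(1), of k \<omega>] z_ge[OF that(1), of \<omega> n] z_ge[OF that(1), of \<omega> k] pow[OF that(2)]
    by linarith
  have WD: "\<bar>\<Lambda> f - \<Lambda> g\<bar> \<le> c * \<Lambda> h"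
    if fg: "f \<in> W" "g \<in> W" "h \<in> W" and le: "\<And>x. \<bar>f x - g x\<bar> \<le> c * h x" for f g h c
  proof -
    have "\<Lambda> f \<le> \<Lambda> (\<lambda>x. g x + c * h x)"
      using le by (intro mono W_plus W_cmult L_plus L_cmult fg) (simp add: abs_le_iff algebra_simps)
    moreover have "\<Lambda> g \<le> \<Lambda> (\<lambda>x. f x + c * h x)"
    proof (intro mono W_plus W_cmult L_plus L_cmult fg)
      show "g x \<le> f x + c * h x" for x using le[of x] by (simp add: abs_le_iff algebra_simps)
    qed
    ultimately show ?thesis by (simp add: W_plus W_cmult L_plus L_cmult fg)
  qed
  have zW: "z i \<in> W" for i
  proof (cases "fst i \<in> S")
    case True
    have "polyrel S (\<lambda>\<omega>. 2 + \<omega> (fst i) * \<omega> (fst i)) (2 *\<^sub>R 1 + fst i * fst i)"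
      by (intro polyrel.intros True)
    then have "(\<lambda>\<omega>. 2 + \<omega> (fst i) * \<omega> (fst i)) \<in> W" using poly by blast
    then show ?thesis
    proof (rule solid)
      fix \<omega> :: "'a \<Rightarrow> real"
      have "1 / 2 ^ snd i \<le> (1::real)" by simp
      then have "\<bar>z i \<omega>\<bar> \<le> \<bar>\<omega> (fst i)\<bar> + 1"
        using z_close[OF True, of \<omega> "snd i"] unfolding prod.collapse by linarith
      then show "\<bar>z i \<omega>\<bar> \<le> \<bar>2 + \<omega> (fst i) * \<omega> (fst i)\<bar>"
        using abs_le_one_plus_square[of "\<omega> (fst i)"] by simp
    qed
  next
    case False
    then have "z i = (\<lambda>_. 0)" by (auto simp: z_def)
    then show ?thesis using W_const[of 0] by simp
  qed
  define Z where "Z J \<omega> = restrict (\<lambda>i. z i \<omega>) J" for J \<omega>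
  have tight: "\<exists>C. finite C \<and> mass {\<omega>. Z J \<omega> \<notin> C} \<le> e" if J: "finite J" and e: "e > 0" for J e
  proof -
    \<comment> \<open>\<open>h\<close> sums the squares of the integers behind the rounded
      coordinates. Outside the box \<open>C\<close> one of them is at least \<open>N\<close> in
      absolute value, so Chebyshev's argument bounds the mass by
      \<open>\<Lambda> h / N ^ 2\<close>.\<close>
    define h where "h = (\<Sum>i\<in>J. (2 ^ snd i *\<^sub>R z i) * (2 ^ snd i *\<^sub>R z i))"
    have hW: "h \<in> W" unfolding h_def by (intro B_sum B_mult B_scale zW)
    have h: "h \<omega> = (\<Sum>i\<in>J. (2 ^ snd i * z i \<omega>)\<^sup>2)" for \<omega>
      by (simp add: h_def sum_fun_apply power2_eq_square ac_simps)
    define N where "N = nat \<lceil>\<Lambda> h / e\<rceil> + 1"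
    have "\<Lambda> h / e \<le> real N" unfolding N_def by linarith
    also have "\<dots> \<le> (real N)\<^sup>2" by (simp add: power2_eq_square N_def)
    finally have N: "\<Lambda> h / (real N)\<^sup>2 \<le> e" using e by (simp add: N_def field_simps)
    have N0: "real N > 0" by (simp add: N_def)
    define C where "C = PiE J (\<lambda>i. (\<lambda>k::int. real_of_int k / 2 ^ snd i) ` {- int N..int N})"
    have "finite C" unfolding C_def by (intro finite_PiE J finite_imageI finite_atLeastAtMost_int)
    moreover have "mass {\<omega>. Z J \<omega> \<notin> C} \<le> \<Lambda> ((1 / (real N)\<^sup>2) *\<^sub>R h)"
      unfolding mass_def
    proof (intro mono indicator_in_W B_scale hW)
      fix \<omega>
      have h0: "0 \<le> h \<omega>" unfolding h by (intro sum_nonneg) simp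
      show "indicator {\<omega>. Z J \<omega> \<notin> C} \<omega> \<le> ((1 / (real N)\<^sup>2) *\<^sub>R h) \<omega>"
      proof (cases "Z J \<omega> \<in> C")
        case True then show ?thesis using h0 by simp
      next
        case False
        then obtain i where i: "i \<in> J" "z i \<omega> \<notin> (\<lambda>k::int. real_of_int k / 2 ^ snd i) ` {- int N..int N}"
          unfolding C_def Z_def PiE_iff by auto
        define k where "k = (if fst i \<in> S then \<lfloor>2 ^ snd i * \<omega> (fst i)\<rfloor> else 0)"
        have k: "z i \<omega> = real_of_int k / 2 ^ snd i" by (simp add: z_def k_def)
        then have "k \<notin> {- int N..int N}" using i(2) by blast
        then have "real N \<le> \<bar>real_of_int k\<bar>" by auto
        then have "(real N)\<^sup>2 \<le> (real_of_int k)\<^sup>2" using power_mono[of "real N" "\<bar>real_of_int k\<bar>" 2] by simp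
        also have "\<dots> = (2 ^ snd i * z i \<omega>)\<^sup>2" by (simp add: k)
        also have "\<dots> \<le> h \<omega>" unfolding h using J i(1) by (intro member_le_sum) auto
        finally show ?thesis using False N0 by (simp add: field_simps)
      qed
    qed
    then have "mass {\<omega>. Z J \<omega> \<notin> C} \<le> e" using N hW by (simp add: L_scale)
    ultimately show ?thesis by blast
  qed
  have "\<exists>Q :: ('a \<times> nat \<Rightarrow> real) pmf. (\<forall>A. measure (measure_pmf Q) A = mass {\<omega>. Z J \<omega> \<in> A}) \<and>
      (\<forall>f. (\<lambda>\<omega>. f (Z J \<omega>)) \<in> W \<longrightarrow> integrable (measure_pmf Q) f \<and> integral\<^sup>L (measure_pmf Q) f = \<Lambda> (\<lambda>\<omega>. f (Z J \<omega>)))"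
    if "finite J" for J
    by (rule discrete_law[OF tight[OF that]]) auto
  then obtain Q :: "('a \<times> nat) set \<Rightarrow> ('a \<times> nat \<Rightarrow> real) pmf" where
    Q: "\<And>J A. finite J \<Longrightarrow> measure (measure_pmf (Q J)) A = mass {\<omega>. Z J \<omega> \<in> A}"
    and Qint: "\<And>J f. finite J \<Longrightarrow> (\<lambda>\<omega>. f (Z J \<omega>)) \<in> W \<Longrightarrow>
      integrable (measure_pmf (Q J)) f \<and> integral\<^sup>L (measure_pmf (Q J)) f = \<Lambda> (\<lambda>\<omega>. f (Z J \<omega>))"
    by metis
  define P where "P J = distr (measure_pmf (Q J)) (PiM J (\<lambda>_. borel :: real measure)) (\<lambda>x. restrict x J)" for J
  have meas[measurable]: "(\<lambda>x. restrict x J) \<in> measurable (measure_pmf q) (PiM J (\<lambda>_. borel :: real measure))"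
    for J and q :: "('a \<times> nat \<Rightarrow> real) pmf"
    by (auto simp: space_PiM)
  have P_emeasure: "emeasure (P J) A = ennreal (mass {\<omega>. Z J \<omega> \<in> A})"
    if "finite J" "A \<in> sets (PiM J (\<lambda>_. borel))" for J A
  proof -
    have "emeasure (P J) A = emeasure (measure_pmf (Q J)) ((\<lambda>x. restrict x J) -` A)"
      unfolding P_def using emeasure_distr[OF meas that(2)] by simp
    also have "\<dots> = ennreal (mass {\<omega>. Z J \<omega> \<in> (\<lambda>x. restrict x J) -` A})"
      by (simp only: measure_pmf.emeasure_eq_measure Q[OF that(1)])
    finally show ?thesis by (simp add: Z_def)
  qed
  have P_prob: "prob_space (P J)" for J
    unfolding P_def by (rule measure_pmf.prob_space_distr) (rule meas)
  \<comment> \<open>Both sides assign to \<open>A\<close> the mass of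
    \<open>{\<omega>. Z J \<omega> \<in> A}\<close>, since restricting \<open>Z H \<omega>\<close>
    to \<open>J\<close> gives \<open>Z J \<omega>\<close>.\<close>
  have P_proj: "P J = distr (P H) (PiM J (\<lambda>_. borel)) (\<lambda>f. restrict f J)"
    if JH: "J \<subseteq> H" "finite H" for J H
  proof -
    have J: "finite J" using JH by (rule finite_subset)
    show "P J = distr (P H) (PiM J (\<lambda>_. borel)) (\<lambda>f. restrict f J)"
    proof (rule measure_eqI)
      show "sets (P J) = sets (distr (P H) (PiM J (\<lambda>_. borel)) (\<lambda>f. restrict f J))" by (simp add: P_def)
      fix A assume "A \<in> sets (P J)"
      then have A: "A \<in> sets (PiM J (\<lambda>_. borel :: real measure))" by (simp add: P_def)
      have r: "(\<lambda>f. restrict f J) \<in> measurable (PiM H (\<lambda>_. borel :: real measure)) (PiM J (\<lambda>_. borel))"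
        using JH(1) by (rule measurable_restrict_subset)
      have "emeasure (distr (P H) (PiM J (\<lambda>_. borel)) (\<lambda>f. restrict f J)) A =
          emeasure (P H) ((\<lambda>f. restrict f J) -` A \<inter> space (PiM H (\<lambda>_. borel)))"
        using emeasure_distr[of "\<lambda>f. restrict f J" "P H", OF _ A] r by (simp add: P_def)
      also have "\<dots> = ennreal (mass {\<omega>. Z H \<omega> \<in> (\<lambda>f. restrict f J) -` A \<inter> space (PiM H (\<lambda>_. borel :: real measure))})"
        by (rule P_emeasure[OF JH(2)]) (rule measurable_sets[OF r A])
      also have "{\<omega>. Z H \<omega> \<in> (\<lambda>f. restrict f J) -` A \<inter> space (PiM H (\<lambda>_. borel :: real measure))} = {\<omega>. Z J \<omega> \<in> A}"
        using JH(1) by (auto simp: Z_def space_PiM restrict_restrict Int_absorb1)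
      also have "ennreal (mass \<dots>) = emeasure (P J) A" by (rule P_emeasure[OF J A, symmetric])
      finally show "emeasure (P J) A = emeasure (distr (P H) (PiM J (\<lambda>_. borel)) (\<lambda>f. restrict f J)) A" by (rule sym)
    qed
  qed
  interpret P: polish_projective UNIV P
    unfolding polish_projective_def projective_family_def using P_prob P_proj by blast
  define M where "M = P.lim"
  have sets_M[measurable_cong]: "sets M = sets (PiM UNIV (\<lambda>_. borel))" by (simp add: M_def)
  interpret M: prob_space M unfolding M_def by (rule P.P.prob_space_axioms)
  have restr: "(\<lambda>\<xi>. restrict \<xi> J) \<in> measurable M (PiM J (\<lambda>_. borel))" for J
    unfolding measurable_cong_sets[OF sets_M refl] by (rule measurable_restrict_subset) simp
  have distr: "distr M (PiM J (\<lambda>_. borel)) (\<lambda>\<xi>. restrict \<xi> J) = P J" if "finite J" for J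
  proof (rule measure_eqI)
    show "sets (distr M (PiM J (\<lambda>_. borel)) (\<lambda>\<xi>. restrict \<xi> J)) = sets (P J)" by (simp add: P_def)
    fix A assume "A \<in> sets (distr M (PiM J (\<lambda>_. borel)) (\<lambda>\<xi>. restrict \<xi> J))"
    then have A: "A \<in> sets (PiM J (\<lambda>_. borel :: real measure))" by simp
    show "emeasure (distr M (PiM J (\<lambda>_. borel)) (\<lambda>\<xi>. restrict \<xi> J)) A = emeasure (P J) A"
      using P.emeasure_lim_emb[OF subset_UNIV that A] A restr
      by (simp add: emeasure_distr M_def prod_emb_def space_PiM)
  qed
  have E: "integrable M (\<lambda>\<xi>. f (restrict \<xi> J)) \<and> (\<integral>\<xi>. f (restrict \<xi> J) \<partial>M) = \<Lambda> (\<lambda>\<omega>. f (Z J \<omega>))"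
    if J: "finite J" and f: "f \<in> borel_measurable (PiM J (\<lambda>_. borel))" and W: "(\<lambda>\<omega>. f (Z J \<omega>)) \<in> W" for f J
  proof -
    have W': "(\<lambda>\<omega>. f (restrict (Z J \<omega>) J)) \<in> W" using W by (simp add: Z_def)
    have "integrable (P J) f \<and> integral\<^sup>L (P J) f = \<Lambda> (\<lambda>\<omega>. f (Z J \<omega>))"
      using Qint[OF J, of "\<lambda>x. f (restrict x J)"] W' f
      by (simp only: P_def integrable_distr_eq[OF meas] integral_distr[OF meas]) (simp add: Z_def)
    then show ?thesis
      unfolding distr[OF J, symmetric] using f by (simp only: integrable_distr_eq[OF restr] integral_distr[OF restr])
  qed
  have comp: "(\<lambda>x. x i) \<in> borel_measurable (PiM J (\<lambda>_. borel :: real measure))" if "i \<in> J" for i :: "'a \<times> nat" and J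
    using that by (rule measurable_component_singleton)
  have AE_cauchy: "AE \<xi> in M. \<forall>n k. n \<le> k \<longrightarrow> \<bar>\<xi> (s, n) - \<xi> (s, k)\<bar> \<le> 1 / 2 ^ n" if s: "s \<in> S" for s
    unfolding AE_all_countable
  proof (intro allI)
    fix n k :: nat
    show "AE \<xi> in M. n \<le> k \<longrightarrow> \<bar>\<xi> (s, n) - \<xi> (s, k)\<bar> \<le> 1 / 2 ^ n"
    proof (cases "n \<le> k")
      case True
      define J where "J = {(s, n), (s, k)}"
      \<comment> \<open>The inequality holds for the roundings of every \<open>\<omega>\<close>, but
        it reaches \<open>M\<close> only through expectations: the excess \<open>f\<close> is
        nonnegative and its expectation is \<open>\<Lambda>\<close> of the zero function.\<close>
      define f where "f x = max 0 (\<bar>x (s, n) - x (s, k)\<bar> - 1 / 2 ^ n)" for x :: "'a \<times> nat \<Rightarrow> real"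
      have "f (Z J \<omega>) = 0" for \<omega> using z_cauchy[OF s True, of \<omega>] by (simp add: f_def Z_def J_def)
      then have fz: "(\<lambda>\<omega>. f (Z J \<omega>)) = (\<lambda>_. 0)" by simp
      have fm: "f \<in> borel_measurable (PiM J (\<lambda>_. borel))"
        unfolding f_def by (intro borel_measurable_max borel_measurable_const borel_measurable_diff
            borel_measurable_abs comp) (auto simp: J_def)
      have "finite J" by (simp add: J_def)
      from E[OF this fm] have int: "integrable M (\<lambda>\<xi>. f (restrict \<xi> J))" "(\<integral>\<xi>. f (restrict \<xi> J) \<partial>M) = 0"
        using W_const[of 0] L_const[of 0] unfolding fz by simp_all
      have "AE \<xi> in M. 0 \<le> f (restrict \<xi> J)" by (simp add: f_def)
      from integral_nonneg_eq_0_iff_AE[OF int(1) this] int(2) have "AE \<xi> in M. f (restrict \<xi> J) = 0" by simp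
      then show ?thesis by eventually_elim (auto simp: f_def J_def)
    qed simp
  qed
  define X where "X s \<xi> = lim (\<lambda>n. \<xi> (s, n))" for s :: 'a and \<xi> :: "'a \<times> nat \<Rightarrow> real"
  have AE_X: "AE \<xi> in M. \<forall>n. \<bar>\<xi> (s, n) - X s \<xi>\<bar> \<le> 1 / 2 ^ n" if s: "s \<in> S" for s
    using AE_cauchy[OF s]
  proof eventually_elim
    case (elim \<xi>)
    have "Cauchy (\<lambda>n. \<xi> (s, n))"
    proof (rule metric_CauchyI)
      fix e :: real assume "e > 0"
      then obtain N where N: "1 / 2 ^ N < e / 2"
        using real_arch_pow_inv[of "e / 2" "1 / 2"] by (auto simp: power_one_over)
      show "\<exists>N. \<forall>m\<ge>N. \<forall>n\<ge>N. dist (\<xi> (s, m)) (\<xi> (s, n)) < e"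
      proof (intro exI allI impI)
        fix m n assume "m \<ge> N" "n \<ge> N"
        then have "\<bar>\<xi> (s, N) - \<xi> (s, m)\<bar> < e / 2" "\<bar>\<xi> (s, N) - \<xi> (s, n)\<bar> < e / 2"
          using elim N by (meson le_less_trans)+
        then show "dist (\<xi> (s, m)) (\<xi> (s, n)) < e" unfolding dist_real_def by linarith
      qed
    qed
    then have lim: "(\<lambda>k. \<xi> (s, k)) \<longlonglongrightarrow> X s \<xi>"
      unfolding X_def by (simp add: Cauchy_convergent_iff convergent_LIMSEQ_iff)
    show ?case
    proof
      fix n
      have "(\<lambda>k. \<bar>\<xi> (s, n) - \<xi> (s, k)\<bar>) \<longlonglongrightarrow> \<bar>\<xi> (s, n) - X s \<xi>\<bar>" by (intro tendsto_intros lim)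
      then show "\<bar>\<xi> (s, n) - X s \<xi>\<bar> \<le> 1 / 2 ^ n"
        by (rule LIMSEQ_le_const2) (use elim in blast)
    qed
  qed
  have Xm: "X s \<in> borel_measurable M" for s
    unfolding X_def measurable_cong_sets[OF sets_M refl]
    by (intro borel_measurable_lim_metric measurable_component_singleton) simp
  \<comment> \<open>Extending linearly from the basis \<open>S\<close> makes \<open>V \<xi>\<close>
    linear for every \<open>\<xi>\<close>, including those for which the limit defining
    \<open>X\<close> fails to exist.\<close>
  define V where "V \<xi> = construct S (\<lambda>s. X s \<xi>)" for \<xi>
  have V: "V \<xi> s = X s \<xi>" if "s \<in> S" for s \<xi>
    unfolding V_def using S that by (rule construct_basis)
  show ?thesis
  proof (rule that[of M V])
    show "prob_space M" by (rule M.prob_space_axioms)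
    show "linear (V \<xi>)" for \<xi> unfolding V_def using S by (rule linear_construct)
    show Vm: "(\<lambda>\<xi>. V \<xi> s) \<in> borel_measurable M" if "s \<in> S" for s using V[OF that] Xm by simp
    have zW: "(\<lambda>\<omega>. f (\<lambda>s. z (s, n) \<omega>)) \<in> W \<and> \<bar>\<Lambda> (\<lambda>\<omega>. f (\<lambda>s. z (s, n) \<omega>)) - L a\<bar> \<le> 1 / 2 ^ n * L b"
      if f: "polyrel S f a" and h: "polyrel S h b" "\<And>\<omega>. 0 \<le> h \<omega>"
        and lip: "\<And>\<omega> \<omega>' \<delta>. 0 \<le> \<delta> \<Longrightarrow> \<delta> \<le> 1 \<Longrightarrow> \<forall>t\<in>S. \<bar>\<omega> t - \<omega>' t\<bar> \<le> \<delta> \<Longrightarrow> \<bar>f \<omega> - f \<omega>'\<bar> \<le> \<delta> * h \<omega>" for f a h b n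
    proof
      have d: "\<bar>f \<omega> - f (\<lambda>s. z (s, n) \<omega>)\<bar> \<le> 1 / 2 ^ n * h \<omega>" for \<omega>
        using z_close by (intro lip) auto
      obtain g c where g: "polyrel S g c" "\<And>\<omega>. \<bar>f \<omega>\<bar> \<le> g \<omega>" using polyrel_dominated[OF f] by metis
      have "polyrel S (\<lambda>\<omega>. g \<omega> + h \<omega>) (c + b)" by (intro polyrel.add g h)
      then have "(\<lambda>\<omega>. g \<omega> + h \<omega>) \<in> W" using poly by blast
      then show 1: "(\<lambda>\<omega>. f (\<lambda>s. z (s, n) \<omega>)) \<in> W"
      proof (rule solid)
        fix \<omega>
        have "1 / 2 ^ n * h \<omega> \<le> 1 * h \<omega>" using h(2) by (intro mult_right_mono) auto
        then show "\<bar>f (\<lambda>s. z (s, n) \<omega>)\<bar> \<le> \<bar>g \<omega> + h \<omega>\<bar>" using d[of \<omega>] g(2)[of \<omega>] by linarith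
      qed
      show "\<bar>\<Lambda> (\<lambda>\<omega>. f (\<lambda>s. z (s, n) \<omega>)) - L a\<bar> \<le> 1 / 2 ^ n * L b"
        using WD[of f _ h "1 / 2 ^ n", OF _ 1 _ d] poly[OF f] poly[OF h(1)] by (simp add: abs_minus_commute)
    qed
    fix f a assume f: "polyrel S f a"
    obtain h b where h: "polyrel S h b" "\<And>\<omega>. 0 \<le> h \<omega>"
      "\<And>\<omega> \<omega>' \<delta>. 0 \<le> \<delta> \<Longrightarrow> \<delta> \<le> 1 \<Longrightarrow> \<forall>t\<in>S. \<bar>\<omega> t - \<omega>' t\<bar> \<le> \<delta> \<Longrightarrow> \<bar>f \<omega> - f \<omega>'\<bar> \<le> \<delta> * h \<omega>"
      using polyrel_lipschitz[OF f] by metis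
    \<comment> \<open>A Lipschitz bound for \<open>h\<close> itself keeps the expectations of
      \<open>h\<close> at the rounded functionals bounded independently of \<open>n\<close>.\<close>
    obtain h' b' where h': "polyrel S h' b'" "\<And>\<omega>. 0 \<le> h' \<omega>"
      "\<And>\<omega> \<omega>' \<delta>. 0 \<le> \<delta> \<Longrightarrow> \<delta> \<le> 1 \<Longrightarrow> \<forall>t\<in>S. \<bar>\<omega> t - \<omega>' t\<bar> \<le> \<delta> \<Longrightarrow> \<bar>h \<omega> - h \<omega>'\<bar> \<le> \<delta> * h' \<omega>"
      using polyrel_lipschitz[OF h(1)] by metis
    obtain F where F: "finite F" "F \<subseteq> S" "polyrel F f a" using polyrel_finite[OF f] by metis
    have En: "integrable M (\<lambda>\<xi>. g (\<lambda>s. \<xi> (s, n))) \<and> (\<integral>\<xi>. g (\<lambda>s. \<xi> (s, n)) \<partial>M) = \<Lambda> (\<lambda>\<omega>. g (\<lambda>s. z (s, n) \<omega>))"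
      if g: "polyrel S g c" and W: "(\<lambda>\<omega>. g (\<lambda>s. z (s, n) \<omega>)) \<in> W" for g c n
    proof -
      obtain G where G: "finite G" "polyrel G g c" using polyrel_finite[OF g] by metis
      define J where "J = G \<times> {n}"
      have 1: "g (\<lambda>s. restrict x J (s, n)) = g (\<lambda>s. x (s, n))" for x
        by (rule polyrel_cong[OF G(2)]) (simp add: J_def)
      then have 2: "g (\<lambda>s. Z J \<omega> (s, n)) = g (\<lambda>s. z (s, n) \<omega>)" for \<omega> unfolding Z_def .
      have "(\<lambda>x. g (\<lambda>s. x (s, n))) \<in> borel_measurable (PiM J (\<lambda>_. borel))"
        by (rule polyrel_measurable[OF G(2)]) (auto intro!: comp simp: J_def)
      from E[OF _ this] show ?thesis using W G(1) unfolding 1 2 by (simp add: J_def)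
    qed
    define \<xi>n where "\<xi>n n \<xi> = (\<lambda>s. \<xi> (s, n))" for n :: nat and \<xi> :: "'a \<times> nat \<Rightarrow> real"
    have close: "AE \<xi> in M. \<forall>n. \<bar>f (\<xi>n n \<xi>) - f (V \<xi>)\<bar> \<le> 1 / 2 ^ n * h (\<xi>n n \<xi>)"
    proof -
      have "AE \<xi> in M. \<forall>s\<in>F. \<forall>n. \<bar>\<xi> (s, n) - X s \<xi>\<bar> \<le> 1 / 2 ^ n"
        using AE_X F by (intro AE_finite_allI) auto
      then show ?thesis
      proof eventually_elim
        case (elim \<xi>)
        show ?case
        proof
          fix n
          \<comment> \<open>The almost sure bound is available on the finite set \<open>F\<close>,
            while the Lipschitz estimate asks for closeness on all of \<open>S\<close>; off
            \<open>F\<close>, where \<open>f\<close> does not look, the rounded value is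
            kept.\<close>
          define \<omega>'' where "\<omega>'' s = (if s \<in> F then X s \<xi> else \<xi> (s, n))" for s
          have "\<bar>f (\<xi>n n \<xi>) - f \<omega>''\<bar> \<le> 1 / 2 ^ n * h (\<xi>n n \<xi>)"
            using elim by (intro h(3)) (auto simp: \<omega>''_def \<xi>n_def)
          moreover have "f \<omega>'' = f (V \<xi>)"
            using F(2) V by (intro polyrel_cong[OF F(3)]) (auto simp: \<omega>''_def)
          ultimately show "\<bar>f (\<xi>n n \<xi>) - f (V \<xi>)\<bar> \<le> 1 / 2 ^ n * h (\<xi>n n \<xi>)" by simp
        qed
      qed
    qed
    have fW: "(\<lambda>\<omega>. f (\<lambda>s. z (s, n) \<omega>)) \<in> W \<and>
        \<bar>\<Lambda> (\<lambda>\<omega>. f (\<lambda>s. z (s, n) \<omega>)) - L a\<bar> \<le> 1 / 2 ^ n * L b" for n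
      by (rule zW[OF f h])
    note fW = conjunct1[OF fW] conjunct2[OF fW]
    have hW: "(\<lambda>\<omega>. h (\<lambda>s. z (s, n) \<omega>)) \<in> W \<and>
        \<bar>\<Lambda> (\<lambda>\<omega>. h (\<lambda>s. z (s, n) \<omega>)) - L b\<bar> \<le> 1 / 2 ^ n * L b'" for n
      by (rule zW[OF h(1) h'])
    note hW = conjunct1[OF hW] conjunct2[OF hW]
    have fn: "integrable M (\<lambda>\<xi>. f (\<xi>n n \<xi>))" "(\<integral>\<xi>. f (\<xi>n n \<xi>) \<partial>M) = \<Lambda> (\<lambda>\<omega>. f (\<lambda>s. z (s, n) \<omega>))" for n
      unfolding \<xi>n_def using En[OF f fW(1), of n] by simp_all
    have hn: "integrable M (\<lambda>\<xi>. h (\<xi>n n \<xi>))" "(\<integral>\<xi>. h (\<xi>n n \<xi>) \<partial>M) = \<Lambda> (\<lambda>\<omega>. h (\<lambda>s. z (s, n) \<omega>))" for n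
      unfolding \<xi>n_def using En[OF h(1) hW(1), of n] by simp_all
    have int: "integrable M (\<lambda>\<xi>. f (V \<xi>))"
    proof (rule Bochner_Integration.integrable_bound)
      show "integrable M (\<lambda>\<xi>. \<bar>f (\<xi>n 0 \<xi>)\<bar> + h (\<xi>n 0 \<xi>))"
        by (intro Bochner_Integration.integrable_add integrable_abs fn hn)
      show "(\<lambda>\<xi>. f (V \<xi>)) \<in> borel_measurable M" by (rule polyrel_measurable[OF f Vm])
      show "AE \<xi> in M. norm (f (V \<xi>)) \<le> norm (\<bar>f (\<xi>n 0 \<xi>)\<bar> + h (\<xi>n 0 \<xi>))"
        using close
      proof eventually_elim
        case (elim \<xi>)
        then have "\<bar>f (\<xi>n 0 \<xi>) - f (V \<xi>)\<bar> \<le> 1 / 2 ^ 0 * h (\<xi>n 0 \<xi>)" by blast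
        then show ?case using h(2)[of "\<xi>n 0 \<xi>"] by simp
      qed
    qed
    have bound: "\<bar>(\<integral>\<xi>. f (V \<xi>) \<partial>M) - L a\<bar> \<le> 1 / 2 ^ n * (2 * L b + L b')" for n
    proof -
      have "\<bar>(\<integral>\<xi>. f (\<xi>n n \<xi>) \<partial>M) - (\<integral>\<xi>. f (V \<xi>) \<partial>M)\<bar> = \<bar>\<integral>\<xi>. f (\<xi>n n \<xi>) - f (V \<xi>) \<partial>M\<bar>"
        using fn(1) int by simp
      also have "\<dots> \<le> (\<integral>\<xi>. \<bar>f (\<xi>n n \<xi>) - f (V \<xi>)\<bar> \<partial>M)" by (rule integral_abs_bound)
      also have "\<dots> \<le> (\<integral>\<xi>. 1 / 2 ^ n * h (\<xi>n n \<xi>) \<partial>M)"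
        using close by (intro integral_mono_AE) (auto intro!: fn hn int Bochner_Integration.integrable_diff)
      also have "\<dots> = 1 / 2 ^ n * \<Lambda> (\<lambda>\<omega>. h (\<lambda>s. z (s, n) \<omega>))" by (simp add: hn)
      also have "\<dots> \<le> 1 / 2 ^ n * (L b + L b')"
      proof (intro mult_left_mono)
        have "0 \<le> L b'" using poly[OF h'(1)] nonneg[of h'] h'(2) by auto
        then have "1 / 2 ^ n * L b' \<le> 1 * L b'" by (intro mult_right_mono) auto
        then show "\<Lambda> (\<lambda>\<omega>. h (\<lambda>s. z (s, n) \<omega>)) \<le> L b + L b'" using hW(2)[of n] by linarith
      qed simp
      finally have "\<bar>(\<integral>\<xi>. f (\<xi>n n \<xi>) \<partial>M) - (\<integral>\<xi>. f (V \<xi>) \<partial>M)\<bar> \<le> 1 / 2 ^ n * (L b + L b')" .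
      \<comment> \<open>The two summands are the error of replacing the limit by its rounding and
        the error between the moment of the rounding and \<open>L a\<close>.\<close>
      moreover have "1 / 2 ^ n * (2 * L b + L b') = 1 / 2 ^ n * (L b + L b') + 1 / 2 ^ n * L b"
        by (simp add: algebra_simps add_divide_distrib)
      ultimately show ?thesis using fW(2)[of n] fn(2)[of n] by linarith
    qed
    have "(\<lambda>n. 1 / 2 ^ n * (2 * L b + L b')) \<longlonglongrightarrow> 0 * (2 * L b + L b')"
      using LIMSEQ_realpow_zero[of "1/2::real"] by (intro tendsto_intros) (simp add: power_one_over)
    then have "\<bar>(\<integral>\<xi>. f (V \<xi>) \<partial>M) - L a\<bar> \<le> 0 * (2 * L b + L b')"
      by (rule LIMSEQ_le_const) (intro exI[of _ 0] allI impI bound)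
    then show "integrable M (\<lambda>\<xi>. f (V \<xi>)) \<and> (\<integral>\<xi>. f (V \<xi>) \<partial>M) = L a" using int by simp
  qed
qed

section \<open>The dual of a locally convex space\<close>

locale locally_convex =
  fixes \<tau> :: "'a::real_vector topology"
  assumes lcs: "locally_convex_hausdorff \<tau>"
begin

abbreviation "T \<equiv> topspace \<tau>"

lemma T_subspace: "subspace T"
  and Hausdorff: "Hausdorff_space \<tau>"
  and add_continuous: "continuous_map (prod_topology \<tau> \<tau>) \<tau> (\<lambda>(x, y). x + y)"
  and scale_continuous: "continuous_map (prod_topology euclideanreal \<tau>) \<tau> (\<lambda>(c, x). c *\<^sub>R x)"
  and convex_nhd: "openin \<tau> U \<Longrightarrow> 0 \<in> U \<Longrightarrow> \<exists>W. openin \<tau> W \<and> convex W \<and> 0 \<in> W \<and> W \<subseteq> U"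
  using lcs by (auto simp: locally_convex_hausdorff_def)

lemma T_0 [simp]: "0 \<in> T"
  and T_add [simp]: "x \<in> T \<Longrightarrow> y \<in> T \<Longrightarrow> x + y \<in> T"
  and T_scale [simp]: "x \<in> T \<Longrightarrow> c *\<^sub>R x \<in> T"
  and T_minus [simp]: "x \<in> T \<Longrightarrow> - x \<in> T"
  using T_subspace by (simp_all add: subspace_0 subspace_add subspace_scale subspace_neg)

lemma scale_map: "continuous_map \<tau> \<tau> (\<lambda>x. a *\<^sub>R x)"
proof -
  have "continuous_map \<tau> \<tau> ((\<lambda>(c, x). c *\<^sub>R x) \<circ> (\<lambda>x. (a, x)))"
    by (rule continuous_map_compose[OF _ scale_continuous]) (intro continuous_map_pairedI; simp)
  then show ?thesis by (simp add: comp_def)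
qed

lemma scale_map_left: "x \<in> T \<Longrightarrow> continuous_map euclideanreal \<tau> (\<lambda>c. c *\<^sub>R x)"
proof -
  assume "x \<in> T"
  then have "continuous_map euclideanreal \<tau> ((\<lambda>(c, x). c *\<^sub>R x) \<circ> (\<lambda>c. (c, x)))"
    by (intro continuous_map_compose[OF _ scale_continuous]) (intro continuous_map_pairedI; simp)
  then show ?thesis by (simp add: comp_def)
qed

lemma translation_map: "b \<in> T \<Longrightarrow> continuous_map \<tau> \<tau> (\<lambda>x. x + b)"
proof -
  assume "b \<in> T"
  then have "continuous_map \<tau> \<tau> ((\<lambda>(x, y). x + y) \<circ> (\<lambda>x. (x, b)))"
    by (intro continuous_map_compose[OF _ add_continuous]) (intro continuous_map_pairedI; simp)
  then show ?thesis by (simp add: comp_def)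
qed

lemma dual_add: "l \<in> continuous_dual \<tau> \<Longrightarrow> x \<in> T \<Longrightarrow> y \<in> T \<Longrightarrow> l (x + y) = l x + l y"
  and dual_scale: "l \<in> continuous_dual \<tau> \<Longrightarrow> x \<in> T \<Longrightarrow> l (c *\<^sub>R x) = c * l x"
  by (auto simp: continuous_dual_def)

lemma dual_zero: "l \<in> continuous_dual \<tau> \<Longrightarrow> l 0 = 0"
  using dual_scale[of l 0 0] by simp

lemma dual_combination:
  assumes l: "l \<in> continuous_dual \<tau>" and m: "m \<in> continuous_dual \<tau>"
  shows "(\<lambda>x\<in>T. l x + c * m x) \<in> continuous_dual \<tau>"
proof -
  have "continuous_map \<tau> euclideanreal (\<lambda>x. l x + c * m x)"
    using l m by (intro continuous_map_add continuous_map_real_mult_left) (auto simp: continuous_dual_def)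
  then have "continuous_map \<tau> euclideanreal (\<lambda>x\<in>T. l x + c * m x)"
    by (rule continuous_map_eq) simp
  then show ?thesis
    using l m by (auto simp: continuous_dual_def algebra_simps)
qed

lemma dual_sum:
  assumes "finite B" "\<And>b. b \<in> B \<Longrightarrow> e b \<in> continuous_dual \<tau>"
  shows "(\<lambda>x\<in>T. \<Sum>b\<in>B. c b * e b x) \<in> continuous_dual \<tau>"
  using assms
proof (induction B rule: finite_induct)
  case empty
  define z where "z = (\<lambda>x\<in>T. \<Sum>b\<in>{}. c b * e b x)"
  have z: "z x = 0" if "x \<in> T" for x using that by (simp add: z_def)
  have "continuous_map \<tau> euclideanreal z"
    by (rule continuous_map_eq[of _ _ "\<lambda>_. 0"]) (simp_all add: z)
  moreover have "z \<in> extensional T" unfolding z_def by (rule restrict_extensional)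
  ultimately have "z \<in> continuous_dual \<tau>" by (simp add: continuous_dual_def z)
  then show ?case by (simp only: z_def)
next
  case (insert b B)
  have "(\<lambda>x\<in>T. (\<lambda>x\<in>T. \<Sum>b\<in>B. c b * e b x) x + c b * e b x) \<in> continuous_dual \<tau>"
    by (intro dual_combination) (use insert in auto)
  moreover have "(\<lambda>x\<in>T. (\<lambda>x\<in>T. \<Sum>b\<in>B. c b * e b x) x + c b * e b x) = (\<lambda>x\<in>T. \<Sum>b\<in>insert b B. c b * e b x)"
    using insert by (auto simp: fun_eq_iff)
  ultimately show ?case by (simp only:)
qed

text \<open>
  The Hahn--Banach argument: with a symmetric convex neighbourhood \<open>V\<close> of \<open>0\<close> missing \<open>t\<close>, a functional
  \<open>l\<close> with \<open>l t = 1\<close> and \<open>l \<le> 1\<close> on \<open>V\<close> corresponds to the functional \<open>(x, s) \<mapsto> s - l x\<close>, which is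
  positive on the cone generated by \<open>V \<times> {1}\<close> and \<open>(0, 1)\<close>.
\<close>

lemma dual_separates:
  assumes t: "t \<in> T" "t \<noteq> 0"
  shows "\<exists>l\<in>continuous_dual \<tau>. l t \<noteq> 0"
proof -
  obtain U U' where U: "openin \<tau> U" "openin \<tau> U'" "0 \<in> U" "t \<in> U'" "disjnt U U'"
    using Hausdorff t unfolding Hausdorff_space_def by (metis T_0)
  obtain W where W: "openin \<tau> W" "convex W" "0 \<in> W" "W \<subseteq> U"
    using convex_nhd[OF U(1,3)] by blast
  define V where "V = W \<inter> {x \<in> T. (- 1) *\<^sub>R x \<in> W}"
  have V_open: "openin \<tau> V"
    unfolding V_def by (intro openin_Int W openin_continuous_map_preimage[OF scale_map])
  have V_minus: "- v \<in> V" if "v \<in> V" for v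
    using openin_subset[OF W(1)] that by (auto simp: V_def)
  have V0: "0 \<in> V" and tV: "t \<notin> V" and VT: "V \<subseteq> T" using W U t by (auto simp: V_def disjnt_def)
  have V_convex: "convex V"
  proof (rule convexI)
    fix x y and u v :: real
    assume a: "x \<in> V" "y \<in> V" "0 \<le> u" "0 \<le> v" "u + v = 1"
    then have "u *\<^sub>R x + v *\<^sub>R y \<in> W" "u *\<^sub>R ((- 1) *\<^sub>R x) + v *\<^sub>R ((- 1) *\<^sub>R y) \<in> W"
      unfolding V_def by (intro convexD[OF W(2)]; blast)+
    moreover have "u *\<^sub>R ((- 1) *\<^sub>R x) + v *\<^sub>R ((- 1) *\<^sub>R y) = (- 1) *\<^sub>R (u *\<^sub>R x + v *\<^sub>R y)"
      by (simp add: algebra_simps)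
    moreover have "u *\<^sub>R x + v *\<^sub>R y \<in> T" using a VT by (intro T_add T_scale) auto
    ultimately show "u *\<^sub>R x + v *\<^sub>R y \<in> V" unfolding V_def by auto
  qed
  have V_star: "c *\<^sub>R v \<in> V" if "v \<in> V" "0 \<le> c" "c \<le> 1" for c v
    using convexD[OF V_convex that(1) V0, of c "1 - c"] that by simp
  have absorb: "\<exists>r>0. \<exists>v\<in>V. x = r *\<^sub>R v" if x: "x \<in> T" for x
  proof -
    have "open {c. c *\<^sub>R x \<in> V}"
      using openin_continuous_map_preimage[OF scale_map_left[OF x] V_open] by simp
    moreover have "0 \<in> {c. c *\<^sub>R x \<in> V}" using V0 by simp
    ultimately obtain e where e: "e > 0" "ball 0 e \<subseteq> {c. c *\<^sub>R x \<in> V}"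
      by (meson openE)
    then have "(e / 2) *\<^sub>R x \<in> V" by (auto simp: subset_iff)
    then show ?thesis using e(1) by (intro exI[of _ "2 / e"] conjI bexI[of _ "(e / 2) *\<^sub>R x"]) auto
  qed
  define G where "G = {((\<alpha> *\<^sub>R t, s), s - \<alpha>) |\<alpha> s :: real. True}"
  define K where "K = {(r *\<^sub>R v, s) |r v s. v \<in> V \<and> 0 \<le> r \<and> r \<le> s}"
  have "subspace G"
    unfolding subspace_def
  proof (intro conjI ballI allI)
    show "0 \<in> G" unfolding G_def by (force simp: zero_prod_def intro: exI[of _ 0])
    fix x y assume "x \<in> G" "y \<in> G"
    then obtain \<alpha> s \<beta> u where "x = ((\<alpha> *\<^sub>R t, s), s - \<alpha>)" "y = ((\<beta> *\<^sub>R t, u), u - \<beta>)"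
      unfolding G_def by blast
    then show "x + y \<in> G" unfolding G_def
      by (intro CollectI exI[of _ "\<alpha> + \<beta>"] exI[of _ "s + u"]) (simp add: algebra_simps)
  next
    fix c x assume "x \<in> G"
    then obtain \<alpha> s where "x = ((\<alpha> *\<^sub>R t, s), s - \<alpha>)" unfolding G_def by blast
    then show "c *\<^sub>R x \<in> G" unfolding G_def
      by (intro CollectI exI[of _ "c * \<alpha>"] exI[of _ "c * s"]) (simp add: algebra_simps)
  qed
  then obtain \<Lambda> where \<Lambda>_G: "\<And>v r. (v, r) \<in> G \<Longrightarrow> \<Lambda> v = r"
    and \<Lambda>_add: "\<And>x y. x \<in> T \<times> UNIV \<Longrightarrow> y \<in> T \<times> UNIV \<Longrightarrow> \<Lambda> (x + y) = \<Lambda> x + \<Lambda> y"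
    and \<Lambda>_scale: "\<And>c x. x \<in> T \<times> UNIV \<Longrightarrow> \<Lambda> (c *\<^sub>R x) = c * \<Lambda> x"
    and \<Lambda>_nonneg: "\<And>x. x \<in> T \<times> UNIV \<Longrightarrow> x \<in> K \<Longrightarrow> 0 \<le> \<Lambda> x"
  proof (rule riesz_extension[of G K "T \<times> UNIV"])
    show "x + y \<in> K" if xy: "x \<in> K" "y \<in> K" for x y
    proof -
      obtain r v s r' v' s' where x: "x = (r *\<^sub>R v, s)" "v \<in> V" "0 \<le> r" "r \<le> s"
        and y: "y = (r' *\<^sub>R v', s')" "v' \<in> V" "0 \<le> r'" "r' \<le> s'"
        using xy unfolding K_def by blast
      show ?thesis
      proof (cases "r + r' = 0")
        case True
        then have "r = 0" "r' = 0" using x y by auto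
        then show ?thesis using x y V0 unfolding K_def
          by (intro CollectI exI[of _ 0] exI[of _ "s + s'"] conjI) auto
      next
        case False
        then have p: "r + r' > 0" using x y by auto
        have "(r / (r + r')) *\<^sub>R v + (r' / (r + r')) *\<^sub>R v' \<in> V"
          using x y p by (intro convexD[OF V_convex]) (auto simp: add_divide_distrib[symmetric])
        moreover have "(r + r') *\<^sub>R ((r / (r + r')) *\<^sub>R v + (r' / (r + r')) *\<^sub>R v') = r *\<^sub>R v + r' *\<^sub>R v'"
          using p by (simp add: scaleR_add_right)
        ultimately have "(r *\<^sub>R v + r' *\<^sub>R v', s + s') \<in> K" unfolding K_def
          using x y by (intro CollectI exI[of _ "r + r'"]
              exI[of _ "(r / (r + r')) *\<^sub>R v + (r' / (r + r')) *\<^sub>R v'"] exI[of _ "s + s'"] conjI) auto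
        then show ?thesis using x y by simp
      qed
    qed
    show "c *\<^sub>R x \<in> K" if c: "0 \<le> c" and x: "x \<in> K" for c x
    proof -
      obtain r v s where "x = (r *\<^sub>R v, s)" "v \<in> V" "0 \<le> r" "r \<le> s" using x unfolding K_def by blast
      then show ?thesis unfolding K_def using c
        by (intro CollectI exI[of _ "c * r"] exI[of _ v] exI[of _ "c * s"]) (auto intro: mult_left_mono)
    qed
    show "0 \<in> K" unfolding K_def using V0
      by (intro CollectI exI[of _ 0] conjI) (auto simp: zero_prod_def)
    show "subspace (T \<times> (UNIV :: real set))" by (intro subspace_Times T_subspace subspace_UNIV)
    show "fst ` G \<subseteq> T \<times> UNIV" using t by (auto simp: G_def)
    show "0 \<le> r" if vr: "(v, r) \<in> G" "v \<in> K" for v r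
    proof -
      obtain \<alpha> s where v: "v = (\<alpha> *\<^sub>R t, s)" "r = s - \<alpha>" using vr(1) unfolding G_def by blast
      obtain \<rho> u where u: "\<alpha> *\<^sub>R t = \<rho> *\<^sub>R u" "u \<in> V" "0 \<le> \<rho>" "\<rho> \<le> s"
        using vr(2) unfolding K_def v(1) by auto
      have "\<alpha> \<le> \<rho>"
      proof (rule ccontr)
        assume "\<not> \<alpha> \<le> \<rho>"
        then have p: "\<alpha> > 0" "\<rho> / \<alpha> \<le> 1" using u(3) by (auto simp: field_simps)
        have "(1 / \<alpha>) *\<^sub>R (\<alpha> *\<^sub>R t) = (1 / \<alpha>) *\<^sub>R (\<rho> *\<^sub>R u)" by (simp only: u(1))
        then have "t = (\<rho> / \<alpha>) *\<^sub>R u" using p by simp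
        then show False using V_star[OF u(2), of "\<rho> / \<alpha>"] p u(3) tV by simp
      qed
      then show ?thesis using u(4) v(2) by simp
    qed
    show "\<exists>v r. (v, r) \<in> G \<and> v - w \<in> K" if w: "w \<in> T \<times> UNIV" for w
    proof -
      obtain x s where xs: "w = (x, s)" "x \<in> T" using w by auto
      \<comment> \<open>Cofinality is the absorption property of \<open>V\<close>: with
        \<open>- x = r *\<^sub>R v\<close>, the pair \<open>(0, s + r)\<close> exceeds
        \<open>(x, s)\<close> by an element of \<open>K\<close>.\<close>
      obtain r v where r: "r > 0" "v \<in> V" "- x = r *\<^sub>R v" using absorb[of "- x"] xs(2) by auto
      have "((0 *\<^sub>R t, s + r), s + r - 0) \<in> G" unfolding G_def by blast
      moreover have "(0 *\<^sub>R t, s + r) - w \<in> K" unfolding K_def using r xs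
        by (intro CollectI exI[of _ r] exI[of _ v]) auto
      ultimately show ?thesis by blast
    qed
  qed auto
  define l where "l = (\<lambda>x\<in>T. - \<Lambda> (x, 0))"
  have l_add: "l (x + y) = l x + l y" if "x \<in> T" "y \<in> T" for x y
    using \<Lambda>_add[of "(x, 0)" "(y, 0)"] that by (simp add: l_def)
  have l_scale: "l (c *\<^sub>R x) = c * l x" if "x \<in> T" for x c
    using \<Lambda>_scale[of "(x, 0)" c] that by (simp add: l_def)
  have le1: "l v \<le> 1" if "v \<in> V" for v
  proof -
    have "((0 *\<^sub>R t, 1), 1 - 0) \<in> G" unfolding G_def by blast
    then have "\<Lambda> (0, 1) = 1" using \<Lambda>_G by fastforce
    moreover have "(1 *\<^sub>R v, 1) \<in> K" unfolding K_def using that by fastforce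
    then have "0 \<le> \<Lambda> (v, 1)" using \<Lambda>_nonneg[of "(v, 1)"] that VT by auto
    moreover have "\<Lambda> (v, 1) = \<Lambda> (v, 0) + \<Lambda> (0, 1)"
      using \<Lambda>_add[of "(v, 0)" "(0, 1)"] that VT by auto
    ultimately show ?thesis using that VT by (auto simp: l_def)
  qed
  have abs_le1: "\<bar>l v\<bar> \<le> 1" if "v \<in> V" for v
    using le1[OF that] le1[OF V_minus[OF that]] l_scale[of v "-1"] that VT by auto
  have "continuous_map \<tau> euclideanreal l"
    unfolding continuous_map
  proof (intro conjI allI impI)
    fix U :: "real set" assume "openin euclideanreal U"
    then have U: "open U" by simp
    show "openin \<tau> {x \<in> T. l x \<in> U}"
    proof (subst openin_subopen, intro ballI)
      fix x assume x: "x \<in> {x \<in> T. l x \<in> U}"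
      then obtain e where e: "e > 0" "ball (l x) e \<subseteq> U" using U by (auto elim: openE)
      \<comment> \<open>Scaling by \<open>2 / e\<close> rather than \<open>1 / e\<close> turns the
        bound by 1 on \<open>V\<close> into a strict bound by \<open>e\<close>.\<close>
      define N where "N = {y \<in> T. y + (- x) \<in> {z \<in> T. (2 / e) *\<^sub>R z \<in> V}}"
      have "openin \<tau> N"
        unfolding N_def using x
        by (intro openin_continuous_map_preimage[OF translation_map] openin_continuous_map_preimage[OF scale_map] V_open) auto
      moreover have "x \<in> N" using x V0 by (simp add: N_def)
      moreover have "N \<subseteq> {x \<in> T. l x \<in> U}"
      proof
        fix y assume y: "y \<in> N"
        then have yT: "y \<in> T" "y + (- x) \<in> T" and "(2 / e) *\<^sub>R (y + (- x)) \<in> V" by (auto simp: N_def)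
        from abs_le1[OF this(3)] have "(2 / e) * \<bar>l (y + (- x))\<bar> \<le> 1"
          using e l_scale[OF yT(2)] by (simp add: abs_mult)
        then have "\<bar>l (y + (- x))\<bar> < e" using e by (simp add: field_simps)
        moreover have "l (y + (- x)) = l y - l x"
          using x yT l_add[of y "- x"] l_scale[of x "-1"] by simp
        ultimately have "l y \<in> ball (l x) e" by (simp add: dist_real_def abs_minus_commute)
        then show "y \<in> {x \<in> T. l x \<in> U}" using e yT by auto
      qed
      ultimately show "\<exists>N. openin \<tau> N \<and> x \<in> N \<and> N \<subseteq> {x \<in> T. l x \<in> U}" by blast
    qed
  qed simp
  then have "l \<in> continuous_dual \<tau>"
    using l_add l_scale by (simp add: continuous_dual_def l_def)
  moreover have "((1 *\<^sub>R t, 0), 0 - 1) \<in> G" unfolding G_def by blast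
  then have "\<Lambda> (t, 0) = - 1" using \<Lambda>_G by fastforce
  then have "l t \<noteq> 0" using t by (simp add: l_def)
  ultimately show ?thesis by blast
qed

text \<open>In the induction step the dual family \<open>e\<close> of \<open>B\<close> corrects a
  functional that does not vanish at \<open>b0 - w\<close>, where \<open>w \<in> span B\<close> has
  the same \<open>e\<close>-coordinates as \<open>b0\<close>. The corrected functional
  \<open>l0\<close> vanishes on \<open>B\<close> but not at \<open>b0\<close>, so a multiple of it
  adjusts the value there.\<close>

lemma dual_interpolation:
  assumes "finite B" "independent B" "B \<subseteq> T"
  shows "\<exists>l\<in>continuous_dual \<tau>. \<forall>b\<in>B. l b = y b"
  using assms
proof (induction B arbitrary: y rule: finite_induct)
  case empty
  then show ?case using dual_sum[of "{}"] by auto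
next
  case (insert b0 B)
  have ind: "independent B" "b0 \<notin> span B" and BT: "B \<subseteq> T" "b0 \<in> T"
    using insert.prems insert.hyps by (auto simp: independent_insert)
  have IH: "\<exists>l\<in>continuous_dual \<tau>. \<forall>b\<in>B. l b = y b" for y by (rule insert.IH[OF ind(1) BT(1)])
  have "\<forall>b. \<exists>l. l \<in> continuous_dual \<tau> \<and> (\<forall>b'\<in>B. l b' = (if b' = b then 1 else 0))"
    using IH[of "\<lambda>b'. if b' = _ then 1 else 0"] by blast
  then obtain e where e: "\<And>b. e b \<in> continuous_dual \<tau>" "\<And>b b'. b' \<in> B \<Longrightarrow> e b b' = (if b' = b then 1 else 0)"
    by metis
  define w where "w = (\<Sum>b\<in>B. e b b0 *\<^sub>R b)"
  have w: "w \<in> span B" unfolding w_def by (intro span_sum span_scale span_base)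
  have wT: "w \<in> T" unfolding w_def using BT by (intro subspace_sum[OF T_subspace]) auto
  have "b0 - w \<noteq> 0" using w ind(2) by auto
  moreover have zT: "b0 - w \<in> T" using BT wT T_subspace by (simp add: subspace_diff)
  ultimately obtain l where l: "l \<in> continuous_dual \<tau>" "l (b0 - w) \<noteq> 0" using dual_separates by blast
  define l0 where "l0 = (\<lambda>x\<in>T. l x + (- 1) * (\<lambda>x\<in>T. \<Sum>b\<in>B. l b * e b x) x)"
  have l0: "l0 \<in> continuous_dual \<tau>"
    unfolding l0_def by (intro dual_combination dual_sum l e insert.hyps)
  have l0B: "l0 b = 0" if "b \<in> B" for b
  proof -
    have "(\<Sum>b'\<in>B. l b' * e b' b) = (\<Sum>b'\<in>B. if b = b' then l b' else 0)"
      using that e(2) by (intro sum.cong) auto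
    then show ?thesis using that BT insert.hyps by (auto simp: l0_def)
  qed
  have lw: "l w = (\<Sum>b\<in>B. l b * e b b0)"
  proof -
    have "l (\<Sum>b\<in>C. e b b0 *\<^sub>R b) = (\<Sum>b\<in>C. l b * e b b0)" if "finite C" "C \<subseteq> B" for C
      using that
    proof (induction C rule: finite_induct)
      case (insert c C)
      have "(\<Sum>b\<in>C. e b b0 *\<^sub>R b) \<in> T" using insert BT by (intro subspace_sum[OF T_subspace]) auto
      moreover have "c \<in> T" using insert.prems BT by auto
      ultimately show ?case using insert by (simp add: dual_add[OF l(1)] dual_scale[OF l(1)])
    qed (simp add: dual_zero[OF l(1)])
    then show ?thesis unfolding w_def using insert.hyps by blast
  qed
  have "l b0 = l (b0 - w) + l w" using dual_add[OF l(1) zT wT] by simp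
  then have "l0 b0 \<noteq> 0" using l(2) lw BT by (simp add: l0_def)
  obtain l1 where l1: "l1 \<in> continuous_dual \<tau>" "\<forall>b\<in>B. l1 b = y b" using IH by blast
  define m where "m = (\<lambda>x\<in>T. l1 x + ((y b0 - l1 b0) / l0 b0) * l0 x)"
  have "m \<in> continuous_dual \<tau>" unfolding m_def by (intro dual_combination l1 l0)
  moreover have "\<forall>b\<in>insert b0 B. m b = y b"
    using \<open>l0 b0 \<noteq> 0\<close> l1(2) l0B BT by (auto simp: m_def)
  ultimately show ?case by blast
qed

text \<open>Here an arbitrary algebraic functional is traded for a continuous one: on
  \<open>F\<close> only its values on a finite basis matter.\<close>

lemma dual_extends:
  assumes F: "F \<in> finite_dim_subspaces \<tau>" and \<omega>: "linear \<omega>"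
  obtains l where "l \<in> continuous_dual \<tau>" "\<And>f. f \<in> F \<Longrightarrow> l f = \<omega> f"
proof -
  obtain B0 where B0: "finite B0" "F = span B0" "F \<subseteq> T" using F by (auto simp: finite_dim_subspaces_def)
  obtain B where B: "B \<subseteq> B0" "independent B" "B0 \<subseteq> span B" using maximal_independent_subset[of B0] by metis
  have "B \<subseteq> T" using B(1) B0 span_superset by blast
  moreover have fB: "finite B" using B B0 finite_subset by blast
  ultimately obtain l where l: "l \<in> continuous_dual \<tau>" "\<forall>b\<in>B. l b = \<omega> b"
    using dual_interpolation[OF _ B(2), of \<omega>] by blast
  have FB: "F = span B" using B B0 by (metis span_mono span_span subset_antisym)
  have "f \<in> T \<and> l f = \<omega> f" if "f \<in> span B" for f
    using that
  proof (induction rule: span_induct_alt)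
    case base
    then show ?case using dual_zero[OF l(1)] linear_0[OF \<omega>] by simp
  next
    case (step c x y)
    then have "x \<in> T" using \<open>B \<subseteq> T\<close> by blast
    then show ?case using step l(2)
      by (simp add: dual_add[OF l(1)] dual_scale[OF l(1)] linear_add[OF \<omega>] linear_scale[OF \<omega>])
  qed
  then show ?thesis using that[OF l(1)] FB by blast
qed

end

section \<open>The cylinder measure of a random functional\<close>

context locally_convex
begin

lemma finite_dim_subset: "F \<in> finite_dim_subspaces \<tau> \<Longrightarrow> F \<subseteq> T"
  by (simp add: finite_dim_subspaces_def)

lemma finite_dim_span: "finite B \<Longrightarrow> B \<subseteq> T \<Longrightarrow> span B \<in> finite_dim_subspaces \<tau>"
  using span_minimal[OF _ T_subspace] by (auto simp: finite_dim_subspaces_def)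

lemma finite_dim_directed:
  assumes "F \<in> finite_dim_subspaces \<tau>" "G \<in> finite_dim_subspaces \<tau>"
  obtains H where "H \<in> finite_dim_subspaces \<tau>" "F \<subseteq> H" "G \<subseteq> H"
proof -
  obtain B C where "finite B" "F = span B" "finite C" "G = span C" "F \<subseteq> T" "G \<subseteq> T"
    using assms by (auto simp: finite_dim_subspaces_def)
  then show ?thesis
    by (intro that[of "span (B \<union> C)"] finite_dim_span) (auto intro: span_base span_mono[THEN subsetD])
qed

text \<open>For \<open>\<omega>\<close> in the continuous dual this is its coset modulo the
  annihilator of \<open>F\<close>. For any other linear \<open>\<omega>\<close> and
  finite-dimensional \<open>F\<close> it is still such a coset, which gives a discontinuous
  functional a place in the quotient.\<close>

definition fibre :: "'a set \<Rightarrow> ('a \<Rightarrow> real) \<Rightarrow> ('a \<Rightarrow> real) set" where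
  "fibre F \<omega> = {l \<in> continuous_dual \<tau>. \<forall>f\<in>F. l f = \<omega> f}"

lemma dual_coset_eq_fibre:
  assumes F: "F \<subseteq> T" and l: "l \<in> continuous_dual \<tau>"
  shows "dual_coset \<tau> F l = fibre F l"
proof
  show "dual_coset \<tau> F l \<subseteq> fibre F l"
  proof
    fix k assume "k \<in> dual_coset \<tau> F l"
    then obtain m where m: "m \<in> continuous_dual \<tau>" "\<forall>f\<in>F. m f = 0" and k: "k = (\<lambda>x\<in>T. l x + m x)"
      unfolding dual_coset_def annihilator_def by blast
    have "(\<lambda>x\<in>T. l x + 1 * m x) \<in> continuous_dual \<tau>" by (rule dual_combination[OF l m(1)])
    then have "k \<in> continuous_dual \<tau>" unfolding k by (simp only: mult_1)
    then show "k \<in> fibre F l" using m(2) F by (auto simp: fibre_def k)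
  qed
  show "fibre F l \<subseteq> dual_coset \<tau> F l"
  proof
    fix k assume "k \<in> fibre F l"
    then have k: "k \<in> continuous_dual \<tau>" "\<forall>f\<in>F. k f = l f" by (auto simp: fibre_def)
    define m where "m = (\<lambda>x\<in>T. k x + (- 1) * l x)"
    have "m \<in> annihilator \<tau> F"
      unfolding annihilator_def using dual_combination[OF k(1) l, of "- 1"] k(2) F by (auto simp: m_def)
    moreover have "k x = (\<lambda>x\<in>T. l x + m x) x" for x
      using k(1) by (auto simp: m_def continuous_dual_def extensional_def)
    then have "k = (\<lambda>x\<in>T. l x + m x)" ..
    ultimately show "k \<in> dual_coset \<tau> F l" unfolding dual_coset_def by blast
  qed
qed

lemma fibre_coset:
  assumes F: "F \<in> finite_dim_subspaces \<tau>" and l: "l \<in> fibre F \<omega>"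
  shows "dual_coset \<tau> F l = fibre F \<omega>"
  using l dual_coset_eq_fibre[OF finite_dim_subset[OF F], of l] by (auto simp: fibre_def)

lemma fibre_nonempty:
  assumes "F \<in> finite_dim_subspaces \<tau>" "linear \<omega>"
  obtains l where "l \<in> fibre F \<omega>"
proof -
  obtain l where "l \<in> continuous_dual \<tau>" "\<And>f. f \<in> F \<Longrightarrow> l f = \<omega> f"
    using dual_extends[OF assms] by blast
  then show ?thesis by (intro that[of l]) (simp add: fibre_def)
qed

lemma fibre_in_quotient:
  assumes "F \<in> finite_dim_subspaces \<tau>" "linear \<omega>"
  shows "fibre F \<omega> \<in> dual_quotient \<tau> F"
proof -
  obtain l where l: "l \<in> fibre F \<omega>" using fibre_nonempty[OF assms] .
  then show ?thesis using fibre_coset[OF assms(1) l] unfolding dual_quotient_def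
    by (intro image_eqI[of _ _ l]) (auto simp: fibre_def)
qed

lemma quotient_open_subset: "openin (dual_quotient_topology \<tau> F) U \<Longrightarrow> U \<subseteq> dual_quotient \<tau> F"
  using openin_subset[of "dual_quotient_topology \<tau> F" U]
  unfolding dual_quotient_topology_def dual_quotient_def by (fastforce simp: topology_generated_by_topspace)

lemma space_quotient_borel: "space (dual_quotient_borel \<tau> F) = dual_quotient \<tau> F"
  unfolding dual_quotient_borel_def using quotient_open_subset by (intro space_measure_of) auto

lemma quotient_subbasis:
  assumes F: "F \<in> finite_dim_subspaces \<tau>" and f: "f \<in> F" and \<omega>: "linear \<omega>"
  shows "fibre F \<omega> \<in> dual_coset \<tau> F ` {l \<in> continuous_dual \<tau>. l f \<in> W} \<longleftrightarrow> \<omega> f \<in> W"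
proof
  assume "fibre F \<omega> \<in> dual_coset \<tau> F ` {l \<in> continuous_dual \<tau>. l f \<in> W}"
  then obtain l where l: "l \<in> continuous_dual \<tau>" "l f \<in> W" "fibre F \<omega> = dual_coset \<tau> F l" by blast
  then have "l \<in> fibre F \<omega>" using dual_coset_eq_fibre[OF finite_dim_subset[OF F] l(1)] by (simp add: fibre_def)
  then show "\<omega> f \<in> W" using l(2) f by (simp add: fibre_def)
next
  assume W: "\<omega> f \<in> W"
  obtain l where l: "l \<in> fibre F \<omega>" using fibre_nonempty[OF F \<omega>] .
  then show "fibre F \<omega> \<in> dual_coset \<tau> F ` {l \<in> continuous_dual \<tau>. l f \<in> W}"
    using fibre_coset[OF F l] W f by (intro image_eqI[of _ _ l]) (auto simp: fibre_def)
qed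

text \<open>Every \<open>f \<in> F\<close> is a finite combination of the \<open>e i\<close>, so a
  subbasic condition is an open condition on these values; intersections and unions preserve that.
  Padding with zeros turns the values into a sequence, whose measurability can be checked
  coordinatewise.\<close>

lemma quotient_open_coordinates:
  fixes n :: nat
  assumes F: "F \<in> finite_dim_subspaces \<tau>" and e: "bij_betw e {..<n} B" and B: "F = span B"
    and U: "openin (dual_quotient_topology \<tau> F) U"
  shows "\<exists>Y. open Y \<and> (\<forall>\<omega>. linear \<omega> \<longrightarrow> (fibre F \<omega> \<in> U \<longleftrightarrow> (\<lambda>i. if i < n then \<omega> (e i) else 0) \<in> Y))"
  using U unfolding dual_quotient_topology_def openin_topology_generated_by_iff
proof (induction rule: generate_topology_on.induct)
  case Empty
  then show ?case by (intro exI[of _ "{}"]) simp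
next
  case (Int a b)
  obtain Y where Y: "open Y" "\<forall>\<omega>. linear \<omega> \<longrightarrow> (fibre F \<omega> \<in> a \<longleftrightarrow> (\<lambda>i. if i < n then \<omega> (e i) else 0) \<in> Y)"
    using Int.IH(1) by (elim exE conjE)
  obtain Z where Z: "open Z" "\<forall>\<omega>. linear \<omega> \<longrightarrow> (fibre F \<omega> \<in> b \<longleftrightarrow> (\<lambda>i. if i < n then \<omega> (e i) else 0) \<in> Z)"
    using Int.IH(2) by (elim exE conjE)
  show ?case
  proof (intro exI[of _ "Y \<inter> Z"] conjI allI impI)
    show "open (Y \<inter> Z)" using Y(1) Z(1) by (rule open_Int)
  qed (use Y(2) Z(2) in simp)
next
  case (UN K)
  have "\<exists>Y. open Y \<and> (\<forall>\<omega>. linear \<omega> \<longrightarrow> (fibre F \<omega> \<in> k \<longleftrightarrow> (\<lambda>i. if i < n then \<omega> (e i) else 0) \<in> Y))"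
    if "k \<in> K" for k
    using that by (rule UN.IH)
  then obtain Y where Y: "\<And>k. k \<in> K \<Longrightarrow> open (Y k)"
    "\<And>k \<omega>. k \<in> K \<Longrightarrow> linear \<omega> \<Longrightarrow> fibre F \<omega> \<in> k \<longleftrightarrow> (\<lambda>i. if i < n then \<omega> (e i) else 0) \<in> Y k"
    by metis
  show ?case
  proof (intro exI[of _ "\<Union>k\<in>K. Y k"] conjI allI impI)
    show "open (\<Union>k\<in>K. Y k)" using Y(1) by (rule open_UN[OF ballI])
  qed (use Y(2) in simp)
next
  case (Basis s)
  then obtain f W where s: "s = dual_coset \<tau> F ` {l \<in> continuous_dual \<tau>. l f \<in> W}" and f: "f \<in> F" and W: "open W"
    by (elim CollectE exE conjE)
  have fin: "finite B" using bij_betw_finite[OF e] by simp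
  obtain u where u: "f = (\<Sum>b\<in>B. u b *\<^sub>R b)" using f B span_finite[OF fin] by auto
  define Y where "Y = (\<lambda>x :: nat \<Rightarrow> real. \<Sum>i<n. u (e i) * x i) -` W"
  have "open Y"
    unfolding Y_def using W
    by (intro open_vimage continuous_on_sum continuous_on_mult continuous_on_const continuous_on_product_coordinates)
  moreover have "\<omega> f = (\<Sum>i<n. u (e i) * (if i < n then \<omega> (e i) else 0))" if \<omega>: "linear \<omega>" for \<omega>
  proof -
    have "\<omega> f = (\<Sum>b\<in>B. u b * \<omega> b)" unfolding u by (simp add: linear_sum[OF \<omega>] linear_scale[OF \<omega>])
    also have "\<dots> = (\<Sum>i<n. u (e i) * \<omega> (e i))" by (rule sum.reindex_bij_betw[OF e, symmetric])
    finally show ?thesis by simp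
  qed
  ultimately show ?case
    using quotient_subbasis[OF F f] by (intro exI[of _ Y]) (simp add: s Y_def)
qed

end

section \<open>The measure that a random linear functional induces on cylinder sets\<close>

locale random_functional = locally_convex \<tau> + prob_space M
  for \<tau> :: "'a::{real_algebra_1, comm_ring_1} topology" and M :: "'b measure" +
  fixes V :: "'b \<Rightarrow> 'a \<Rightarrow> real"
  assumes V_linear: "linear (V \<xi>)"
    and V_measurable: "t \<in> topspace \<tau> \<Longrightarrow> (\<lambda>\<xi>. V \<xi> t) \<in> borel_measurable M"
begin

lemma fibre_measurable:
  assumes F: "F \<in> finite_dim_subspaces \<tau>"
  shows "(\<lambda>\<xi>. fibre F (V \<xi>)) \<in> measurable M (dual_quotient_borel \<tau> F)"
  unfolding dual_quotient_borel_def
proof (rule measurable_measure_of)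
  show "{U. openin (dual_quotient_topology \<tau> F) U} \<subseteq> Pow (dual_quotient \<tau> F)"
    using quotient_open_subset by auto
  show "(\<lambda>\<xi>. fibre F (V \<xi>)) \<in> space M \<rightarrow> dual_quotient \<tau> F"
    using fibre_in_quotient[OF F V_linear] by auto
  fix U assume "U \<in> {U. openin (dual_quotient_topology \<tau> F) U}"
  then have U: "openin (dual_quotient_topology \<tau> F) U" by simp
  obtain B where B: "finite B" "F = span B" using F by (auto simp: finite_dim_subspaces_def)
  obtain e where e: "bij_betw e {..<card B} B"
    using ex_bij_betw_nat_finite[OF B(1)] by (auto simp: lessThan_atLeast0)
  obtain Y where Y: "open Y"
    "\<And>\<omega>. linear \<omega> \<Longrightarrow> fibre F \<omega> \<in> U \<longleftrightarrow> (\<lambda>i. if i < card B then \<omega> (e i) else 0) \<in> Y"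
    using quotient_open_coordinates[OF F e B(2) U] by blast
  have "(\<lambda>\<xi> i. if i < card B then V \<xi> (e i) else 0) \<in> borel_measurable M"
  proof (rule measurable_coordinatewise_then_product)
    fix i
    show "(\<lambda>\<xi>. if i < card B then V \<xi> (e i) else 0) \<in> borel_measurable M"
    proof (cases "i < card B")
      case True
      then have "e i \<in> B" using e by (auto simp: bij_betw_def)
      then have "e i \<in> T" using B finite_dim_subset[OF F] span_superset by blast
      then show ?thesis using V_measurable True by simp
    qed simp
  qed
  from measurable_sets[OF this, of Y] Y(1)
  have "(\<lambda>\<xi> i. if i < card B then V \<xi> (e i) else 0) -` Y \<inter> space M \<in> sets M" by simp
  also have "(\<lambda>\<xi> i. if i < card B then V \<xi> (e i) else 0) -` Y \<inter> space M = (\<lambda>\<xi>. fibre F (V \<xi>)) -` U \<inter> space M"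
    using Y(2)[OF V_linear] by auto
  finally show "(\<lambda>\<xi>. fibre F (V \<xi>)) -` U \<inter> space M \<in> sets M" .
qed

definition law :: "'a set \<Rightarrow> ('a \<Rightarrow> real) set measure" where
  "law F = distr M (dual_quotient_borel \<tau> F) (\<lambda>\<xi>. fibre F (V \<xi>))"

lemma prob_space_law: "F \<in> finite_dim_subspaces \<tau> \<Longrightarrow> prob_space (law F)"
  unfolding law_def by (intro prob_space_distr fibre_measurable)

text \<open>
  \<open>V \<xi>\<close> need not lie in the continuous dual, so the event \<open>V \<xi> \<in> N\<close> is replaced by its
  finite-dimensional meaning.
\<close>

definition cyl :: "('a \<Rightarrow> real) set \<Rightarrow> real" where
  "cyl N = measure M {\<xi> \<in> space M. \<exists>F\<in>finite_dim_subspaces \<tau>. fibre F (V \<xi>) \<subseteq> N}"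

text \<open>Two subspaces \<open>F\<close> and \<open>G\<close> lie in a common \<open>H\<close>,
  and an element of the nonempty fibre over \<open>H\<close> links the conditions over both. Hence
  \<open>cyl\<close> does not depend on how a cylinder set is presented.\<close>

lemma fibre_subset_cylinder_set:
  assumes F: "F \<in> finite_dim_subspaces \<tau>" and \<omega>: "linear \<omega>"
  shows "(\<exists>G\<in>finite_dim_subspaces \<tau>. fibre G \<omega> \<subseteq> cylinder_set \<tau> F A) \<longleftrightarrow> fibre F \<omega> \<in> A"
proof
  assume "\<exists>G\<in>finite_dim_subspaces \<tau>. fibre G \<omega> \<subseteq> cylinder_set \<tau> F A"
  then obtain G where G: "G \<in> finite_dim_subspaces \<tau>" "fibre G \<omega> \<subseteq> cylinder_set \<tau> F A" by blast
  obtain H where H: "H \<in> finite_dim_subspaces \<tau>" "F \<subseteq> H" "G \<subseteq> H" using finite_dim_directed[OF F G(1)] .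
  obtain l where "l \<in> fibre H \<omega>" using fibre_nonempty[OF H(1) \<omega>] .
  then have l: "l \<in> fibre F \<omega>" "l \<in> fibre G \<omega>" using H by (auto simp: fibre_def)
  then have "dual_coset \<tau> F l \<in> A" using G(2) by (auto simp: cylinder_set_def)
  then show "fibre F \<omega> \<in> A" using fibre_coset[OF F l(1)] by simp
next
  assume A: "fibre F \<omega> \<in> A"
  have "fibre F \<omega> \<subseteq> cylinder_set \<tau> F A"
  proof
    fix l assume l: "l \<in> fibre F \<omega>"
    then show "l \<in> cylinder_set \<tau> F A" using fibre_coset[OF F l] A by (simp add: cylinder_set_def fibre_def)
  qed
  then show "\<exists>G\<in>finite_dim_subspaces \<tau>. fibre G \<omega> \<subseteq> cylinder_set \<tau> F A" using F by blast
qed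

lemma cyl_cylinder_set:
  assumes F: "F \<in> finite_dim_subspaces \<tau>"
  shows "cyl (cylinder_set \<tau> F A) = measure M {\<xi> \<in> space M. fibre F (V \<xi>) \<in> A}"
  unfolding cyl_def using fibre_subset_cylinder_set[OF F V_linear] by simp

lemma cyl_law:
  assumes F: "F \<in> finite_dim_subspaces \<tau>" and A: "A \<in> sets (dual_quotient_borel \<tau> F)"
  shows "cyl (cylinder_set \<tau> F A) = measure (law F) A"
  unfolding law_def cyl_cylinder_set[OF F] measure_distr[OF fibre_measurable[OF F] A]
  by (rule arg_cong[of _ _ "measure M"]) auto

lemma cylinder_measure_cyl: "cylinder_measure \<tau> cyl"
  unfolding cylinder_measure_def
proof (intro conjI ballI allI impI)
  fix N show "0 \<le> cyl N" "cyl N \<le> 1" by (simp_all add: cyl_def)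
next
  have "span {} \<in> finite_dim_subspaces \<tau>" by (rule finite_dim_span) auto
  then have "{\<xi> \<in> space M. \<exists>F\<in>finite_dim_subspaces \<tau>. fibre F (V \<xi>) \<subseteq> continuous_dual \<tau>} = space M"
    by (auto simp: fibre_def)
  then show "cyl (continuous_dual \<tau>) = 1" by (simp add: cyl_def prob_space)
next
  fix F and N :: "nat \<Rightarrow> ('a \<Rightarrow> real) set"
  assume F: "F \<in> finite_dim_subspaces \<tau>" and "range N \<subseteq> cylinder_sets_over \<tau> F \<and> disjoint_family N"
  then have N: "\<And>n. N n \<in> cylinder_sets_over \<tau> F" and disj: "disjoint_family N" by auto
  then have "\<forall>n. \<exists>A. A \<in> sets (dual_quotient_borel \<tau> F) \<and> N n = cylinder_set \<tau> F A"
    unfolding cylinder_sets_over_def by blast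
  then obtain A where A: "\<And>n. A n \<in> sets (dual_quotient_borel \<tau> F)" "\<And>n. N n = cylinder_set \<tau> F (A n)"
    by metis
  \<comment> \<open>Each coset in the quotient comes from a functional, so disjoint cylinder sets
    over the same subspace have disjoint bases.\<close>
  have "disjoint_family A"
    unfolding disjoint_family_on_def
  proof (intro ballI impI)
    fix m n :: nat assume "m \<noteq> n"
    show "A m \<inter> A n = {}"
    proof (rule ccontr)
      assume "A m \<inter> A n \<noteq> {}"
      then obtain c where c: "c \<in> A m" "c \<in> A n" by blast
      then have "c \<in> dual_quotient \<tau> F"
        using sets.sets_into_space[OF A(1)[of m]] by (auto simp: space_quotient_borel)
      then obtain l where "l \<in> continuous_dual \<tau>" "c = dual_coset \<tau> F l" unfolding dual_quotient_def by blast
      then have "l \<in> N m \<inter> N n" using c by (simp add: A(2) cylinder_set_def)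
      then show False using disj \<open>m \<noteq> n\<close> unfolding disjoint_family_on_def by blast
    qed
  qed
  moreover have "range A \<subseteq> sets (law F)" using A(1) by (auto simp: law_def)
  ultimately have "(\<lambda>n. measure (law F) (A n)) sums measure (law F) (\<Union>n. A n)"
    using finite_measure.finite_measure_UNION[OF prob_space.finite_measure[OF prob_space_law[OF F]]] by blast
  moreover have "(\<Union>n. N n) = cylinder_set \<tau> F (\<Union>n. A n)" by (auto simp: A(2) cylinder_set_def)
  moreover have "(\<Union>n. A n) \<in> sets (dual_quotient_borel \<tau> F)" using A(1) by auto
  ultimately show "(\<lambda>n. cyl (N n)) sums cyl (\<Union>n. N n)" using A by (simp add: cyl_law[OF F])
qed

lemma induced_measure_cyl:
  assumes F: "F \<in> finite_dim_subspaces \<tau>"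
  shows "induced_measure \<tau> cyl F = law F"
proof -
  interpret law: prob_space "law F" by (rule prob_space_law[OF F])
  let ?N = "dual_quotient_borel \<tau> F"
  have "induced_measure \<tau> cyl F = measure_of (space ?N) (sets ?N) (emeasure (law F))"
    unfolding induced_measure_def space_quotient_borel[symmetric]
  proof (rule measure_of_eq)
    show "sets ?N \<subseteq> Pow (space ?N)" by (rule sets.space_closed)
    fix A assume "A \<in> sigma_sets (space ?N) (sets ?N)"
    then have "A \<in> sets ?N" by (simp add: sets.sigma_sets_eq)
    then show "ennreal (cyl (cylinder_set \<tau> F A)) = emeasure (law F) A"
      by (simp add: cyl_law[OF F] law.emeasure_eq_measure)
  qed
  also have "\<dots> = law F" using measure_of_of_measure[of "law F"] by (simp add: law_def)
  finally show ?thesis .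
qed

lemma has_cylinder_integralD:
  assumes "has_cylinder_integral \<tau> cyl g I"
  obtains F h where "F \<in> finite_dim_subspaces \<tau>" "\<And>l. l \<in> continuous_dual \<tau> \<Longrightarrow> g l = h (dual_coset \<tau> F l)"
    "I = (\<integral>\<xi>. h (fibre F (V \<xi>)) \<partial>M)"
proof -
  obtain F h where F: "F \<in> finite_dim_subspaces \<tau>" and h: "h \<in> borel_measurable (dual_quotient_borel \<tau> F)"
    and g: "\<forall>l\<in>continuous_dual \<tau>. g l = h (dual_coset \<tau> F l)"
    and I: "I = integral\<^sup>L (induced_measure \<tau> cyl F) h"
    using assms unfolding has_cylinder_integral_def by blast
  show ?thesis
    using that[OF F, of h] g I unfolding induced_measure_cyl[OF F]
    by (simp add: law_def integral_distr[OF fibre_measurable[OF F] h])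
qed

text \<open>The two representations of \<open>g\<close> are compared at a continuous functional that
  agrees with \<open>V \<xi>\<close> on a subspace containing both \<open>F\<close> and
  \<open>G\<close>. This justifies the definite description in
  \<open>cylinder_integral\<close>.\<close>

lemma has_cylinder_integral_unique:
  assumes "has_cylinder_integral \<tau> cyl g I" "has_cylinder_integral \<tau> cyl g J"
  shows "I = J"
proof -
  obtain F h where F: "F \<in> finite_dim_subspaces \<tau>" "\<And>l. l \<in> continuous_dual \<tau> \<Longrightarrow> g l = h (dual_coset \<tau> F l)"
    "I = (\<integral>\<xi>. h (fibre F (V \<xi>)) \<partial>M)"
    using has_cylinder_integralD[OF assms(1)] by metis
  obtain G k where G: "G \<in> finite_dim_subspaces \<tau>" "\<And>l. l \<in> continuous_dual \<tau> \<Longrightarrow> g l = k (dual_coset \<tau> G l)"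
    "J = (\<integral>\<xi>. k (fibre G (V \<xi>)) \<partial>M)"
    using has_cylinder_integralD[OF assms(2)] by metis
  obtain H where H: "H \<in> finite_dim_subspaces \<tau>" "F \<subseteq> H" "G \<subseteq> H" using finite_dim_directed[OF F(1) G(1)] .
  have "h (fibre F (V \<xi>)) = k (fibre G (V \<xi>))" for \<xi>
  proof -
    obtain l where "l \<in> fibre H (V \<xi>)" using fibre_nonempty[OF H(1) V_linear] .
    then have l: "l \<in> fibre F (V \<xi>)" "l \<in> fibre G (V \<xi>)" "l \<in> continuous_dual \<tau>"
      using H by (auto simp: fibre_def)
    show ?thesis
      using F(2)[OF l(3)] G(2)[OF l(3)] fibre_coset[OF F(1) l(1)] fibre_coset[OF G(1) l(2)] by simp
  qed
  then show ?thesis using F(3) G(3) by simp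
qed

lemma has_cylinder_integral_polyrel:
  assumes g: "polyrel T g a" and int: "integrable M (\<lambda>\<xi>. g (V \<xi>))"
  shows "has_cylinder_integral \<tau> cyl g (\<integral>\<xi>. g (V \<xi>) \<partial>M)"
proof -
  obtain B where B: "finite B" "B \<subseteq> T" "polyrel B g a" using polyrel_finite[OF g] .
  define F where "F = span B"
  have F: "F \<in> finite_dim_subspaces \<tau>" unfolding F_def using B by (intro finite_dim_span)
  have BF: "B \<subseteq> F" unfolding F_def by (rule span_superset)
  \<comment> \<open>A chosen representative of a coset is determined only on \<open>F\<close>, but
    \<open>g\<close> reads only the values on \<open>B \<subseteq> F\<close>, so composing with
    \<open>rep\<close> gives a Borel function on the quotient that represents
    \<open>g\<close>.\<close>
  define rep where "rep c = (SOME l. l \<in> c)" for c :: "('a \<Rightarrow> real) set"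
  have rep: "rep (fibre F \<omega>) f = \<omega> f" if "fibre F \<omega> \<noteq> {}" "f \<in> F" for \<omega> f
  proof -
    have "rep (fibre F \<omega>) \<in> fibre F \<omega>" unfolding rep_def using that(1) by (simp add: some_in_eq)
    then show ?thesis using that(2) by (simp add: fibre_def)
  qed
  have rep_coset: "rep (dual_coset \<tau> F l) f = l f" if l: "l \<in> continuous_dual \<tau>" and f: "f \<in> F" for l f
  proof -
    have "l \<in> fibre F l" using l by (simp add: fibre_def)
    then show ?thesis using rep[of l f] f dual_coset_eq_fibre[OF finite_dim_subset[OF F] l] by auto
  qed
  have rep_meas: "(\<lambda>c. rep c f) \<in> borel_measurable (dual_quotient_borel \<tau> F)" if f: "f \<in> B" for f
  proof (rule borel_measurableI)
    fix W :: "real set" assume W: "open W"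
    have fF: "f \<in> F" using f BF by blast
    have r: "rep (dual_coset \<tau> F l) f = l f" if "l \<in> continuous_dual \<tau>" for l
      using rep_coset[OF that fF] .
    have "(\<lambda>c. rep c f) -` W \<inter> space (dual_quotient_borel \<tau> F) = dual_coset \<tau> F ` {l \<in> continuous_dual \<tau>. l f \<in> W}"
      unfolding space_quotient_borel dual_quotient_def using r by auto
    moreover have "openin (dual_quotient_topology \<tau> F) (dual_coset \<tau> F ` {l \<in> continuous_dual \<tau>. l f \<in> W})"
      unfolding dual_quotient_topology_def by (rule topology_generated_by_Basis) (use fF W in blast)
    ultimately show "(\<lambda>c. rep c f) -` W \<inter> space (dual_quotient_borel \<tau> F) \<in> sets (dual_quotient_borel \<tau> F)"
      unfolding dual_quotient_borel_def using quotient_open_subset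
      by (simp add: sets_measure_of sigma_sets.Basic subset_iff)
  qed
  have h: "(\<lambda>c. g (rep c)) \<in> borel_measurable (dual_quotient_borel \<tau> F)"
    by (rule polyrel_measurable[OF B(3) rep_meas])
  have gl: "g l = g (rep (dual_coset \<tau> F l))" if l: "l \<in> continuous_dual \<tau>" for l
  proof (rule polyrel_cong[OF B(3)])
    fix t assume "t \<in> B"
    then have "t \<in> F" using BF by blast
    then show "l t = rep (dual_coset \<tau> F l) t"
      using rep_coset[OF l] by simp
  qed
  have gV: "g (rep (fibre F (V \<xi>))) = g (V \<xi>)" for \<xi>
  proof (rule polyrel_cong[OF B(3)])
    fix t assume "t \<in> B"
    then have "t \<in> F" using BF by blast
    then show "rep (fibre F (V \<xi>)) t = V \<xi> t"
      using rep[of "V \<xi>" t] fibre_nonempty[OF F V_linear] by blast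
  qed
  show ?thesis
    unfolding has_cylinder_integral_def
  proof (intro bexI[OF _ F] bexI[OF _ h] conjI ballI)
    show "integrable (induced_measure \<tau> cyl F) (\<lambda>c. g (rep c))"
      using int by (simp add: induced_measure_cyl[OF F] law_def integrable_distr_eq[OF fibre_measurable[OF F] h] gV)
    show "(\<integral>\<xi>. g (V \<xi>) \<partial>M) = integral\<^sup>L (induced_measure \<tau> cyl F) (\<lambda>c. g (rep c))"
      by (simp add: induced_measure_cyl[OF F] law_def integral_distr[OF fibre_measurable[OF F] h] gV)
  qed (rule gl)
qed

text \<open>The cylinder integral sees its integrand on the continuous dual only. The freedom in
  \<open>k\<close> serves integrands built from \<open>character_of\<close>, which is described by
  polynomials only at restrictions of characters.\<close>

lemma cylinder_integral_polyrel:
  assumes "polyrel T g a" "integrable M (\<lambda>\<xi>. g (V \<xi>))" and eq: "\<And>l. l \<in> continuous_dual \<tau> \<Longrightarrow> k l = g l"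
  shows "cylinder_integrable \<tau> cyl k" "cylinder_integral \<tau> cyl k = (\<integral>\<xi>. g (V \<xi>) \<partial>M)"
proof -
  have k: "has_cylinder_integral \<tau> cyl k (\<integral>\<xi>. g (V \<xi>) \<partial>M)"
    using has_cylinder_integral_polyrel[OF assms(1,2)] eq by (simp add: has_cylinder_integral_def)
  then show "cylinder_integrable \<tau> cyl k" by (auto simp: cylinder_integrable_def)
  show "cylinder_integral \<tau> cyl k = (\<integral>\<xi>. g (V \<xi>) \<partial>M)"
    unfolding cylinder_integral_def using k has_cylinder_integral_unique by blast
qed

lemma continuous_cylinder_measure_cyl:
  assumes q: "continuous_seminorm \<tau> q"
    and int: "\<And>t. t \<in> T \<Longrightarrow> integrable M (\<lambda>\<xi>. (V \<xi> t)\<^sup>2)"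
    and le: "\<And>t. t \<in> T \<Longrightarrow> (\<integral>\<xi>. (V \<xi> t)\<^sup>2 \<partial>M) \<le> (q t)\<^sup>2"
  shows "continuous_cylinder_measure \<tau> cyl"
  unfolding continuous_cylinder_measure_def
proof (intro conjI allI impI cylinder_measure_cyl)
  fix \<epsilon> a :: real assume \<epsilon>: "\<epsilon> > 0" and a: "a > 0"
  \<comment> \<open>The radius \<open>a * sqrt \<epsilon>\<close> is what Chebyshev's inequality
    asks for: it gives \<open>(q t) ^ 2 / a ^ 2 \<le> \<epsilon>\<close>.\<close>
  define U where "U = {t \<in> T. q t \<in> {..< a * sqrt \<epsilon>}}"
  have "openin \<tau> U"
    unfolding U_def using q by (intro openin_continuous_map_preimage[where Y = euclideanreal])
      (auto simp: continuous_seminorm_def)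
  moreover have "q 0 = 0"
  proof -
    have "q (0 *\<^sub>R 0) = \<bar>0\<bar> * q 0" using q T_0 unfolding continuous_seminorm_def by blast
    then show ?thesis by simp
  qed
  then have "0 \<in> U" using \<epsilon> a by (simp add: U_def)
  moreover have "cyl {\<phi> \<in> continuous_dual \<tau>. a \<le> \<bar>\<phi> t\<bar>} \<le> \<epsilon>" if "t \<in> U" for t
  proof -
    have t: "t \<in> T" "q t < a * sqrt \<epsilon>" using that by (auto simp: U_def)
    define F where "F = span {t}"
    have F: "F \<in> finite_dim_subspaces \<tau>" unfolding F_def using t by (intro finite_dim_span) auto
    have tF: "t \<in> F" by (simp add: F_def span_base)
    define A where "A = dual_coset \<tau> F ` {l \<in> continuous_dual \<tau>. l t \<in> {x. a \<le> \<bar>x\<bar>}}"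
    have "dual_coset \<tau> F l \<in> A \<longleftrightarrow> a \<le> \<bar>l t\<bar>" if l: "l \<in> continuous_dual \<tau>" for l
    proof
      assume "dual_coset \<tau> F l \<in> A"
      then obtain m where m: "m \<in> continuous_dual \<tau>" "a \<le> \<bar>m t\<bar>" "dual_coset \<tau> F l = dual_coset \<tau> F m"
        by (auto simp: A_def)
      then have "m \<in> fibre F l"
        using dual_coset_eq_fibre[OF finite_dim_subset[OF F]] l by (auto simp: fibre_def)
      then show "a \<le> \<bar>l t\<bar>" using m(2) tF by (simp add: fibre_def)
    qed (use l in \<open>auto simp: A_def\<close>)
    then have "{\<phi> \<in> continuous_dual \<tau>. a \<le> \<bar>\<phi> t\<bar>} = cylinder_set \<tau> F A"
      by (auto simp: cylinder_set_def)
    then have "cyl {\<phi> \<in> continuous_dual \<tau>. a \<le> \<bar>\<phi> t\<bar>} = measure M {\<xi> \<in> space M. fibre F (V \<xi>) \<in> A}"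
      by (simp add: cyl_cylinder_set[OF F])
    also have "{\<xi> \<in> space M. fibre F (V \<xi>) \<in> A} = {\<xi> \<in> space M. a\<^sup>2 \<le> (V \<xi> t)\<^sup>2}"
      unfolding A_def quotient_subbasis[OF F tF V_linear] using a
      by (simp add: abs_le_square_iff[symmetric])
    also have "measure M \<dots> \<le> (\<integral>\<xi>. (V \<xi> t)\<^sup>2 \<partial>M) / a\<^sup>2"
      using a by (intro integral_Markov_inequality_measure[OF int[OF t(1)]]) auto
    also have "\<dots> \<le> (q t)\<^sup>2 / a\<^sup>2" using le[OF t(1)] by (intro divide_right_mono) auto
    also have "\<dots> \<le> (a * sqrt \<epsilon>)\<^sup>2 / a\<^sup>2"
      using t q by (intro divide_right_mono power_mono) (auto simp: continuous_seminorm_def)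
    also have "\<dots> = \<epsilon>" using a \<epsilon> by (simp add: power_mult_distrib)
    finally show ?thesis .
  qed
  ultimately show "\<exists>U. openin \<tau> U \<and> 0 \<in> U \<and> (\<forall>t\<in>U. cyl {\<phi> \<in> continuous_dual \<tau>. a \<le> \<bar>\<phi> t\<bar>} \<le> \<epsilon>)"
    by blast
qed

end

section \<open>Characters as evaluations of polynomial functions\<close>

lemma polyrel_character:
  assumes "polyrel B f a" "\<phi> \<in> characters"
  shows "\<phi> a = f \<phi>"
  using assms
proof induction
  case (const c)
  then show ?case by (auto simp: characters_def linear_scale)
qed (auto simp: characters_def linear_add)

lemma polyrel_generates:
  assumes "is_subalgebra hull (B \<union> {1}) = (UNIV :: 'a::{real_algebra_1, comm_ring_1} set)"
  obtains f where "polyrel B f (a :: 'a)"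
proof -
  have "is_subalgebra {a. \<exists>f. polyrel B f a}"
    unfolding is_subalgebra_def subspace_def
  proof (intro conjI ballI allI)
    show "0 \<in> {a. \<exists>f. polyrel B f a}" using polyrel.const[of B 0] by auto
    show "1 \<in> {a. \<exists>f. polyrel B f a}" using polyrel.const[of B 1] by auto
  qed (use polyrel.add polyrel.mult polyrel_scale in blast)+
  moreover have "1 \<in> {a. \<exists>f. polyrel B f a}" using polyrel.const[of B 1] by auto
  then have "B \<union> {1} \<subseteq> {a. \<exists>f. polyrel B f a}" using polyrel.gen by blast
  ultimately have "is_subalgebra hull (B \<union> {1}) \<subseteq> {a. \<exists>f. polyrel B f a}" by (rule hull_minimal[rotated])
  then show ?thesis using assms that by auto
qed

text \<open>Polynomial expressions in the elements of the space reach the whole algebra, so a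
  restriction fixes its character and the definite description in \<open>character_of\<close> is
  unambiguous.\<close>

lemma character_of_polyrel:
  assumes gen: "is_subalgebra hull (topspace \<tau> \<union> {1}) = UNIV"
    and \<phi>: "\<phi> \<in> (\<lambda>\<psi>. restrict \<psi> (topspace \<tau>)) ` characters" and f: "polyrel (topspace \<tau>) f a"
  shows "character_of \<tau> \<phi> a = f \<phi>"
proof -
  obtain \<psi> where \<psi>: "\<psi> \<in> characters" "\<phi> = restrict \<psi> (topspace \<tau>)" using \<phi> by blast
  have "character_of \<tau> \<phi> = \<psi>"
    unfolding character_of_def
  proof (rule the_equality)
    show "\<psi> \<in> characters \<and> restrict \<psi> (topspace \<tau>) = \<phi>" using \<psi> by blast
    fix \<psi>' assume \<psi>': "\<psi>' \<in> characters \<and> restrict \<psi>' (topspace \<tau>) = \<phi>"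
    show "\<psi>' = \<psi>"
    proof
      fix b
      obtain g where g: "polyrel (topspace \<tau>) g b" using polyrel_generates[OF gen] .
      have "g \<psi>' = g \<psi>" using polyrel_cong[OF g] \<psi>' \<psi>(2) by (metis restrict_apply')
      then show "\<psi>' b = \<psi> b" using polyrel_character[OF g] \<psi>' \<psi>(1) by simp
    qed
  qed
  moreover have "f \<psi> = f \<phi>" by (rule polyrel_cong[OF f]) (simp add: \<psi>(2))
  ultimately show ?thesis using polyrel_character[OF f \<psi>(1)] by simp
qed

section \<open>Univariate polynomials and series\<close>

inductive sos :: "real poly \<Rightarrow> bool" where
  square: "sos (q * q)"
| add: "sos p \<Longrightarrow> sos q \<Longrightarrow> sos (p + q)"

lemma sos_mult_square: "sos p \<Longrightarrow> sos (r * r * p)"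
proof (induction rule: sos.induct)
  case (square q)
  have "r * r * (q * q) = (r * q) * (r * q)" by (simp add: ac_simps)
  then show ?case by (metis sos.square)
qed (simp add: distrib_left sos.add)

lemma poly_attains_min:
  fixes p :: "real poly"
  assumes nonneg: "\<And>x. 0 \<le> poly p x" and deg: "degree p > 0"
  obtains x0 where "\<And>x. poly p x0 \<le> poly p x"
proof -
  have "filterlim (poly p) at_infinity at_infinity" by (rule filterlim_poly_at_infinity[OF deg])
  then have "\<forall>\<^sub>F x in at_infinity. norm (poly p x) \<ge> poly p 0 + 1"
    by (simp add: filterlim_at_infinity_conv_norm_at_top filterlim_at_top)
  then obtain b where b: "\<And>x. b \<le> norm x \<Longrightarrow> norm (poly p x) \<ge> poly p 0 + 1"
    unfolding eventually_at_infinity by blast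
  define c where "c = max b 1"
  have "continuous_on {-c..c} (poly p)" by (intro continuous_intros)
  moreover have "{-c..c} \<noteq> {}" by (simp add: c_def)
  ultimately obtain x0 where x0: "x0 \<in> {-c..c}" "\<And>x. x \<in> {-c..c} \<Longrightarrow> poly p x0 \<le> poly p x"
    using continuous_attains_inf[OF compact_Icc] by blast
  have "poly p x0 \<le> poly p x" for x
  proof (cases "x \<in> {-c..c}")
    case False
    then have "b \<le> norm x" by (auto simp: c_def)
    from b[OF this] have "poly p 0 \<le> poly p x" using nonneg[of x] by simp
    moreover have "poly p x0 \<le> poly p 0" by (rule x0(2)) (simp add: c_def)
    ultimately show ?thesis by simp
  qed (rule x0(2))
  then show ?thesis by (rule that)
qed

lemma poly_tendsto_at: "(poly p \<longlongrightarrow> poly p x) (at x within S)" for p :: "real poly"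
  by (rule tendsto_within_subset[of _ _ _ UNIV]) (simp_all add: isCont_def[symmetric])

text \<open>
  Subtracting the minimum from a nonnegative polynomial creates a double root; dividing by its square
  lowers the degree.
\<close>

lemma nonneg_poly_sos:
  assumes "\<And>x. 0 \<le> poly p x"
  shows "sos p"
  using assms
proof (induction "degree p" arbitrary: p rule: less_induct)
  case less
  show ?case
  proof (cases "degree p = 0")
    case True
    then obtain c where c: "p = [:c:]" by (metis degree_eq_zeroE)
    then have "c \<ge> 0" using less.prems[of 0] by simp
    then have "p = [:sqrt c:] * [:sqrt c:]" by (simp add: c)
    then show ?thesis by (metis sos.square)
  next
    case False
    obtain x0 where x0: "\<And>x. poly p x0 \<le> poly p x"
      using poly_attains_min[OF less.prems] False by blast
    define m where "m = poly p x0"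
    have m: "m \<ge> 0" unfolding m_def by (rule less.prems)
    have "poly (p - [:m:]) x0 = 0" by (simp add: m_def)
    then obtain q where q: "p - [:m:] = [:-x0, 1:] * q" using poly_eq_0_iff_dvd dvdE by blast
    have pq: "poly p x - m = (x - x0) * poly q x" for x
      using arg_cong[OF q, of "\<lambda>p. poly p x"] by (simp add: algebra_simps)
    \<comment> \<open>The quotient \<open>q\<close> is at most 0 to the left of \<open>x0\<close>
      and at least 0 to the right, so by continuity \<open>x0\<close> is a root of it as
      well.\<close>
    have sgn: "0 \<le> (x - x0) * poly q x" for x using x0[of x] pq[of x] by (simp add: m_def)
    have sgn_r: "0 \<le> poly q x" if "x0 < x" for x
      using sgn[of x] that by (auto simp: zero_le_mult_iff)
    have sgn_l: "poly q x \<le> 0" if "x < x0" for x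
      using sgn[of x] that by (auto simp: zero_le_mult_iff)
    have "0 \<le> poly q x0"
    proof (rule tendsto_lowerbound[OF poly_tendsto_at[of q x0 "{x0<..}"]])
      show "\<forall>\<^sub>F x in at_right x0. 0 \<le> poly q x"
        unfolding eventually_at_filter using sgn_r by (intro always_eventually allI impI) auto
    qed simp
    moreover have "poly q x0 \<le> 0"
    proof (rule tendsto_upperbound[OF poly_tendsto_at[of q x0 "{..<x0}"]])
      show "\<forall>\<^sub>F x in at_left x0. poly q x \<le> 0"
        unfolding eventually_at_filter using sgn_l by (intro always_eventually allI impI) auto
    qed simp
    ultimately have "poly q x0 = 0" by simp
    then obtain r where r: "q = [:-x0, 1:] * r" using poly_eq_0_iff_dvd dvdE by blast
    have p: "p = [:m:] + [:-x0, 1:] * [:-x0, 1:] * r"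
    proof -
      have "p = [:m:] + [:-x0, 1:] * q" using q by (metis add.commute diff_add_cancel)
      then show ?thesis by (simp only: r mult.assoc)
    qed
    have rn: "0 \<le> poly r x" if "x \<noteq> x0" for x
    proof -
      have "0 \<le> (x - x0)\<^sup>2 * poly r x" proof -
        have "poly q x = (x - x0) * poly r x" by (simp add: r algebra_simps)
        then show ?thesis using sgn[of x] by (simp add: power2_eq_square mult.assoc)
      qed
      then show ?thesis using that by (simp add: zero_le_mult_iff)
    qed
    have "0 \<le> poly r x0"
    proof (rule tendsto_lowerbound[OF poly_tendsto_at[of r x0 UNIV]])
      show "\<forall>\<^sub>F x in at x0. 0 \<le> poly r x"
        unfolding eventually_at_filter using rn by (intro always_eventually allI impI) auto
    qed simp
    then have rn': "0 \<le> poly r x" for x using rn by (cases "x = x0") auto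
    have "r \<noteq> 0" using p False by auto
    then have "degree ([:-x0, 1:] * [:-x0, 1:] * r) = 2 + degree r"
      by (subst degree_mult_eq, simp, simp, subst degree_mult_eq) simp_all
    then have "degree p = 2 + degree r" unfolding p by (subst degree_add_eq_right) auto
    then have "sos r" using less.hyps[of r] rn' by simp
    then have "sos ([:-x0, 1:] * [:-x0, 1:] * r)" by (rule sos_mult_square)
    moreover have "[:m:] = [:sqrt m:] * [:sqrt m:]" using m by simp
    then have "sos [:m:]" by (metis sos.square)
    ultimately show ?thesis using p sos.add by metis
  qed
qed

text \<open>Polya's weighting: the inequality of arithmetic and geometric means is applied to
  \<open>c k * a k\<close>, with weights \<open>c\<close> tuned so that the geometric mean of the
  first \<open>n + 1\<close> of them is \<open>n + 2\<close> and the resulting double sum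
  telescopes.\<close>

lemma carleman_inequality_partial:
  fixes a :: "nat \<Rightarrow> real"
  assumes a: "\<And>k. 0 \<le> a k"
  shows "(\<Sum>n<N. (\<Prod>k\<le>n. a k) powr (1 / real (Suc n))) \<le> exp 1 * (\<Sum>k<N. a k)"
proof -
  define c where "c k = (real k + 2) ^ (Suc k) / (real k + 1) ^ k" for k :: nat
  have c0: "c k > 0" for k by (simp add: c_def)
  have prod_c: "(\<Prod>k\<le>n. c k) = (real n + 2) ^ Suc n" for n
  proof (induction n)
    case (Suc n)
    have "(\<Prod>k\<le>Suc n. c k) = (real n + 2) ^ Suc n * c (Suc n)" using Suc by simp
    also have "\<dots> = (real (Suc n) + 2) ^ Suc (Suc n)"
      by (simp add: c_def add.commute)
    finally show ?case .
  qed (simp add: c_def)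
  have c_le: "c k / (real k + 1) \<le> exp 1" for k
  proof -
    have "c k / (real k + 1) = (1 + 1 / (real k + 1)) ^ Suc k"
    proof -
      have "1 + 1 / (real k + 1) = (real k + 2) / (real k + 1)" by (simp add: field_simps)
      then show ?thesis by (simp add: c_def power_divide)
    qed
    also have "\<dots> \<le> exp (1 / (real k + 1)) ^ Suc k"
      by (intro power_mono exp_ge_add_one_self) auto
    also have "\<dots> = exp (real (Suc k) * (1 / (real k + 1)))" by (rule exp_of_nat_mult[symmetric])
    also have "\<dots> = exp 1" by (simp add: add.commute)
    finally show ?thesis .
  qed
  have gm: "(\<Prod>k\<le>n. a k) powr (1 / real (Suc n)) \<le> (\<Sum>k\<le>n. c k * a k) / ((real n + 1) * (real n + 2))" for n
  proof -
    have "(\<Prod>k\<le>n. c k * a k) powr (1 / card {..n}) \<le> (\<Sum>k\<le>n. c k * a k / card {..n})"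
      using a c0 by (intro arith_geom_mean) (auto simp: less_imp_le)
    moreover have "(\<Prod>k\<le>n. c k * a k) powr (1 / card {..n}) = (real n + 2) * (\<Prod>k\<le>n. a k) powr (1 / real (Suc n))"
    proof -
      have "((real n + 2) ^ Suc n) powr (1 / real (Suc n)) = real n + 2"
        by (subst powr_realpow[symmetric]) (simp_all add: powr_powr)
      then show ?thesis
        using a by (simp add: prod.distrib prod_c powr_mult prod_nonneg del: power_Suc)
    qed
    ultimately have "(real n + 2) * (\<Prod>k\<le>n. a k) powr (1 / real (Suc n)) \<le> (\<Sum>k\<le>n. c k * a k) / (real n + 1)"
      by (simp add: sum_divide_distrib add.commute)
    then have "(real n + 2) * (\<Prod>k\<le>n. a k) powr (1 / real (Suc n)) * (real n + 1) \<le> (\<Sum>k\<le>n. c k * a k)"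
      by (subst (asm) pos_le_divide_eq) auto
    then show ?thesis by (subst pos_le_divide_eq) (auto simp: ac_simps)
  qed
  \<comment> \<open>The extra term on the left is the part not yet used up; the induction closes by
    \<open>1 / ((N + 1) * (N + 2)) + 1 / (N + 2) = 1 / (N + 1)\<close>.\<close>
  have "(\<Sum>n<N. (\<Prod>k\<le>n. a k) powr (1 / real (Suc n))) + (\<Sum>k<N. c k * a k) / (real N + 1)
    \<le> (\<Sum>k<N. c k * a k / (real k + 1))"
  proof (induction N)
    case (Suc N)
    define s where "s = (\<Sum>k<N. c k * a k)"
    define u where "u = c N * a N"
    have g: "(\<Prod>k\<le>N. a k) powr (1 / real (Suc N)) \<le> (s + u) / ((real N + 1) * (real N + 2))"
      using gm[of N] by (simp add: s_def u_def flip: lessThan_Suc_atMost)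
    have "(s + u) / ((real N + 1) * (real N + 2)) + (s + u) / (real N + 2) = s / (real N + 1) + u / (real N + 1)"
      by (simp add: divide_simps) (simp add: algebra_simps)
    with g Suc show ?case by (simp add: s_def[symmetric] u_def[symmetric] add.commute)
  qed simp
  moreover have "0 \<le> (\<Sum>k<N. c k * a k) / (real N + 1)"
    using a c0 by (intro divide_nonneg_nonneg sum_nonneg mult_nonneg_nonneg) (auto simp: less_imp_le)
  moreover have "(\<Sum>k<N. c k * a k / (real k + 1)) \<le> exp 1 * (\<Sum>k<N. a k)"
    unfolding sum_distrib_left
  proof (rule sum_mono)
    fix k show "c k * a k / (real k + 1) \<le> exp 1 * a k"
      using mult_right_mono[OF c_le a, of k k] by simp
  qed
  ultimately show ?thesis by linarith
qed

lemma carleman_inequality: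
  fixes a :: "nat \<Rightarrow> real"
  assumes a: "\<And>k. 0 \<le> a k" and sum: "summable a"
  shows "summable (\<lambda>n. (\<Prod>k\<le>n. a k) powr (1 / real (Suc n)))"
proof (rule summableI_nonneg_bounded)
  fix N
  have "(\<Sum>n<N. (\<Prod>k\<le>n. a k) powr (1 / real (Suc n))) \<le> exp 1 * (\<Sum>k<N. a k)"
    by (rule carleman_inequality_partial[OF a])
  also have "\<dots> \<le> exp 1 * suminf a" by (intro mult_left_mono sum_le_suminf sum a) auto
  finally show "(\<Sum>n<N. (\<Prod>k\<le>n. a k) powr (1 / real (Suc n))) \<le> exp 1 * suminf a" .
qed simp

text \<open>By monotonicity each block of \<open>r\<close> consecutive terms is at most
  \<open>r\<close> times its first term, which apart from the initial block is a term of the given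
  series.\<close>

lemma summable_decreasing_subsequence:
  fixes a :: "nat \<Rightarrow> real"
  assumes a: "\<And>k. 0 \<le> a k" "decseq a" and r: "r \<ge> 1" and sum: "summable (\<lambda>n. a (r * Suc n))"
  shows "summable a"
proof (rule summableI_nonneg_bounded)
  have split: "(\<Sum>k<m + n. a k) = (\<Sum>k<m. a k) + (\<Sum>k<n. a (k + m))" for m n
    by (induction n) (simp_all add: add.commute)
  have block: "(\<Sum>k<r * Suc N. a k) \<le> r * a 0 + r * (\<Sum>n<N. a (r * Suc n))" for N
  proof (induction N)
    case 0
    have "(\<Sum>k<r. a k) \<le> (\<Sum>k<r. a 0)" using a(2) by (intro sum_mono) (simp add: decseq_def)
    then show ?case by simp
  next
    case (Suc N)
    have "(\<Sum>k<r * Suc (Suc N). a k) = (\<Sum>k<r * Suc N + r. a k)" by (simp add: algebra_simps)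
    also have "\<dots> = (\<Sum>k<r * Suc N. a k) + (\<Sum>k<r. a (k + r * Suc N))"
      by (rule split)
    also have "(\<Sum>k<r. a (k + r * Suc N)) \<le> (\<Sum>k<r. a (r * Suc N))"
      using a(2) by (intro sum_mono) (simp add: decseq_def)
    finally show ?case using Suc by (simp add: algebra_simps)
  qed
  fix N
  have "(\<Sum>k<N. a k) \<le> (\<Sum>k<r * Suc N. a k)"
  proof (intro sum_mono2)
    have "1 * N \<le> r * Suc N" using r by (intro mult_le_mono) auto
    then show "{..<N} \<subseteq> {..<r * Suc N}" by auto
  qed (auto intro: a(1))
  also have "\<dots> \<le> r * a 0 + r * (\<Sum>n<N. a (r * Suc n))" by (rule block)
  also have "\<dots> \<le> r * a 0 + r * suminf (\<lambda>n. a (r * Suc n))"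
    by (intro add_left_mono mult_left_mono sum_le_suminf sum a) auto
  finally show "(\<Sum>k<N. a k) \<le> r * a 0 + r * suminf (\<lambda>n. a (r * Suc n))" .
qed (rule a)

text \<open>Each derivative of the cosine is a phase shift by \<open>pi / 2\<close>, so the
  expansion stays within shifted cosines and the derivative in the Lagrange remainder is bounded by
  1.\<close>

lemma cos_taylor:
  fixes y u :: real
  shows "\<bar>cos (y + u) - (\<Sum>i<k. u ^ i / fact i * cos (y + real i * pi / 2))\<bar> \<le> \<bar>u\<bar> ^ k / fact k"
proof -
  define d where "d = (\<lambda>i x. cos (y + x + real i * pi / 2))"
  have "\<exists>t. \<bar>t\<bar> \<le> \<bar>u\<bar> \<and> cos (y + u) = (\<Sum>m<k. (d m 0 / fact m) * u ^ m) + (d k t / fact k) * u ^ k"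
  proof (rule Maclaurin_all_le)
    show "d 0 = (\<lambda>u. cos (y + u))" by (simp add: d_def)
    have "(d m has_real_derivative d (Suc m) x) (at x)" for m x
    proof -
      have "(d m has_real_derivative - sin (y + x + real m * pi / 2)) (at x)"
        unfolding d_def by (auto intro!: derivative_eq_intros)
      moreover have "d (Suc m) x = - sin (y + x + real m * pi / 2)"
        unfolding d_def minus_sin_cos_eq by (simp add: algebra_simps add_divide_distrib)
      ultimately show ?thesis by simp
    qed
    then show "\<forall>m x. (d m has_real_derivative d (Suc m) x) (at x)" by blast
  qed
  then obtain t where t: "cos (y + u) = (\<Sum>m<k. (d m 0 / fact m) * u ^ m) + (d k t / fact k) * u ^ k" by blast
  have "(\<Sum>m<k. (d m 0 / fact m) * u ^ m) = (\<Sum>i<k. u ^ i / fact i * cos (y + real i * pi / 2))"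
    by (simp add: d_def mult.commute)
  then have "cos (y + u) - (\<Sum>i<k. u ^ i / fact i * cos (y + real i * pi / 2)) = (d k t / fact k) * u ^ k"
    using t by simp
  also have "\<bar>\<dots>\<bar> = \<bar>d k t\<bar> * (\<bar>u\<bar> ^ k / fact k)" by (simp add: abs_mult power_abs)
  also have "\<dots> \<le> 1 * (\<bar>u\<bar> ^ k / fact k)" unfolding d_def by (intro mult_right_mono) auto
  finally show ?thesis by simp
qed

section \<open>Quasianalyticity and density of polynomials\<close>

locale moment_line = dominated_functional UNIV W \<Lambda>
  for W :: "(real \<Rightarrow> real) set" and \<Lambda> +
  assumes poly_W: "poly p \<in> W"
begin

lemma power_W: "(\<lambda>x. x ^ n) \<in> W"
proof -
  have "poly (monom 1 n) = (\<lambda>x::real. x ^ n)" by (simp add: fun_eq_iff poly_monom)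
  then show ?thesis using poly_W by metis
qed

definition moment :: "nat \<Rightarrow> real" where
  "moment n = \<Lambda> (\<lambda>x. x ^ n)"

lemma moment_0: "moment 0 = 1"
  by (simp add: moment_def L_const)

lemma moment_even_nonneg: "0 \<le> moment (2 * n)"
  unfolding moment_def by (intro nonneg power_W) auto

lemma moment_cauchy_schwarz: "(moment (i + j))\<^sup>2 \<le> moment (2 * i) * moment (2 * j)"
proof -
  have *: "(\<lambda>x::real. x ^ i) * (\<lambda>x. x ^ j) = (\<lambda>x. x ^ (i + j))" for i j
    by (simp add: fun_eq_iff power_add)
  show ?thesis
    using cauchy_schwarz[OF power_W[of i] power_W[of j]] by (simp add: moment_def * mult_2)
qed

text \<open>An upper bound for the seminorm of exponent \<open>2 * r\<close>, stated without roots.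
  Keeping \<open>a\<close> positive allows division by it even where the seminorm vanishes.\<close>

definition Lp_le :: "nat \<Rightarrow> (real \<Rightarrow> real) \<Rightarrow> real \<Rightarrow> bool" where
  "Lp_le r f a \<longleftrightarrow> f \<in> W \<and> 0 < a \<and> \<Lambda> (\<lambda>x. f x ^ (2 * r)) \<le> a ^ (2 * r)"

lemma Lp_leD: "Lp_le r f a \<Longrightarrow> f \<in> W" "Lp_le r f a \<Longrightarrow> 0 < a"
  "Lp_le r f a \<Longrightarrow> \<Lambda> (\<lambda>x. f x ^ (2 * r)) \<le> a ^ (2 * r)"
  by (auto simp: Lp_le_def)

text \<open>Minkowski's inequality from the convexity of the even power, applied at
  \<open>x / a\<close> and \<open>y / b\<close> with weights \<open>a / (a + b)\<close> and
  \<open>b / (a + b)\<close>.\<close>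

lemma Lp_le_add:
  assumes f: "Lp_le r f a" and g: "Lp_le r g b" and r: "r \<ge> 1"
  shows "Lp_le r (\<lambda>x. f x + g x) (a + b)"
proof -
  have ab: "a > 0" "b > 0" using f g by (auto simp: Lp_le_def)
  define t where "t = b / (a + b)"
  have t: "0 \<le> t" "t \<le> 1" "1 - t = a / (a + b)" using ab by (auto simp: t_def field_simps)
  define A where "A = (a + b) ^ (2 * r) * (a / (a + b)) / a ^ (2 * r)"
  define C where "C = (a + b) ^ (2 * r) * (b / (a + b)) / b ^ (2 * r)"
  have AC: "A \<ge> 0" "C \<ge> 0" using ab by (simp_all add: A_def C_def)
  have pw: "(x + y) ^ (2 * r) \<le> A * x ^ (2 * r) + C * y ^ (2 * r)" for x y
  proof -
    have "((1 - t) *\<^sub>R (x / a) + t *\<^sub>R (y / b)) ^ (2 * r) \<le> (1 - t) * (x / a) ^ (2 * r) + t * (y / b) ^ (2 * r)"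
      by (rule convex_onD[OF convex_power_even]) (use t in auto)
    moreover have "(1 - t) *\<^sub>R (x / a) + t *\<^sub>R (y / b) = (x + y) / (a + b)"
      unfolding t(3) using ab by (simp add: t_def add_divide_distrib)
    ultimately have "(x + y) ^ (2 * r) / (a + b) ^ (2 * r)
        \<le> (a / (a + b)) * (x ^ (2 * r) / a ^ (2 * r)) + (b / (a + b)) * (y ^ (2 * r) / b ^ (2 * r))"
      unfolding t(3) by (simp add: t_def power_divide)
    then have "(x + y) ^ (2 * r)
        \<le> ((a / (a + b)) * (x ^ (2 * r) / a ^ (2 * r)) + (b / (a + b)) * (y ^ (2 * r) / b ^ (2 * r))) * (a + b) ^ (2 * r)"
      using ab by (subst (asm) pos_divide_le_eq) auto
    then show ?thesis by (simp add: A_def C_def algebra_simps)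
  qed
  have fW: "f \<in> W" "g \<in> W" using f g by (auto simp: Lp_le_def)
  have "\<Lambda> (\<lambda>x. (f x + g x) ^ (2 * r)) \<le> \<Lambda> (\<lambda>x. A * f x ^ (2 * r) + C * g x ^ (2 * r))"
    by (intro mono W_power W_plus W_cmult fW pw)
  also have "\<dots> = A * \<Lambda> (\<lambda>x. f x ^ (2 * r)) + C * \<Lambda> (\<lambda>x. g x ^ (2 * r))"
    by (simp add: L_plus L_cmult W_cmult W_power fW)
  also have "\<dots> \<le> A * a ^ (2 * r) + C * b ^ (2 * r)"
    using f g AC by (intro add_mono mult_left_mono) (auto simp: Lp_le_def)
  also have "\<dots> = (a + b) ^ (2 * r) * (a / (a + b) + b / (a + b))"
  proof -
    have "A * a ^ (2 * r) = (a + b) ^ (2 * r) * (a / (a + b))" "C * b ^ (2 * r) = (a + b) ^ (2 * r) * (b / (a + b))"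
      using ab by (simp_all add: A_def C_def)
    then show ?thesis by (simp only: distrib_left)
  qed
  also have "\<dots> = (a + b) ^ (2 * r)" using ab by (simp add: add_divide_distrib[symmetric])
  finally show ?thesis using ab fW by (simp add: Lp_le_def W_plus)
qed

lemma Lp_le_mono: "Lp_le r f a \<Longrightarrow> a \<le> b \<Longrightarrow> Lp_le r f b"
  unfolding Lp_le_def using power_mono[of a b "2 * r"] by auto

lemma Lp_le_cmult:
  assumes "Lp_le r f a" "c \<noteq> 0"
  shows "Lp_le r (\<lambda>x. c * f x) (\<bar>c\<bar> * a)"
proof -
  have "\<bar>c\<bar> ^ (2 * r) = c ^ (2 * r)" by (simp add: power_even_abs)
  then show ?thesis
    using assms by (auto simp: Lp_le_def W_cmult power_mult_distrib L_cmult W_power intro: mult_left_mono)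
qed

lemma Lp_le_bound:
  assumes f: "f \<in> W" and g: "g \<in> W" and le: "\<And>x. \<bar>f x\<bar> \<le> \<bar>g x\<bar>"
    and "\<Lambda> (\<lambda>x. g x ^ (2 * r)) \<le> a ^ (2 * r)" "0 < a"
  shows "Lp_le r f a"
proof -
  have "f x ^ (2 * r) \<le> g x ^ (2 * r)" for x
    using power_mono[OF le[of x], of "2 * r"] by (simp add: power_even_abs)
  then have "\<Lambda> (\<lambda>x. f x ^ (2 * r)) \<le> \<Lambda> (\<lambda>x. g x ^ (2 * r))"
    by (intro mono W_power f g)
  then show ?thesis using assms by (simp add: Lp_le_def)
qed

lemma Lp_le_uniform:
  assumes "\<And>x. \<bar>f x\<bar> \<le> a" "0 < a"
  shows "Lp_le r f a"
  using assms by (intro Lp_le_bound[where g = "\<lambda>_. a"] W_bounded[of _ a] W_const) (auto simp: L_const)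

text \<open>A diagonal choice suffices: the exponent grows along the sequence, and once
  \<open>i \<le> n\<close> the power \<open>2 * i\<close> is dominated, after rescaling by the
  bound, by 1 plus the power \<open>2 * Suc n\<close>.\<close>

lemma null_seqI:
  assumes "\<And>n. Lp_le (Suc n) (u n) (1 / real (Suc n))"
  shows "null_seq u"
  unfolding null_seq_def
proof (intro conjI allI impI)
  have uW: "u n \<in> W" for n using assms[of n] by (simp add: Lp_le_def)
  then show "range u \<subseteq> W" by auto
  fix i :: nat assume i: "i \<ge> 1"
  have fun_power: "u n ^ (2 * i) = (\<lambda>x. u n x ^ (2 * i))" for n by (simp add: fun_eq_iff)
  have "\<forall>\<^sub>F n in sequentially. norm (\<Lambda> (u n ^ (2 * i))) \<le> 2 * (1 / real (Suc n))"
    using eventually_ge_at_top[of i]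
  proof eventually_elim
    case (elim n)
    define e where "e = 1 / real (Suc n)"
    have e: "0 < e" "e \<le> 1" by (simp_all add: e_def)
    have pw: "x ^ (2 * i) \<le> e ^ (2 * i) * (1 + (1 / e ^ (2 * Suc n)) * x ^ (2 * Suc n))" for x
    proof -
      have "(x / e) ^ (2 * i) \<le> 1 + (x / e) ^ (2 * Suc n)"
      proof (cases "\<bar>x / e\<bar> \<le> 1")
        case True
        then have "\<bar>x / e\<bar> ^ (2 * i) \<le> 1" by (intro power_le_one) auto
        then have "(x / e) ^ (2 * i) \<le> 1" by (simp only: power_even_abs dvd_triv_left)
        moreover have "0 \<le> (x / e) ^ (2 * Suc n)" by (intro zero_le_even_power) simp
        ultimately show ?thesis by linarith
      next
        case False
        then have "\<bar>x / e\<bar> ^ (2 * i) \<le> \<bar>x / e\<bar> ^ (2 * Suc n)"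
          using elim by (intro power_increasing) auto
        then have "(x / e) ^ (2 * i) \<le> (x / e) ^ (2 * Suc n)" by (simp only: power_even_abs dvd_triv_left)
        then show ?thesis by linarith
      qed
      then have "e ^ (2 * i) * (x / e) ^ (2 * i) \<le> e ^ (2 * i) * (1 + (x / e) ^ (2 * Suc n))"
        using e by (intro mult_left_mono) auto
      moreover have "e ^ (2 * i) * (x / e) ^ (2 * i) = x ^ (2 * i)"
        using e by (simp flip: power_mult_distrib)
      ultimately show ?thesis by (simp add: power_divide)
    qed
    have "\<Lambda> (\<lambda>x. u n x ^ (2 * i)) \<le> \<Lambda> (\<lambda>x. e ^ (2 * i) * (1 + (1 / e ^ (2 * Suc n)) * u n x ^ (2 * Suc n)))"
      by (intro mono W_power W_plus W_cmult W_const uW pw)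
    also have "\<dots> = e ^ (2 * i) * (1 + (1 / e ^ (2 * Suc n)) * \<Lambda> (\<lambda>x. u n x ^ (2 * Suc n)))"
      by (simp only: L_cmult L_plus L_const W_plus W_cmult W_const W_power uW)
    also have "\<dots> \<le> e ^ (2 * i) * (1 + (1 / e ^ (2 * Suc n)) * e ^ (2 * Suc n))"
      using Lp_leD(3)[OF assms[of n]] e
      by (intro mult_left_mono add_left_mono) (auto simp: e_def)
    also have "\<dots> = 2 * e ^ (2 * i)" using e by simp
    also have "\<dots> \<le> 2 * e ^ 1" using e i by (intro mult_left_mono power_decreasing) auto
    finally show ?case
      using L_even_power[OF uW, of n i] by (simp add: fun_power e_def)
  qed
  moreover have "(\<lambda>n. 2 * (1 / real (Suc n))) \<longlonglongrightarrow> 0"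
    using tendsto_mult_right_zero[OF LIMSEQ_inverse_real_of_nat, of 2] by (simp add: inverse_eq_divide)
  ultimately show "(\<lambda>n. \<Lambda> (u n ^ (2 * i))) \<longlonglongrightarrow> 0" by (rule Lim_null_comparison)
qed

lemma null_seqD:
  assumes "null_seq u" "r \<ge> 1" "0 < a"
  shows "\<forall>\<^sub>F n in sequentially. Lp_le r (u n) a"
proof -
  have *: "u n ^ (2 * r) = (\<lambda>x. u n x ^ (2 * r))" for n by (simp add: fun_eq_iff)
  have "(\<lambda>n. \<Lambda> (\<lambda>x. u n x ^ (2 * r))) \<longlonglongrightarrow> 0"
  proof -
    have "(\<lambda>n. \<Lambda> (u n ^ (2 * r))) \<longlonglongrightarrow> 0" using assms by (simp add: null_seq_def)
    then show ?thesis by (simp only: *)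
  qed
  then have "\<forall>\<^sub>F n in sequentially. \<Lambda> (\<lambda>x. u n x ^ (2 * r)) < a ^ (2 * r)"
    by (rule order_tendstoD) (use assms in simp)
  then show ?thesis
    by eventually_elim (use assms null_seq_in in \<open>auto simp: Lp_le_def\<close>)
qed

text \<open>The distance is an infimum that need not be attained; the slack \<open>e\<close>
  accounts for this and lets \<open>a = 0\<close> express membership in the closure of the
  polynomials.\<close>

definition poly_dist_le :: "nat \<Rightarrow> (real \<Rightarrow> real) \<Rightarrow> real \<Rightarrow> bool" where
  "poly_dist_le r f a \<longleftrightarrow> 0 \<le> a \<and> (\<forall>e>0. \<exists>q. Lp_le r (\<lambda>x. f x - poly q x) (a + e))"

lemma poly_dist_poly: "poly_dist_le r (poly p) 0"
  unfolding poly_dist_le_def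
  by (intro conjI allI impI exI[of _ p]) (auto intro: Lp_le_uniform)

lemma poly_dist_zero: "poly_dist_le r (\<lambda>x. 0) 0"
proof -
  have "poly 0 = (\<lambda>x::real. 0)" by (simp add: fun_eq_iff)
  then show ?thesis using poly_dist_poly by metis
qed

lemma poly_dist_mono: "poly_dist_le r f a \<Longrightarrow> a \<le> b \<Longrightarrow> poly_dist_le r f b"
  unfolding poly_dist_le_def by (meson Lp_le_mono add_right_mono order_trans)

lemma poly_dist_Lp: "0 \<le> a \<Longrightarrow> (\<And>e. e > 0 \<Longrightarrow> Lp_le r f (a + e)) \<Longrightarrow> poly_dist_le r f a"
  unfolding poly_dist_le_def by (auto intro!: exI[of _ 0])

lemma poly_dist_add:
  assumes r: "r \<ge> 1" and f: "poly_dist_le r f a" and g: "poly_dist_le r g b"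
  shows "poly_dist_le r (\<lambda>x. f x + g x) (a + b)"
  unfolding poly_dist_le_def
proof (intro conjI allI impI)
  show "0 \<le> a + b" using f g by (simp add: poly_dist_le_def)
  fix e :: real assume "e > 0"
  then have "e / 2 > 0" by simp
  then obtain p q where "Lp_le r (\<lambda>x. f x - poly p x) (a + e / 2)" "Lp_le r (\<lambda>x. g x - poly q x) (b + e / 2)"
    using f g unfolding poly_dist_le_def by metis
  from Lp_le_add[OF this r] show "\<exists>q. Lp_le r (\<lambda>x. f x + g x - poly q x) (a + b + e)"
    by (intro exI[of _ "p + q"]) (simp add: algebra_simps)
qed

lemma poly_dist_cmult:
  assumes f: "poly_dist_le r f a"
  shows "poly_dist_le r (\<lambda>x. c * f x) (\<bar>c\<bar> * a)"
proof (cases "c = 0")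
  case True
  then show ?thesis using poly_dist_zero by simp
next
  case False
  show ?thesis
    unfolding poly_dist_le_def
  proof (intro conjI allI impI)
    show "0 \<le> \<bar>c\<bar> * a" using f by (simp add: poly_dist_le_def)
    fix e :: real assume "e > 0"
    then have "e / \<bar>c\<bar> > 0" using False by simp
    then obtain p where "Lp_le r (\<lambda>x. f x - poly p x) (a + e / \<bar>c\<bar>)"
      using f unfolding poly_dist_le_def by metis
    from Lp_le_cmult[OF this False] show "\<exists>q. Lp_le r (\<lambda>x. c * f x - poly q x) (\<bar>c\<bar> * a + e)"
      using False by (intro exI[of _ "smult c p"]) (simp add: algebra_simps)
  qed
qed

lemma poly_dist_sum:
  assumes r: "r \<ge> 1" and f: "\<And>i. i \<in> I \<Longrightarrow> poly_dist_le r (f i) (a i)"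
  shows "poly_dist_le r (\<lambda>x. \<Sum>i\<in>I. f i x) (\<Sum>i\<in>I. a i)"
  using f
proof (induction I rule: infinite_finite_induct)
  case (insert i I)
  then show ?case using poly_dist_add[OF r] by simp
qed (use poly_dist_zero in simp_all)

text \<open>The seminorm of exponent \<open>2 * r\<close> of \<open>x ^ n\<close>. These numbers
  play the role of the derivative bounds in the Denjoy--Carleman theorem, since differentiating
  \<open>cos (t * x)\<close> in \<open>t\<close> produces powers of \<open>x\<close>.\<close>

definition moment_norm :: "nat \<Rightarrow> nat \<Rightarrow> real" where
  "moment_norm r n = root (2 * r) (moment (2 * r * n))"

lemma moment_norm_power: "r \<ge> 1 \<Longrightarrow> moment_norm r n ^ (2 * r) = moment (2 * r * n)"
  unfolding moment_norm_def using moment_even_nonneg[of "r * n"]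
  by (intro real_root_pow_pos2) (auto simp: mult.assoc)

lemma moment_norm_nonneg: "r \<ge> 1 \<Longrightarrow> 0 \<le> moment_norm r n"
  unfolding moment_norm_def using moment_even_nonneg[of "r * n"] by (simp add: mult.assoc)

lemma moment_norm_0: "r \<ge> 1 \<Longrightarrow> moment_norm r 0 = 1"
  by (simp add: moment_norm_def moment_0)

lemma Lp_le_power_bound:
  assumes r: "r \<ge> 1" and f: "f \<in> W" and le: "\<And>x. \<bar>f x\<bar> \<le> c * \<bar>x\<bar> ^ n" and c: "c \<ge> 0" and e: "e > 0"
  shows "Lp_le r f (c * moment_norm r n + e)"
proof (rule Lp_le_bound[where g = "\<lambda>x. c * x ^ n"])
  have M: "0 \<le> c * moment_norm r n" using moment_norm_nonneg[OF r] c by simp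
  then show "0 < c * moment_norm r n + e" using e by simp
  show "(\<lambda>x. c * x ^ n) \<in> W" by (intro W_cmult power_W)
  show "\<bar>f x\<bar> \<le> \<bar>c * x ^ n\<bar>" for x using le[of x] c by (simp add: abs_mult power_abs)
  have "(\<lambda>x::real. (c * x ^ n) ^ (2 * r)) = (\<lambda>x. c ^ (2 * r) * x ^ (2 * r * n))"
    by (simp add: fun_eq_iff power_mult_distrib mult.commute flip: power_mult)
  then have "\<Lambda> (\<lambda>x. (c * x ^ n) ^ (2 * r)) = c ^ (2 * r) * moment (2 * r * n)"
    by (simp only: L_cmult power_W moment_def)
  also have "\<dots> = (c * moment_norm r n) ^ (2 * r)" by (simp only: power_mult_distrib moment_norm_power[OF r])
  also have "\<dots> \<le> (c * moment_norm r n + e) ^ (2 * r)" using M e by (intro power_mono) auto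
  finally show "\<Lambda> (\<lambda>x. (c * x ^ n) ^ (2 * r)) \<le> (c * moment_norm r n + e) ^ (2 * r)" .
qed (rule f)

lemma poly_dist_power_bound:
  assumes "r \<ge> 1" "f \<in> W" "\<And>x. \<bar>f x\<bar> \<le> c * \<bar>x\<bar> ^ n" "c \<ge> 0"
  shows "poly_dist_le r f (c * moment_norm r n)"
  using assms by (intro poly_dist_Lp Lp_le_power_bound mult_nonneg_nonneg moment_norm_nonneg)

end

text \<open>Positive even moments make the quotients of consecutive \<open>moment_norm\<close>
  values meaningful; the degenerate case is settled separately in \<open>quadrature\<close>.\<close>

locale positive_moments = moment_line +
  assumes moment_pos: "0 < moment (2 * n)"
begin

lemma moment_norm_pos: "r \<ge> 1 \<Longrightarrow> 0 < moment_norm r n"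
  unfolding moment_norm_def using moment_pos[of "r * n"] by (simp add: mult.assoc)

lemma moment_norm_log_convex:
  assumes r: "r \<ge> 1"
  shows "(moment_norm r (Suc n))\<^sup>2 \<le> moment_norm r n * moment_norm r (Suc (Suc n))"
proof -
  have "((moment_norm r (Suc n))\<^sup>2) ^ (2 * r) = (moment (2 * r * Suc n))\<^sup>2"
  proof -
    have "((moment_norm r (Suc n))\<^sup>2) ^ (2 * r) = (moment_norm r (Suc n) ^ (2 * r))\<^sup>2"
      unfolding power_mult[symmetric] by (simp only: mult.commute)
    then show ?thesis by (simp only: moment_norm_power[OF r])
  qed
  also have "2 * r * Suc n = r * n + r * Suc (Suc n)" by simp
  also have "(moment (r * n + r * Suc (Suc n)))\<^sup>2 \<le> moment (2 * (r * n)) * moment (2 * (r * Suc (Suc n)))" by (rule moment_cauchy_schwarz)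
  also have "\<dots> = (moment_norm r n * moment_norm r (Suc (Suc n))) ^ (2 * r)"
    by (simp only: power_mult_distrib moment_norm_power[OF r] mult.assoc)
  finally show ?thesis
    using moment_norm_nonneg[OF r] r by (subst (asm) power_mono_iff) auto
qed

lemma moment_norm_ratio_mono:
  assumes r: "r \<ge> 1" and "i \<le> n"
  shows "moment_norm r (Suc i) / moment_norm r i \<le> moment_norm r (Suc n) / moment_norm r n"
  using \<open>i \<le> n\<close>
proof (induction n rule: dec_induct)
  case (step n)
  have "moment_norm r (Suc n) / moment_norm r n \<le> moment_norm r (Suc (Suc n)) / moment_norm r (Suc n)"
    using moment_norm_log_convex[OF r, of n] moment_norm_pos[OF r, of n] moment_norm_pos[OF r, of "Suc n"]
    by (simp add: field_simps power2_eq_square)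
  with step show ?case by simp
qed simp

text \<open>The quotient is a product of \<open>i\<close> consecutive ratios, each of which is at
  most the ratio at \<open>n\<close> by log-convexity.\<close>

lemma moment_norm_growth:
  assumes r: "r \<ge> 1" and "j + i \<le> Suc n"
  shows "moment_norm r (j + i) \<le> moment_norm r j * (moment_norm r (Suc n) / moment_norm r n) ^ i"
  using \<open>j + i \<le> Suc n\<close>
proof (induction i)
  case (Suc i)
  let ?\<rho> = "moment_norm r (Suc n) / moment_norm r n"
  note pos = moment_norm_pos[OF r]
  have "moment_norm r (j + Suc i) = moment_norm r (j + i) * (moment_norm r (Suc (j + i)) / moment_norm r (j + i))"
    using pos[of "j + i"] by simp
  also have "\<dots> \<le> (moment_norm r j * ?\<rho> ^ i) * ?\<rho>"
    using Suc pos by (intro mult_mono moment_norm_ratio_mono[OF r]) (auto intro!: divide_nonneg_nonneg simp: less_imp_le)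
  finally show ?case by (simp add: ac_simps)
qed simp

text \<open>Up to a phase, \<open>x ^ j * cos (t * x + \<theta>)\<close> is the \<open>j\<close>-th
  derivative in \<open>t\<close> of the cosine. The condition bounds Bang's weighted norm by
  \<open>exp (- n)\<close>: the supremum over \<open>j\<close> of
  \<open>exp (- j) / moment_norm r j\<close> times the distance of the \<open>j\<close>-th
  derivative from the polynomials. It is automatic for \<open>j \<ge> n\<close>, and quantifying
  over \<open>\<theta>\<close> absorbs the phase shifts.\<close>

definition bang :: "nat \<Rightarrow> real \<Rightarrow> nat \<Rightarrow> bool" where
  "bang r t n \<longleftrightarrow> (\<forall>j \<theta>. poly_dist_le r (\<lambda>x. x ^ j * cos (t * x + \<theta>)) (exp (real j - real n) * moment_norm r j))"

lemma trig_W: "(\<lambda>x. x ^ j * cos (t * x + \<theta>)) \<in> W"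
  by (intro W_times power_W W_bounded[of _ 1]) simp

lemma bang_0: 
  assumes r: "r \<ge> 1" shows "bang r 0 n"
  unfolding bang_def
proof (intro allI)
  fix j :: nat and \<theta> :: real
  have "(\<lambda>x. x ^ j * cos (0 * x + \<theta>)) = poly (monom (cos \<theta>) j)"
    by (simp add: fun_eq_iff poly_monom mult.commute)
  then have "poly_dist_le r (\<lambda>x. x ^ j * cos (0 * x + \<theta>)) 0" using poly_dist_poly by metis
  then show "poly_dist_le r (\<lambda>x. x ^ j * cos (0 * x + \<theta>)) (exp (real j - real n) * moment_norm r j)"
    by (rule poly_dist_mono) (simp add: moment_norm_nonneg[OF r])
qed

text \<open>
  Bang's step in the proof of the Denjoy--Carleman theorem: the weighted seminorm grows at most by the
  factor \<open>e\<close> over a distance of \<open>M n / (e * M (Suc n))\<close>.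
\<close>

lemma bang_step:
  assumes r: "r \<ge> 1" and P: "bang r t (Suc n)"
    and h: "\<bar>h\<bar> * exp 1 * moment_norm r (Suc n) \<le> moment_norm r n"
  shows "bang r (t + h) n"
  unfolding bang_def
proof (intro allI)
  fix j :: nat and \<theta> :: real
  let ?M = "moment_norm r"
  let ?f = "\<lambda>x. x ^ j * cos ((t + h) * x + \<theta>)"
  note Mpos = moment_norm_pos[OF r]
  show "poly_dist_le r ?f (exp (real j - real n) * ?M j)"
  proof (cases "j \<le> n")
    case False
    have "poly_dist_le r ?f (1 * ?M j)"
      by (intro poly_dist_power_bound r trig_W) (auto simp: abs_mult power_abs mult_left_le)
    then show ?thesis
      by (rule poly_dist_mono) (use False Mpos[of j] in \<open>auto intro!: mult_right_mono simp: less_imp_le\<close>)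
  next
    case True
    \<comment> \<open>Expanding to order \<open>k\<close> leaves a remainder with the power
      \<open>x ^ Suc n\<close>, the last index that \<open>moment_norm_growth\<close>
      reaches.\<close>
    define k where "k = Suc n - j"
    have jk: "j + k = Suc n" using True by (simp add: k_def)
    define \<rho> where "\<rho> = ?M (Suc n) / ?M n"
    have \<rho>: "\<rho> > 0" using Mpos by (simp add: \<rho>_def)
    have eh: "exp 1 * \<bar>h\<bar> * \<rho> \<le> 1" using h Mpos[of n] by (simp add: \<rho>_def field_simps)
    define g where "g i x = h ^ i / fact i * (x ^ (j + i) * cos (t * x + (\<theta> + real i * pi / 2)))" for i and x :: real
    define E where "E x = ?f x - (\<Sum>i<k. g i x)" for x
    have gW: "(\<lambda>x. g i x) \<in> W" for i unfolding g_def by (intro W_cmult trig_W)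
    have sumW: "(\<lambda>x. \<Sum>i<k. g i x) \<in> W"
    proof -
      have "(\<Sum>i<k. g i) \<in> W" using gW by (intro B_sum) simp
      moreover have "(\<Sum>i<k. g i) = (\<lambda>x. \<Sum>i<k. g i x)" by (simp add: fun_eq_iff sum_fun_apply)
      ultimately show ?thesis by simp
    qed
    have EW: "E \<in> W"
    proof -
      have "E = ?f - (\<lambda>x. \<Sum>i<k. g i x)" by (simp add: E_def fun_eq_iff)
      then show ?thesis using B_diff[OF trig_W sumW] by simp
    qed
    have E_le: "\<bar>E x\<bar> \<le> \<bar>h\<bar> ^ k / fact k * \<bar>x\<bar> ^ Suc n" for x
    proof -
      have E: "E x = x ^ j * (cos ((t * x + \<theta>) + h * x) - (\<Sum>i<k. (h * x) ^ i / fact i * cos ((t * x + \<theta>) + real i * pi / 2)))"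
        unfolding E_def g_def right_diff_distrib sum_distrib_left
        by (intro arg_cong2[of _ _ _ _ "(-)"] sum.cong) (auto simp: algebra_simps power_add power_mult_distrib)
      have "\<bar>E x\<bar> \<le> \<bar>x\<bar> ^ j * (\<bar>h * x\<bar> ^ k / fact k)"
        unfolding E abs_mult[of "x ^ j"] power_abs by (intro mult_left_mono cos_taylor) auto
      also have "\<dots> = \<bar>h\<bar> ^ k / fact k * \<bar>x\<bar> ^ Suc n"
        unfolding jk[symmetric] by (simp add: abs_mult power_mult_distrib power_add)
      finally show ?thesis .
    qed
    define A where "A = exp (real j - real (Suc n)) * ?M j"
    have A: "A \<ge> 0" using Mpos[of j] by (simp add: A_def)
    have "poly_dist_le r (g i) (A / fact i)" if i: "i < k" for i
    proof -
      have "poly_dist_le r (g i) (\<bar>h ^ i / fact i\<bar> * (exp (real (j + i) - real (Suc n)) * ?M (j + i)))"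
        unfolding g_def using P unfolding bang_def by (intro poly_dist_cmult) blast
      moreover have "\<bar>h ^ i / fact i\<bar> * (exp (real (j + i) - real (Suc n)) * ?M (j + i)) \<le> A / fact i"
      proof -
        have "\<bar>h\<bar> ^ i * (exp (real (j + i) - real (Suc n)) * ?M (j + i))
            \<le> \<bar>h\<bar> ^ i * (exp (real (j + i) - real (Suc n)) * (?M j * \<rho> ^ i))"
          unfolding \<rho>_def using i jk by (intro mult_left_mono moment_norm_growth[OF r]) auto
        also have "\<dots> = A * (exp 1 * \<bar>h\<bar> * \<rho>) ^ i"
        proof -
          have "exp (real (j + i) - real (Suc n)) = exp (real j - real (Suc n)) * exp 1 ^ i"
            by (simp flip: exp_of_nat_mult exp_add add: algebra_simps)
          then show ?thesis by (simp add: A_def power_mult_distrib)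
        qed
        also have "\<dots> \<le> A * 1" using eh \<rho> A by (intro mult_left_mono power_le_one) auto
        finally show ?thesis by (simp add: power_abs divide_right_mono)
      qed
      ultimately show ?thesis by (rule poly_dist_mono)
    qed
    then have 1: "poly_dist_le r (\<lambda>x. \<Sum>i<k. g i x) (\<Sum>i<k. A / fact i)"
      by (intro poly_dist_sum[OF r]) auto
    have "poly_dist_le r E (\<bar>h\<bar> ^ k / fact k * ?M (Suc n))"
      using E_le by (intro poly_dist_power_bound[OF r EW]) auto
    moreover have "\<bar>h\<bar> ^ k / fact k * ?M (Suc n) \<le> A / fact k"
    proof -
      have "\<bar>h\<bar> ^ k * ?M (Suc n) \<le> \<bar>h\<bar> ^ k * (?M j * \<rho> ^ k)"
        unfolding \<rho>_def jk[symmetric] using moment_norm_growth[OF r, of j k n] jk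
        by (intro mult_left_mono) auto
      also have "\<dots> = A * (exp 1 * \<bar>h\<bar> * \<rho>) ^ k"
      proof -
        have "real (Suc n) = real j + real k" using jk by linarith
        then have "exp (real j - real (Suc n)) * exp 1 ^ k = 1"
          by (simp flip: exp_of_nat_mult exp_add)
        then have "A * exp 1 ^ k = ?M j" by (simp add: A_def ac_simps)
        then show ?thesis by (simp add: power_mult_distrib ac_simps)
      qed
      also have "\<dots> \<le> A * 1" using eh \<rho> A by (intro mult_left_mono power_le_one) auto
      finally show ?thesis by (simp add: divide_right_mono)
    qed
    ultimately have 2: "poly_dist_le r E (A / fact k)" by (rule poly_dist_mono)
    have eq: "(\<lambda>x. (\<Sum>i<k. g i x) + E x) = ?f" by (simp add: E_def)
    \<comment> \<open>Taylor terms and remainder together form a partial sum of the exponential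
      series; its bound \<open>exp 1\<close> costs exactly one level of \<open>n\<close>.\<close>
    have "(\<Sum>i<k. A / fact i) + A / fact k \<le> exp (real j - real n) * ?M j"
    proof -
      have "(\<Sum>i<k. A / fact i) + A / fact k = A * (\<Sum>i<Suc k. 1 / fact i)"
        by (simp add: sum_distrib_left algebra_simps)
      also have "(\<Sum>i<Suc k. 1 / fact i) \<le> exp (1::real)"
      proof -
        have s: "(\<lambda>i. 1 / fact i) sums exp (1::real)"
          using exp_converges[of "1::real"] by (simp add: divide_inverse)
        then show ?thesis unfolding sums_unique[OF s]
          by (intro sum_le_suminf) (auto simp: sums_iff)
      qed
      then have "A * (\<Sum>i<Suc k. 1 / fact i) \<le> A * exp 1" using A by (rule mult_left_mono)
      also have "\<dots> = exp (real j - real n) * ?M j"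
      proof -
        have "exp (real j - real (Suc n)) * exp 1 = exp (real j - real n)" by (simp add: exp_add[symmetric])
        then show ?thesis by (simp add: A_def)
      qed
      finally show ?thesis .
    qed
    with poly_dist_add[OF r 1 2] show ?thesis unfolding eq by (rule poly_dist_mono)
  qed
qed

text \<open>At 0 every level holds, so the argument starts there with level \<open>N\<close> and
  gives up one level per step of admissible length; the sum is the total distance available.\<close>

lemma bang_iterate:
  assumes r: "r \<ge> 1" and "n \<le> N"
    and "\<bar>t\<bar> \<le> (\<Sum>k=n..<N. moment_norm r k / (exp 1 * moment_norm r (Suc k)))"
  shows "bang r t n"
  using assms(2,3)
proof (induction n arbitrary: t rule: inc_induct)
  case base
  then show ?case using bang_0[OF r] by simp
next
  case (step n)
  define \<delta> where "\<delta> = moment_norm r n / (exp 1 * moment_norm r (Suc n))"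
  define H where "H = (\<Sum>k=Suc n..<N. moment_norm r k / (exp 1 * moment_norm r (Suc k)))"
  have H: "0 \<le> H" unfolding H_def by (intro sum_nonneg divide_nonneg_nonneg mult_nonneg_nonneg moment_norm_nonneg r) auto
  have \<delta>: "0 \<le> \<delta>" unfolding \<delta>_def by (intro divide_nonneg_nonneg mult_nonneg_nonneg moment_norm_nonneg r) auto
  have t: "\<bar>t\<bar> \<le> \<delta> + H"
    using step.prems step.hyps by (simp add: \<delta>_def H_def sum.atLeast_Suc_lessThan)
  \<comment> \<open>The point nearest to \<open>t\<close> at which the next level is available; the
    rest of the way is a single step.\<close>
  define t' where "t' = max (- H) (min H t)"
  have t': "\<bar>t'\<bar> \<le> H" "\<bar>t - t'\<bar> \<le> \<delta>" using t H \<delta> by (auto simp: t'_def)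
  have "bang r t' (Suc n)" using step.IH t'(1) by (simp add: H_def)
  then have "bang r (t' + (t - t')) n"
  proof (rule bang_step[OF r])
    have "\<bar>t - t'\<bar> * (exp 1 * moment_norm r (Suc n)) \<le> \<delta> * (exp 1 * moment_norm r (Suc n))"
      using t'(2) moment_norm_nonneg[OF r] by (intro mult_right_mono) auto
    also have "\<dots> = moment_norm r n" using moment_norm_pos[OF r, of "Suc n"] by (simp add: \<delta>_def)
    finally show "\<bar>t - t'\<bar> * exp 1 * moment_norm r (Suc n) \<le> moment_norm r n" by (simp add: mult.assoc)
  qed
  then show ?case by simp
qed

text \<open>If the series of ratios diverges, every \<open>t\<close> can be reached from 0 while any
  prescribed level \<open>n\<close> is kept; \<open>j = 0\<close> then leaves the bound
  \<open>exp (- n)\<close>.\<close>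

lemma poly_dist_cos:
  assumes r: "r \<ge> 1" and div: "\<not> summable (\<lambda>k. moment_norm r k / moment_norm r (Suc k))"
  shows "poly_dist_le r (\<lambda>x. cos (t * x + \<theta>)) 0"
proof -
  have "bang r t n" for n
  proof -
    let ?a = "\<lambda>k. moment_norm r k / (exp 1 * moment_norm r (Suc k))"
    have nn: "0 \<le> ?a k" for k
      by (intro divide_nonneg_nonneg mult_nonneg_nonneg moment_norm_nonneg r) auto
    have "\<not> summable ?a"
    proof
      assume "summable ?a"
      then have "summable (\<lambda>k. exp 1 * ?a k)" by (rule summable_mult)
      then show False using div by simp
    qed
    then have "\<not> (\<forall>N. (\<Sum>k<N. ?a k) \<le> \<bar>t\<bar> + (\<Sum>k<n. ?a k))"
      using summableI_nonneg_bounded[of ?a, OF nn] by blast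
    then obtain N where N: "\<bar>t\<bar> + (\<Sum>k<n. ?a k) < (\<Sum>k<N. ?a k)" by (auto simp: not_le)
    have nN: "n \<le> N"
    proof (rule ccontr)
      assume "\<not> n \<le> N"
      then have "(\<Sum>k<N. ?a k) \<le> (\<Sum>k<n. ?a k)" using nn by (intro sum_mono2) auto
      then show False using N by linarith
    qed
    have "(\<Sum>k<N. ?a k) = (\<Sum>k<n. ?a k) + (\<Sum>k=n..<N. ?a k)"
      using sum.atLeastLessThan_concat[of 0 n N ?a] nN by (simp add: lessThan_atLeast0)
    then show ?thesis using N by (intro bang_iterate[OF r nN]) simp
  qed
  then have P: "poly_dist_le r (\<lambda>x. x ^ 0 * cos (t * x + \<theta>)) (exp (real 0 - real n) * moment_norm r 0)" for n
    unfolding bang_def by blast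
  show ?thesis
    unfolding poly_dist_le_def
  proof (intro conjI allI impI)
    fix e :: real assume e: "e > 0"
    obtain n where n: "exp (- real n) < e / 2"
    proof -
      obtain n where "- ln (e / 2) < real n" using reals_Archimedean2 by blast
      then have "exp (- real n) < exp (ln (e / 2))" by simp
      then show ?thesis using that e by simp
    qed
    have "e / 2 > 0" using e by simp
    moreover have "poly_dist_le r (\<lambda>x. cos (t * x + \<theta>)) (exp (- real n))"
      using P[of n] by (simp add: moment_norm_0[OF r])
    ultimately obtain q where q: "Lp_le r (\<lambda>x. cos (t * x + \<theta>) - poly q x) (exp (- real n) + e / 2)"
      unfolding poly_dist_le_def by blast
    have "exp (- real n) + e / 2 \<le> 0 + e" using n by simp
    with q show "\<exists>q. Lp_le r (\<lambda>x. cos (t * x + \<theta>) - poly q x) (0 + e)"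
      by (intro exI[of _ q]) (rule Lp_le_mono)
  qed simp
qed

text \<open>Carleman's condition concerns exponent 2, whereas density is needed for every exponent
  \<open>2 * r\<close>. The square roots \<open>a k\<close> of quotients of consecutive even moments
  link the two: their geometric means are the terms of Carleman's series, and each ratio of
  \<open>moment_norm r\<close> is the geometric mean of \<open>r\<close> of them.\<close>

lemma carleman_ratio_diverges:
  assumes carl: "\<not> summable (\<lambda>n. moment (2 * Suc n) powr (- (1 / (2 * real (Suc n)))))" and r: "r \<ge> 1"
  shows "\<not> summable (\<lambda>k. moment_norm r k / moment_norm r (Suc k))"
proof
  assume sum: "summable (\<lambda>k. moment_norm r k / moment_norm r (Suc k))"
  define a where "a k = sqrt (moment (2 * k) / moment (2 * Suc k))" for k
  have a_pos: "a k > 0" for k by (simp add: a_def moment_pos del: mult_Suc_right)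
  have a_sq: "(a k)\<^sup>2 = moment (2 * k) / moment (2 * Suc k)" for k
    unfolding a_def using moment_pos[of k] moment_pos[of "Suc k"] by (intro real_sqrt_pow2) (auto simp: less_imp_le)
  have "decseq a"
  proof (rule decseq_SucI)
    fix k
    have "(moment (k + Suc (Suc k)))\<^sup>2 \<le> moment (2 * k) * moment (2 * Suc (Suc k))"
      by (rule moment_cauchy_schwarz)
    moreover have "k + Suc (Suc k) = 2 * Suc k" by simp
    ultimately have le: "(moment (2 * Suc k))\<^sup>2 \<le> moment (2 * k) * moment (2 * Suc (Suc k))" by metis
    have "s / q \<le> p / s" if "s\<^sup>2 \<le> p * q" "s > 0" "q > 0" for s p q :: real
      using that by (simp add: field_simps power2_eq_square)
    from this[OF le moment_pos moment_pos]
    have "moment (2 * Suc k) / moment (2 * Suc (Suc k)) \<le> moment (2 * k) / moment (2 * Suc k)" .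
    then show "a (Suc k) \<le> a k" unfolding a_def by (rule real_sqrt_le_mono)
  qed
  have prod_sq: "(\<Prod>k<n. (a k)\<^sup>2) = 1 / moment (2 * n)" for n
  proof (induction n)
    case (Suc n)
    then show ?case using moment_pos[of n] by (simp add: a_sq del: mult_Suc_right)
  qed (simp add: moment_0)
  have ratio: "a (r * Suc n) \<le> moment_norm r n / moment_norm r (Suc n)" for n
  proof -
    have "a (r * Suc n) ^ (2 * r) = (\<Prod>k<r. (a (r * Suc n))\<^sup>2)" by (simp add: power_mult)
    also have "\<dots> \<le> (\<Prod>k<r. (a (r * n + k))\<^sup>2)"
      using \<open>decseq a\<close> a_pos by (intro prod_mono conjI power_mono) (auto simp: decseq_def less_imp_le)
    also have "\<dots> = (\<Prod>k<r * n + r. (a k)\<^sup>2) / (\<Prod>k<r * n. (a k)\<^sup>2)"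
    proof -
      have "(\<Prod>k<m + l. f k) = (\<Prod>k<m. f k) * (\<Prod>k<l. f (m + k))" for m l and f :: "nat \<Rightarrow> real"
        by (induction l) (simp_all add: mult.assoc)
      moreover have "(\<Prod>k<r * n. (a k)\<^sup>2) \<noteq> 0" using a_pos by (simp add: less_imp_neq[symmetric])
      ultimately show ?thesis by simp
    qed
    also have "\<dots> = moment (2 * r * n) / moment (2 * r * Suc n)"
      unfolding prod_sq by (simp add: algebra_simps)
    also have "\<dots> = (moment_norm r n / moment_norm r (Suc n)) ^ (2 * r)"
      by (simp only: power_divide moment_norm_power[OF r])
    finally show ?thesis
      using r a_pos moment_norm_nonneg[OF r] by (subst (asm) power_mono_iff) (auto simp: less_imp_le)
  qed
  have "summable (\<lambda>n. a (r * Suc n))"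
    by (rule summable_comparison_test'[OF sum]) (use ratio a_pos in \<open>auto simp: less_imp_le abs_of_pos\<close>)
  then have "summable a"
    by (rule summable_decreasing_subsequence[rotated -1]) (use a_pos \<open>decseq a\<close> r in \<open>auto simp: less_imp_le\<close>)
  then have "summable (\<lambda>n. (\<Prod>k\<le>n. a k) powr (1 / real (Suc n)))"
    using a_pos by (intro carleman_inequality) (auto simp: less_imp_le)
  moreover have "(\<Prod>k\<le>n. a k) powr (1 / real (Suc n)) = moment (2 * Suc n) powr (- (1 / (2 * real (Suc n))))" for n
  proof -
    have "(\<Prod>k\<le>n. a k)\<^sup>2 = 1 / moment (2 * Suc n)"
      using prod_sq[of "Suc n"] by (simp add: prod_power_distrib lessThan_Suc_atMost)
    moreover have "(\<Prod>k\<le>n. a k) > 0" using a_pos by (simp add: prod_pos)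
    ultimately have "(\<Prod>k\<le>n. a k) = (1 / moment (2 * Suc n)) powr (1 / 2)"
      by (metis powr_half_sqrt real_sqrt_unique less_imp_le zero_le_power2)
    also have "\<dots> = moment (2 * Suc n) powr (- (1 / 2))"
      using moment_pos[of "Suc n"] by (simp add: powr_divide powr_minus_divide del: mult_Suc_right)
    finally show ?thesis by (simp add: powr_powr)
  qed
  ultimately show False using carl by simp
qed

end

section \<open>Quadrature formulas with square weights\<close>

lemma abs_diff_sin_le: "\<bar>sin u - u\<bar> \<le> u\<^sup>2 / 2" for u :: real
  using cos_taylor[of "- (pi / 2)" u 2]
  by (simp add: numeral_2_eq_2 cos_diff)

lemma abs_diff_power_le:
  fixes x y :: real
  assumes "\<bar>y\<bar> \<le> \<bar>x\<bar>" "\<bar>x - y\<bar> \<le> \<delta> * x\<^sup>2"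
  shows "\<bar>x ^ a - y ^ a\<bar> \<le> real a * \<delta> * \<bar>x\<bar> ^ Suc a"
proof (induction a)
  case (Suc a)
  have "x ^ Suc a - y ^ Suc a = x * (x ^ a - y ^ a) + y ^ a * (x - y)" by (simp add: algebra_simps)
  then have "\<bar>x ^ Suc a - y ^ Suc a\<bar> \<le> \<bar>x\<bar> * \<bar>x ^ a - y ^ a\<bar> + \<bar>y\<bar> ^ a * \<bar>x - y\<bar>"
    by (metis abs_mult abs_triangle_ineq power_abs)
  also have "\<dots> \<le> \<bar>x\<bar> * (real a * \<delta> * \<bar>x\<bar> ^ Suc a) + \<bar>x\<bar> ^ a * (\<delta> * x\<^sup>2)"
    using assms Suc by (intro add_mono mult_mono power_mono) auto
  also have "\<dots> = real (Suc a) * \<delta> * \<bar>x\<bar> ^ Suc (Suc a)"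
    by (simp add: algebra_simps power2_eq_square flip: abs_mult)
  finally show ?case .
qed simp

context moment_line
begin

text \<open>One sequence of polynomials serves all even exponents at once; this makes the
  approximable functions closed under products.\<close>

definition approximable :: "(real \<Rightarrow> real) \<Rightarrow> bool" where
  "approximable f \<longleftrightarrow> f \<in> W \<and> (\<exists>q. null_seq (\<lambda>n. f - poly (q n)))"

lemma approximable_const: "approximable (\<lambda>_. c)"
proof -
  have "(\<lambda>n::nat. (\<lambda>_. c) - poly [:c:]) = (\<lambda>_. 0)" by (simp add: fun_eq_iff)
  then have "null_seq (\<lambda>n. (\<lambda>_. c) - poly ((\<lambda>_. [:c:]) n))" using null_zero by simp
  then show ?thesis unfolding approximable_def
    by (intro conjI exI[of _ "\<lambda>_. [:c:]"] W_const)
qed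

lemma approximable_mult:
  assumes "approximable f" "approximable g"
  shows "approximable (\<lambda>x. f x * g x)"
proof -
  obtain p q where "null_seq (\<lambda>n. f - poly (p n))" "null_seq (\<lambda>n. g - poly (q n))"
    using assms unfolding approximable_def by (elim conjE exE)
  then have "null_seq (\<lambda>n. f * g - poly (p n) * poly (q n))"
    using assms by (intro null_diff_mult) (auto simp: approximable_def)
  moreover have "f * g - poly (p n) * poly (q n) = (\<lambda>x. f x * g x) - poly (p n * q n)" for n
    by (simp add: fun_eq_iff)
  ultimately have "null_seq (\<lambda>n. (\<lambda>x. f x * g x) - poly (p n * q n))" by simp
  moreover have "(\<lambda>x. f x * g x) \<in> W" using assms by (intro W_times) (simp_all add: approximable_def)
  ultimately show ?thesis unfolding approximable_def by (intro conjI exI[of _ "\<lambda>n. p n * q n"])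
qed

lemma approximable_power: "approximable f \<Longrightarrow> approximable (\<lambda>x. f x ^ n)"
  by (induction n) (simp_all add: approximable_const approximable_mult)

lemma approximable_square:
  assumes "approximable f"
  obtains q where "null_seq (\<lambda>n x. (f x)\<^sup>2 - (poly (q n) x)\<^sup>2)"
proof -
  obtain q where q: "null_seq (\<lambda>n. f - poly (q n))" using assms by (auto simp: approximable_def)
  have "f \<in> W" using assms by (simp add: approximable_def)
  from null_diff_mult[OF this q this q] have "null_seq (\<lambda>n. f * f - poly (q n) * poly (q n))" .
  moreover have "f * f - poly (q n) * poly (q n) = (\<lambda>x. (f x)\<^sup>2 - (poly (q n) x)\<^sup>2)" for n
    by (simp add: fun_eq_iff power2_eq_square)
  ultimately have "null_seq (\<lambda>n x. (f x)\<^sup>2 - (poly (q n) x)\<^sup>2)" by simp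
  then show ?thesis by (rule that)
qed

end

context positive_moments
begin

context
  assumes carleman: "\<not> summable (\<lambda>n. moment (2 * Suc n) powr (- (1 / (2 * real (Suc n)))))"
begin

text \<open>The \<open>n\<close>-th polynomial is chosen within \<open>1 / Suc n\<close> in the
  seminorm of exponent \<open>2 * Suc n\<close>, as \<open>null_seqI\<close> requires.\<close>

lemma approximable_cos: "approximable (\<lambda>x. cos (t * x + \<theta>))"
proof -
  have "\<exists>q. Lp_le (Suc n) (\<lambda>x. cos (t * x + \<theta>) - poly q x) (1 / real (Suc n))" for n
  proof -
    have "poly_dist_le (Suc n) (\<lambda>x. cos (t * x + \<theta>)) 0"
      by (intro poly_dist_cos carleman_ratio_diverges carleman) auto
    moreover have "1 / real (Suc n) > 0" by simp
    ultimately have "\<exists>q. Lp_le (Suc n) (\<lambda>x. cos (t * x + \<theta>) - poly q x) (0 + 1 / real (Suc n))"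
      unfolding poly_dist_le_def by blast
    then show ?thesis by (simp only: add_0)
  qed
  then obtain q where "\<And>n. Lp_le (Suc n) (\<lambda>x. cos (t * x + \<theta>) - poly (q n) x) (1 / real (Suc n))" by metis
  then have "null_seq (\<lambda>n x. cos (t * x + \<theta>) - poly (q n) x)" by (rule null_seqI)
  then have "null_seq (\<lambda>n. (\<lambda>x. cos (t * x + \<theta>)) - poly (q n))" by (simp add: fun_diff_def)
  then show ?thesis unfolding approximable_def using trig_W[of 0 t \<theta>] by auto
qed

text \<open>
  For large \<open>R\<close> the variable \<open>x\<close> is close to \<open>R * sin (x / R)\<close>, and with \<open>v = x / (2 * R) - pi / 4\<close> the point
  \<open>y = (1 + sin (x / R)) / 2 = (cos v)\<^sup>2\<close> runs through \<open>{0..1}\<close>. The Bernstein weights at \<open>y\<close> are then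
  squares of trigonometric polynomials.
\<close>

lemma quadrature_approx:
  assumes r: "r \<ge> 1" and \<epsilon>: "\<epsilon> > 0"
  shows "\<exists>N c q. \<forall>a\<le>d. Lp_le r (\<lambda>x. x ^ a - (\<Sum>k\<le>N::nat. c k ^ a * (poly (q k) x)\<^sup>2)) \<epsilon>"
proof -
  \<comment> \<open>\<open>R\<close> is large enough that the error bound
    \<open>a / (2 * R) * moment_norm r (Suc a)\<close> for replacing \<open>x\<close> by
    \<open>R * sin (x / R)\<close> is at most \<open>\<epsilon> / 6\<close> for all
    \<open>a \<le> d\<close> at once.\<close>
  define R where "R = 1 + (\<Sum>a\<le>d. 3 * real a * moment_norm r (Suc a) / \<epsilon>)"
  have terms: "0 \<le> 3 * real a * moment_norm r (Suc a) / \<epsilon>" for a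
    using moment_norm_nonneg[OF r] \<epsilon> by simp
  have R1: "R \<ge> 1" using sum_nonneg[of "{..d}", OF terms] by (simp add: R_def)
  have RM: "real a / (2 * R) * moment_norm r (Suc a) + \<epsilon> / 6 \<le> \<epsilon> / 3" if "a \<le> d" for a
  proof -
    have "3 * real a * moment_norm r (Suc a) / \<epsilon> \<le> (\<Sum>a\<le>d. 3 * real a * moment_norm r (Suc a) / \<epsilon>)"
      using that by (intro member_le_sum terms) auto
    then have "3 * real a * moment_norm r (Suc a) / \<epsilon> \<le> R" by (simp add: R_def)
    then show ?thesis using R1 \<epsilon> by (simp add: field_simps)
  qed
  define s where "s x = R * sin (x / R)" for x
  have sW: "(\<lambda>x. s x ^ a) \<in> W" for a
    unfolding s_def using R1 by (intro W_power W_cmult W_bounded[of _ 1]) auto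
  have diffW: "(\<lambda>x. f x - g x) \<in> W" if "f \<in> W" "g \<in> W" for f g
    using B_diff[OF that] by (simp add: fun_diff_def)
  have 1: "Lp_le r (\<lambda>x. x ^ a - s x ^ a) (\<epsilon> / 3)" if a: "a \<le> d" for a
  proof (rule Lp_le_mono[OF _ RM[OF a]], rule Lp_le_power_bound[OF r])
    show "(\<lambda>x. x ^ a - s x ^ a) \<in> W" by (intro diffW sW power_W)
    fix x :: real
    have "\<bar>s x\<bar> \<le> \<bar>x\<bar>"
    proof -
      have "\<bar>s x\<bar> = R * \<bar>sin (x / R)\<bar>" using R1 by (simp add: s_def abs_mult)
      also have "\<dots> \<le> R * \<bar>x / R\<bar>" using R1 by (intro mult_left_mono abs_sin_x_le_abs_x) auto
      also have "\<dots> = \<bar>x\<bar>" using R1 by (simp add: abs_divide)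
      finally show ?thesis .
    qed
    moreover have "\<bar>x - s x\<bar> \<le> 1 / (2 * R) * x\<^sup>2"
    proof -
      have "x - s x = - R * (sin (x / R) - x / R)" using R1 by (simp add: s_def algebra_simps)
      then have "\<bar>x - s x\<bar> = R * \<bar>sin (x / R) - x / R\<bar>" using R1 by (simp add: abs_mult)
      also have "\<dots> \<le> R * ((x / R)\<^sup>2 / 2)" using R1 by (intro mult_left_mono abs_diff_sin_le) auto
      also have "\<dots> = 1 / (2 * R) * x\<^sup>2" using R1 by (simp add: power2_eq_square)
      finally show ?thesis .
    qed
    ultimately have "\<bar>x ^ a - s x ^ a\<bar> \<le> real a * (1 / (2 * R)) * \<bar>x\<bar> ^ Suc a" by (rule abs_diff_power_le)
    then show "\<bar>x ^ a - s x ^ a\<bar> \<le> real a / (2 * R) * \<bar>x\<bar> ^ Suc a" by simp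
  qed (use R1 \<epsilon> in auto)
  have "\<exists>N. \<forall>n x. N \<le> n \<and> x \<in> {0..1} \<longrightarrow>
      \<bar>(R * (2 * x - 1)) ^ a - (\<Sum>k\<le>n. (R * (2 * (real k / real n) - 1)) ^ a * Bernstein n k x)\<bar> < \<epsilon> / 3" for a
    by (intro Bernstein_Weierstrass continuous_intros) (use \<epsilon> in auto)
  from choice[OF allI[OF this]] obtain N0 where "\<forall>a n x. N0 a \<le> n \<and> x \<in> {0..1} \<longrightarrow>
      \<bar>(R * (2 * x - 1)) ^ a - (\<Sum>k\<le>n. (R * (2 * (real k / real n) - 1)) ^ a * Bernstein n k x)\<bar> < \<epsilon> / 3" ..
  then have N0: "\<bar>(R * (2 * x - 1)) ^ a - (\<Sum>k\<le>n. (R * (2 * (real k / real n) - 1)) ^ a * Bernstein n k x)\<bar> < \<epsilon> / 3"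
    if "N0 a \<le> n" "x \<in> {0..1}" for a n x
    using that by blast
  define N where "N = (\<Sum>a\<le>d. N0 a)"
  have N: "N0 a \<le> N" if "a \<le> d" for a unfolding N_def using that by (intro member_le_sum) auto
  \<comment> \<open>The node belonging to \<open>y = k / N\<close>, since
    \<open>R * sin (x / R) = R * (2 * y - 1)\<close>.\<close>
  define c where "c k = R * (2 * (real k / real N) - 1)" for k :: nat
  define v where "v x = 1 / (2 * R) * x + - (pi / 4)" for x
  \<comment> \<open>The second cosine, shifted by a quarter period, is \<open>sin (v x)\<close>; it
    is written as a cosine to fit \<open>approximable_cos\<close>.\<close>
  define \<phi> where "\<phi> k x = sqrt (real (N choose k)) * (cos (v x) ^ k * cos (1 / (2 * R) * x + - (pi / 4 + pi / 2)) ^ (N - k))" for k x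
  have approx: "approximable (\<phi> k)" for k
    unfolding \<phi>_def v_def by (intro approximable_mult approximable_const approximable_power approximable_cos)
  define y where "y x = (1 + sin (x / R)) / 2" for x
  have y01: "y x \<in> {0..1}" for x
  proof -
    have "(1 + w) / 2 \<in> {0..1}" if "- 1 \<le> w" "w \<le> 1" for w :: real using that by simp
    from this[OF sin_ge_minus_one sin_le_one] show ?thesis by (simp only: y_def)
  qed
  have \<phi>_sq: "(\<phi> k x)\<^sup>2 = Bernstein N k (y x)" for k x
  proof -
    have "cos (2 * v x) = sin (x / R)" using R1 by (simp add: v_def right_diff_distrib cos_diff)
    then have c2: "(cos (v x))\<^sup>2 = y x" using cos_double_cos[of "v x"] by (simp add: y_def)
    have "cos (1 / (2 * R) * x + - (pi / 4 + pi / 2)) = cos (v x - pi / 2)" by (simp add: v_def algebra_simps)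
    also have "\<dots> = sin (v x)" by (simp add: cos_diff)
    finally have s2: "(cos (1 / (2 * R) * x + - (pi / 4 + pi / 2)))\<^sup>2 = 1 - y x"
      using sin_squared_eq[of "v x"] c2 by simp
    have "(\<phi> k x)\<^sup>2 = real (N choose k) * (((cos (v x))\<^sup>2) ^ k * ((cos (1 / (2 * R) * x + - (pi / 4 + pi / 2)))\<^sup>2) ^ (N - k))"
      by (simp add: \<phi>_def power_mult_distrib flip: power_mult) (simp add: mult.commute)
    then show ?thesis unfolding c2 s2 Bernstein_def by (simp only: mult.assoc)
  qed
  have 2: "Lp_le r (\<lambda>x. s x ^ a - (\<Sum>k\<le>N. c k ^ a * (\<phi> k x)\<^sup>2)) (\<epsilon> / 3)" if a: "a \<le> d" for a
  proof (rule Lp_le_uniform)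
    fix x
    have "2 * ((1 + w) / 2) - 1 = w" for w :: real by (simp add: field_simps)
    then have "R * (2 * y x - 1) = s x" by (simp only: y_def s_def)
    then show "\<bar>s x ^ a - (\<Sum>k\<le>N. c k ^ a * (\<phi> k x)\<^sup>2)\<bar> \<le> \<epsilon> / 3"
      using N0[OF N[OF a] y01[of x]] by (simp add: c_def \<phi>_sq)
  qed (use \<epsilon> in simp)
  have "\<exists>q. null_seq (\<lambda>n x. (\<phi> k x)\<^sup>2 - (poly (q n) x)\<^sup>2)" for k
  proof -
    obtain q where "null_seq (\<lambda>n x. (\<phi> k x)\<^sup>2 - (poly (q n) x)\<^sup>2)" by (rule approximable_square[OF approx[of k]])
    then show ?thesis by (rule exI[of _ q])
  qed
  then have "\<forall>k. \<exists>q. null_seq (\<lambda>n x. (\<phi> k x)\<^sup>2 - (poly (q n) x)\<^sup>2)" by (rule allI)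
  from choice[OF this] obtain q where "\<forall>k. null_seq (\<lambda>n x. (\<phi> k x)\<^sup>2 - (poly (q k n) x)\<^sup>2)" ..
  note q = spec[OF this]
  have "\<forall>\<^sub>F n in sequentially. Lp_le r (\<lambda>x. \<Sum>k\<le>N. c k ^ a * ((\<phi> k x)\<^sup>2 - (poly (q k n) x)\<^sup>2)) (\<epsilon> / 3)" for a
  proof (rule null_seqD[OF _ r])
    have "null_seq (\<lambda>n. \<Sum>k\<le>N. c k ^ a *\<^sub>R (\<lambda>x. (\<phi> k x)\<^sup>2 - (poly (q k n) x)\<^sup>2))"
      by (intro null_sum null_scale q)
    moreover have "(\<Sum>k\<le>N. c k ^ a *\<^sub>R (\<lambda>x. (\<phi> k x)\<^sup>2 - (poly (q k n) x)\<^sup>2)) =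
        (\<lambda>x. \<Sum>k\<le>N. c k ^ a * ((\<phi> k x)\<^sup>2 - (poly (q k n) x)\<^sup>2))" for n
      by (simp add: fun_eq_iff sum_fun_apply)
    ultimately show "null_seq (\<lambda>n x. \<Sum>k\<le>N. c k ^ a * ((\<phi> k x)\<^sup>2 - (poly (q k n) x)\<^sup>2))" by simp
  qed (use \<epsilon> in simp)
  then have "\<forall>\<^sub>F n in sequentially. \<forall>a\<in>{..d}. Lp_le r (\<lambda>x. \<Sum>k\<le>N. c k ^ a * ((\<phi> k x)\<^sup>2 - (poly (q k n) x)\<^sup>2)) (\<epsilon> / 3)"
    by (intro eventually_ball_finite) auto
  from eventually_happens'[OF sequentially_bot this] obtain n where
    "\<forall>a\<in>{..d}. Lp_le r (\<lambda>x. \<Sum>k\<le>N. c k ^ a * ((\<phi> k x)\<^sup>2 - (poly (q k n) x)\<^sup>2)) (\<epsilon> / 3)" ..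
  then have n: "Lp_le r (\<lambda>x. \<Sum>k\<le>N. c k ^ a * ((\<phi> k x)\<^sup>2 - (poly (q k n) x)\<^sup>2)) (\<epsilon> / 3)"
    if "a \<le> d" for a
    by (rule bspec) (use that in simp)
  have "Lp_le r (\<lambda>x. x ^ a - (\<Sum>k\<le>N. c k ^ a * (poly (q k n) x)\<^sup>2)) \<epsilon>" if a: "a \<le> d" for a
  proof -
    have eq: "x ^ a - (\<Sum>k\<le>N. c k ^ a * (poly (q k n) x)\<^sup>2) =
        (x ^ a - s x ^ a) + (s x ^ a - (\<Sum>k\<le>N. c k ^ a * (\<phi> k x)\<^sup>2)) +
        (\<Sum>k\<le>N. c k ^ a * ((\<phi> k x)\<^sup>2 - (poly (q k n) x)\<^sup>2))" for x
      by (simp add: right_diff_distrib sum_subtractf)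
    have \<epsilon>3: "\<epsilon> / 3 + \<epsilon> / 3 + \<epsilon> / 3 = \<epsilon>" by simp
    show ?thesis
      using Lp_le_add[OF Lp_le_add[OF 1[OF a] 2[OF a] r] n[OF a] r] by (simp only: eq \<epsilon>3)
  qed
  then show ?thesis by (intro exI[of _ N] exI[of _ c] exI[of _ "\<lambda>k. q k n"] allI impI)
qed

end

end

context moment_line
begin

text \<open>If an even moment of positive order vanishes, Cauchy--Schwarz makes all of them vanish,
  and the single node 0 with weight 1 has zero error in every even moment. Otherwise the
  approximations of \<open>quadrature_approx\<close> are diagonalized.\<close>

lemma quadrature:
  assumes "(\<exists>k. moment (2 * Suc k) = 0) \<or> \<not> summable (\<lambda>n. moment (2 * Suc n) powr (- (1 / (2 * real (Suc n)))))"
  obtains N :: "nat \<Rightarrow> nat" and c :: "nat \<Rightarrow> nat \<Rightarrow> real" and q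
  where "\<And>a. null_seq (\<lambda>n x. x ^ a - (\<Sum>k\<le>N n. c n k ^ a * (poly (q n k) x)\<^sup>2))"
proof (cases "\<exists>k. moment (2 * Suc k) = 0")
  case True
  then obtain k where k: "moment (2 * Suc k) = 0" by blast
  \<comment> \<open>Cauchy--Schwarz halves the order of a vanishing moment, and \<open>up\<close>
    raises it; doubling \<open>i\<close> often enough brings it into the range of
    \<open>up\<close>.\<close>
  have down: "moment (2 * i) = 0" if "moment (2 * (2 * i)) = 0" for i
    using moment_cauchy_schwarz[of 0 "2 * i"] that by simp
  have up: "moment (2 * (Suc k + l)) = 0" for l
    using moment_cauchy_schwarz[of "Suc k" "Suc k + 2 * l"] k by (simp add: algebra_simps)
  have zero: "moment (2 * i) = 0" if "i \<ge> 1" for i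
  proof -
    have "moment (2 * (2 ^ l * i)) = 0 \<Longrightarrow> moment (2 * i) = 0" for l
    proof (induction l)
      case (Suc l)
      then show ?case using down[of "2 ^ l * i"] by (simp add: mult.assoc)
    qed simp
    moreover have "Suc k \<le> 2 ^ Suc k * i"
    proof -
      have "Suc k \<le> 2 ^ Suc k" by (rule less_imp_le) (rule less_exp)
      also have "\<dots> \<le> 2 ^ Suc k * i" using that by simp
      finally show ?thesis .
    qed
    then have "moment (2 * (2 ^ Suc k * i)) = 0" using up[of "2 ^ Suc k * i - Suc k"] by (simp only: le_add_diff_inverse)
    ultimately show ?thesis by blast
  qed
  \<comment> \<open>For \<open>a = 0\<close> the convention \<open>0 ^ 0 = 1\<close> makes the
    formula exact.\<close>
  have "null_seq (\<lambda>n x. x ^ a - (\<Sum>k\<le>(0::nat). 0 ^ a * (poly 1 x)\<^sup>2))" for a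
  proof (cases "a = 0")
    case True
    have "(\<lambda>x::real. x ^ a - (\<Sum>k\<le>(0::nat). 0 ^ a * (poly 1 x)\<^sup>2)) = 0"
      using True by (simp add: fun_eq_iff)
    then show ?thesis using null_zero by simp
  next
    case False
    have eq: "(\<lambda>x::real. x ^ a - (\<Sum>k\<le>(0::nat). 0 ^ a * (poly 1 x)\<^sup>2)) = (\<lambda>x. x ^ a)"
      using False by (simp add: fun_eq_iff)
    have "(\<lambda>x::real. x ^ a) ^ (2 * i) = (\<lambda>x. x ^ (2 * (a * i)))" for i
      by (simp add: fun_eq_iff power_mult[symmetric] mult.left_commute)
    then have "\<Lambda> ((\<lambda>x. x ^ a) ^ (2 * i)) = 0" if "i \<ge> 1" for i
      using zero[of "a * i"] that False by (simp add: moment_def)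
    then show ?thesis unfolding eq null_seq_def using power_W by auto
  qed
  then show ?thesis by (rule that)
next
  case False
  interpret positive_moments W \<Lambda>
  proof
    fix n
    show "0 < moment (2 * n)"
    proof (cases n)
      case (Suc k)
      then show ?thesis using False moment_even_nonneg[of n] by (metis less_eq_real_def)
    qed (simp add: moment_0)
  qed
  have carl: "\<not> summable (\<lambda>n. moment (2 * Suc n) powr (- (1 / (2 * real (Suc n)))))" using assms False by blast
  have "\<forall>n. \<exists>N c q. \<forall>a\<le>n. Lp_le (Suc n) (\<lambda>x. x ^ a - (\<Sum>k\<le>N::nat. c k ^ a * (poly (q k) x)\<^sup>2)) (1 / real (Suc n))"
    using quadrature_approx[OF carl] by simp
  from choice[OF this] obtain N :: "nat \<Rightarrow> nat" where
    "\<forall>n. \<exists>c q. \<forall>a\<le>n. Lp_le (Suc n) (\<lambda>x. x ^ a - (\<Sum>k\<le>N n. c k ^ a * (poly (q k) x)\<^sup>2)) (1 / real (Suc n))" ..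
  from choice[OF this] obtain c where
    "\<forall>n. \<exists>q. \<forall>a\<le>n. Lp_le (Suc n) (\<lambda>x. x ^ a - (\<Sum>k\<le>N n. c n k ^ a * (poly (q k) x)\<^sup>2)) (1 / real (Suc n))" ..
  from choice[OF this] obtain q where
    "\<forall>n. \<forall>a\<le>n. Lp_le (Suc n) (\<lambda>x. x ^ a - (\<Sum>k\<le>N n. c n k ^ a * (poly (q n k) x)\<^sup>2)) (1 / real (Suc n))" ..
  then have le: "Lp_le (Suc n) (\<lambda>x. x ^ a - (\<Sum>k\<le>N n. c n k ^ a * (poly (q n k) x)\<^sup>2)) (1 / real (Suc n))"
    if "a \<le> n" for n a
    using that by (elim allE impE)
  show ?thesis
  proof (rule that)
    fix a
    define u where "u n = (\<lambda>x. x ^ a - (\<Sum>k\<le>N n. c n k ^ a * (poly (q n k) x)\<^sup>2))" for n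
    have uW: "u n \<in> W" for n
    proof -
      have "u n = poly (monom 1 a - (\<Sum>k\<le>N n. smult (c n k ^ a) ((q n k)\<^sup>2)))"
        by (simp add: u_def fun_eq_iff poly_monom poly_sum)
      then show ?thesis using poly_W by metis
    qed
    \<comment> \<open>The estimate at stage \<open>n\<close> covers only \<open>a \<le> n\<close>;
      altering finitely many terms does not affect the limits.\<close>
    have "null_seq (\<lambda>n. if a \<le> n then u n else 0)"
    proof (rule null_seqI)
      fix n
      show "Lp_le (Suc n) (if a \<le> n then u n else 0) (1 / real (Suc n))"
        using le[of a n] Lp_le_uniform[of "\<lambda>_. 0" "1 / real (Suc n)" "Suc n"] by (simp add: u_def zero_fun_def)
    qed
    moreover have "\<forall>\<^sub>F n in sequentially. \<Lambda> ((if a \<le> n then u n else 0) ^ (2 * i)) = \<Lambda> (u n ^ (2 * i))" for i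
      using eventually_ge_at_top[of a] by eventually_elim simp
    ultimately have "(\<lambda>n. \<Lambda> (u n ^ (2 * i))) \<longlonglongrightarrow> 0" if "i \<ge> 1" for i
      using that unfolding null_seq_def by (blast intro: Lim_transform_eventually)
    then show "null_seq (\<lambda>n x. x ^ a - (\<Sum>k\<le>N n. c n k ^ a * (poly (q n k) x)\<^sup>2))"
      using uW unfolding null_seq_def u_def[symmetric] by auto
  qed
qed

end

section \<open>Positivity under Carleman's condition\<close>

definition poly_at :: "real poly \<Rightarrow> 'a::{real_algebra_1, comm_ring_1} \<Rightarrow> 'a" where
  "poly_at p s = poly (map_poly of_real p) s"

lemma map_poly_of_real_add:
  "map_poly of_real (p + q) = map_poly of_real p + (map_poly of_real q :: 'a::{real_algebra_1, comm_ring_1} poly)"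
  by (rule poly_eqI) (simp add: coeff_map_poly)

lemma poly_at_0 [simp]: "poly_at 0 s = 0"
  by (simp add: poly_at_def)

lemma poly_at_add: "poly_at (p + q) s = poly_at p s + poly_at q s"
  by (simp add: poly_at_def map_poly_of_real_add)

lemma poly_at_pCons: "poly_at (pCons c p) s = c *\<^sub>R 1 + s * poly_at p s"
  by (cases "c = 0 \<and> p = 0") (auto simp: poly_at_def map_poly_pCons of_real_def)

lemma poly_at_smult: "poly_at (smult c p) s = c *\<^sub>R poly_at p s"
  by (induction p) (simp_all add: poly_at_pCons scaleR_add_right)

lemma poly_at_mult: "poly_at (p * q) s = poly_at p s * poly_at q s"
  by (induction p) (simp_all add: poly_at_pCons poly_at_add poly_at_smult algebra_simps)

lemma poly_at_1 [simp]: "poly_at 1 s = 1"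
  by (simp add: one_pCons poly_at_pCons)

lemma poly_at_power: "poly_at (p ^ n) s = poly_at p s ^ n"
  by (induction n) (simp_all add: poly_at_mult)

lemma poly_at_monom: "poly_at (monom 1 n) s = s ^ n"
  by (induction n) (simp_all add: monom_0 monom_Suc poly_at_pCons)

lemma poly_at_diff: "poly_at (p - q) s = poly_at p s - poly_at q s"
  using poly_at_add[of "p - q" q s] by simp

lemma poly_at_sum: "poly_at (sum f I) s = (\<Sum>i\<in>I. poly_at (f i) s)"
  by (induction I rule: infinite_finite_induct) (simp_all add: poly_at_add)

lemma suminf_ennreal_finite:
  fixes f :: "nat \<Rightarrow> real"
  assumes "\<And>n. 0 \<le> f n" "summable f"
  shows "suminf (\<lambda>n. ennreal (f n)) \<noteq> \<infinity>"
  using assms by (simp add: suminf_ennreal2 less_top[symmetric])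

lemma carlemanD:
  assumes "carleman L t"
  shows "(\<exists>n. L (t ^ (2 * Suc n)) = 0) \<or>
    \<not> summable (\<lambda>n. L (t ^ (2 * Suc n)) powr (- (1 / (2 * real (Suc n)))))"
proof (rule ccontr)
  assume "\<not> ?thesis"
  then have nz: "\<And>n. L (t ^ (2 * Suc n)) \<noteq> 0"
    and sum: "summable (\<lambda>n. L (t ^ (2 * Suc n)) powr (- (1 / (2 * real (Suc n)))))" by blast+
  have "suminf (\<lambda>n. ennreal (L (t ^ (2 * Suc n)) powr (- (1 / (2 * real (Suc n)))))) \<noteq> \<infinity>"
    by (rule suminf_ennreal_finite[OF _ sum]) simp
  then show False using assms nz unfolding carleman_def by simp
qed

locale positive_linear = positive_functional UNIV L for L :: "'a::{real_algebra_1, comm_ring_1} \<Rightarrow> real"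
begin

text \<open>A polynomial in one variable that is nonnegative on the line is a sum of squares, so
  positivity of \<open>L\<close> on squares is all that the extension theorem asks for here.\<close>

lemma moment_line_at:
  obtains W \<Lambda> where "moment_line W \<Lambda>" "\<And>p. \<Lambda> (poly p) = L (poly_at p s)"
proof -
  define G where "G = range (\<lambda>p. (poly p :: real \<Rightarrow> real, L (poly_at p s)))"
  obtain W \<Lambda> where W: "dominated_functional UNIV W \<Lambda>" "\<And>f r. (f, r) \<in> G \<Longrightarrow> f \<in> W \<and> \<Lambda> f = r"
  proof (rule positive_extension[of G UNIV])
    show "subspace G"
      unfolding subspace_def
    proof (intro conjI ballI allI)
      have "poly (0 :: real poly) = 0" by (simp add: fun_eq_iff)
      then show "0 \<in> G" unfolding G_def by (intro image_eqI[of _ _ 0]) (simp_all add: zero_prod_def)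
      fix x y assume "x \<in> G" "y \<in> G"
      then obtain p q where "x = (poly p, L (poly_at p s))" "y = (poly q, L (poly_at q s))"
        unfolding G_def by blast
      then show "x + y \<in> G" unfolding G_def
        by (intro image_eqI[of _ _ "p + q"]) (simp_all add: fun_eq_iff poly_at_add L_add)
    next
      fix c x assume "x \<in> G"
      then obtain p where "x = (poly p, L (poly_at p s))" unfolding G_def by blast
      then show "c *\<^sub>R x \<in> G" unfolding G_def
        by (intro image_eqI[of _ _ "smult c p"]) (simp_all add: fun_eq_iff poly_at_smult L_scale)
    qed
    have "poly (1 :: real poly) = 1" by (simp add: fun_eq_iff)
    then show "(1, 1) \<in> G" unfolding G_def by (intro image_eqI[of _ _ 1]) (simp_all add: L_one)
    show "f * g \<in> fst ` G" if fg: "(f, r) \<in> G" "(g, t) \<in> G" for f g r t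
    proof -
      obtain p q where "f = poly p" "g = poly q" using fg unfolding G_def by blast
      then have "f * g = poly (p * q)" by (simp add: fun_eq_iff)
      then show ?thesis unfolding G_def by (simp add: image_image)
    qed
    show "0 \<le> r" if fr: "(f, r) \<in> G" "\<And>x. x \<in> UNIV \<Longrightarrow> 0 \<le> f x" for f r
    proof -
      obtain p where p: "f = poly p" "r = L (poly_at p s)" using fr(1) unfolding G_def by blast
      have "sos p" using fr(2) p(1) by (intro nonneg_poly_sos) simp
      then have "0 \<le> L (poly_at p s)"
        by induction (simp_all add: poly_at_mult poly_at_add L_square L_add)
      then show ?thesis using p(2) by simp
    qed
  qed blast
  have G: "(poly p, L (poly_at p s)) \<in> G" for p unfolding G_def by blast
  have "moment_line W \<Lambda>"
  proof (intro moment_line.intro moment_line_axioms.intro W(1))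
    show "poly p \<in> W" for p using W(2)[OF G] by blast
  qed
  then show ?thesis by (rule that) (use W(2)[OF G] in blast)
qed

text \<open>The differences in \<open>quadrature\<close> are polynomial functions, and on these
  \<open>\<Lambda>\<close> is \<open>L\<close> after substituting \<open>s\<close>; so the
  convergence there is one in the algebra.\<close>

lemma quadrature_at:
  assumes "carleman L s"
  obtains N :: "nat \<Rightarrow> nat" and c :: "nat \<Rightarrow> nat \<Rightarrow> real" and q
  where "\<And>a. null_seq (\<lambda>n. s ^ a - (\<Sum>k\<le>N n. c n k ^ a *\<^sub>R (q n k * q n k)))"
proof -
  obtain W \<Lambda> where W: "moment_line W \<Lambda>" and \<Lambda>: "\<And>p. \<Lambda> (poly p) = L (poly_at p s)"
    using moment_line_at[of s] by blast
  interpret line: moment_line W \<Lambda> by (rule W)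
  have moment: "line.moment n = L (s ^ n)" for n
  proof -
    have "(\<lambda>x::real. x ^ n) = poly (monom 1 n)" by (simp add: fun_eq_iff poly_monom)
    then show ?thesis unfolding line.moment_def by (simp only: \<Lambda> poly_at_monom)
  qed
  have "(\<exists>k. line.moment (2 * Suc k) = 0) \<or>
      \<not> summable (\<lambda>n. line.moment (2 * Suc n) powr (- (1 / (2 * real (Suc n)))))"
    unfolding moment by (rule carlemanD[OF assms])
  then obtain N :: "nat \<Rightarrow> nat" and c :: "nat \<Rightarrow> nat \<Rightarrow> real" and q
    where q: "\<And>a. line.null_seq (\<lambda>n x. x ^ a - (\<Sum>k\<le>N n. c n k ^ a * (poly (q n k) x)\<^sup>2))"
    by (rule line.quadrature) blast
  show ?thesis
  proof (rule that)
    fix a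
    define p where "p n = monom 1 a - (\<Sum>k\<le>N n. smult (c n k ^ a) (q n k * q n k))" for n
    have 1: "(\<lambda>x. x ^ a - (\<Sum>k\<le>N n. c n k ^ a * (poly (q n k) x)\<^sup>2)) = poly (p n)" for n
      by (simp add: p_def fun_eq_iff poly_monom poly_sum power2_eq_square)
    have 2: "poly_at (p n) s = s ^ a - (\<Sum>k\<le>N n. c n k ^ a *\<^sub>R (poly_at (q n k) s * poly_at (q n k) s))" for n
      by (simp add: p_def poly_at_diff poly_at_monom poly_at_sum poly_at_smult poly_at_mult)
    have 3: "poly (p n) ^ (2 * i) = poly (p n ^ (2 * i))" for n i by (simp add: fun_eq_iff)
    have "line.null_seq (\<lambda>n. poly (p n))" using q[of a] by (simp only: 1)
    then have "null_seq (\<lambda>n. poly_at (p n) s)"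
      by (simp add: line.null_seq_def null_seq_def 3 \<Lambda> poly_at_power)
    then show "null_seq (\<lambda>n. s ^ a - (\<Sum>k\<le>N n. c n k ^ a *\<^sub>R (poly_at (q n k) s * poly_at (q n k) s)))"
      by (simp only: 2)
  qed
qed

end

text \<open>
  Replacing every power \<open>s ^ m\<close> of a generator by its one-dimensional quadrature turns \<open>L a\<close> into a sum of
  values of \<open>f\<close> at real points, weighted by the values of \<open>L\<close> at squares.
\<close>

lemma (in positive_linear) carleman_nonneg:
  assumes S: "independent S" "\<And>s. s \<in> S \<Longrightarrow> carleman L s"
    and f: "polyrel S f a" and f_nonneg: "\<And>\<omega>. linear \<omega> \<Longrightarrow> 0 \<le> f \<omega>"
  shows "0 \<le> L a"
proof -
  obtain B where B: "finite B" "B \<subseteq> S" "polyrel B f a" using polyrel_finite[OF f] .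
  have "\<exists>N c q. \<forall>a. null_seq (\<lambda>n. s ^ a - (\<Sum>k\<le>(N n :: nat). c n k ^ a *\<^sub>R (q n k * q n k)))"
    if "s \<in> B" for s
  proof -
    have "carleman L s" using S(2) B(2) that by blast
    then show ?thesis
    proof (rule quadrature_at)
      fix N :: "nat \<Rightarrow> nat" and c q
      assume "\<And>a. null_seq (\<lambda>n. s ^ a - (\<Sum>k\<le>N n. c n k ^ a *\<^sub>R (q n k * q n k)))"
      then show ?thesis by (intro exI allI)
    qed
  qed
  then have "\<forall>s\<in>B. \<exists>N c q. \<forall>a. null_seq (\<lambda>n. s ^ a - (\<Sum>k\<le>(N n :: nat). c n k ^ a *\<^sub>R (q n k * q n k)))"
    by (rule ballI)
  from bchoice[OF this] obtain N where
    "\<forall>s\<in>B. \<exists>c q. \<forall>a. null_seq (\<lambda>n. s ^ a - (\<Sum>k\<le>(N s n :: nat). c n k ^ a *\<^sub>R (q n k * q n k)))" ..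
  from bchoice[OF this] obtain c where
    "\<forall>s\<in>B. \<exists>q. \<forall>a. null_seq (\<lambda>n. s ^ a - (\<Sum>k\<le>(N s n :: nat). c s n k ^ a *\<^sub>R (q n k * q n k)))" ..
  from bchoice[OF this] obtain q where
    q: "\<forall>s\<in>B. \<forall>a. null_seq (\<lambda>n. s ^ a - (\<Sum>k\<le>(N s n :: nat). c s n k ^ a *\<^sub>R (q s n k * q s n k)))" ..
  define I where "I n = PiE B (\<lambda>s. {..N s n})" for n
  \<comment> \<open>The product of the square weights over all generators, arranged as a single
    square so that \<open>L\<close> is nonnegative on it.\<close>
  define w where "w n \<kappa> = (\<Prod>s\<in>B. q s n (\<kappa> s)) * (\<Prod>s\<in>B. q s n (\<kappa> s))" for n \<kappa>
  define \<omega> where "\<omega> n \<kappa> s = c s n (\<kappa> s)" for n \<kappa> s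
  define A where "A n x = (\<Sum>\<kappa>\<in>I n. fst x (\<omega> n \<kappa>) * L (w n \<kappa>))" for n and x :: "(('a \<Rightarrow> real) \<Rightarrow> real) \<times> 'a"
  \<comment> \<open>Convergence of the product quadrature is a linear condition on the pair, hence
    it has to be proved for monomials only.\<close>
  define C where "C = {x. (\<lambda>n. A n x) \<longlonglongrightarrow> L (snd x)}"
  have "subspace C"
    unfolding subspace_def
  proof (intro conjI ballI allI)
    show "0 \<in> C" by (simp add: C_def A_def)
    fix x y assume "x \<in> C" "y \<in> C"
    then have "(\<lambda>n. A n x + A n y) \<longlonglongrightarrow> L (snd x) + L (snd y)" by (auto simp: C_def intro: tendsto_add)
    moreover have "A n (x + y) = A n x + A n y" for n by (simp add: A_def distrib_right sum.distrib)
    ultimately show "x + y \<in> C" by (simp add: C_def L_add)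
  next
    fix r x assume "x \<in> C"
    then have "(\<lambda>n. r * A n x) \<longlonglongrightarrow> r * L (snd x)" by (auto simp: C_def intro: tendsto_mult_left)
    moreover have "A n (r *\<^sub>R x) = r * A n x" for n by (simp add: A_def sum_distrib_left mult.assoc)
    ultimately show "r *\<^sub>R x \<in> C" by (simp add: C_def L_scale)
  qed
  moreover have "monomials B \<subseteq> C"
  proof
    fix x assume "x \<in> monomials B"
    then obtain m where x: "x = ((\<lambda>\<omega>. \<Prod>s\<in>B. \<omega> s ^ m s), (\<Prod>s\<in>B. s ^ m s))" by (auto simp: monomials_def)
    define r where "r s n = (\<Sum>k\<le>N s n. c s n k ^ m s *\<^sub>R (q s n k * q s n k))" for s n
    have "null_seq (\<lambda>n. s ^ m s - r s n)" if "s \<in> B" for s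
      using bspec[OF q that] unfolding r_def by (rule spec)
    then have "null_seq (\<lambda>n. (\<Prod>s\<in>B. s ^ m s) - (\<Prod>s\<in>B. r s n))"
      using null_diff_prod[OF B(1)] by simp
    then have "(\<lambda>n. L ((\<Prod>s\<in>B. s ^ m s) - (\<Prod>s\<in>B. r s n))) \<longlonglongrightarrow> 0" by (rule tendsto_null)
    then have "(\<lambda>n. L (\<Prod>s\<in>B. s ^ m s) - L (\<Prod>s\<in>B. r s n)) \<longlonglongrightarrow> 0" by (simp add: L_diff)
    from tendsto_diff[OF tendsto_const[of "L (\<Prod>s\<in>B. s ^ m s)"] this]
    have "(\<lambda>n. L (\<Prod>s\<in>B. r s n)) \<longlonglongrightarrow> L (\<Prod>s\<in>B. s ^ m s)" by simp
    moreover have "L (\<Prod>s\<in>B. r s n) = A n x" for n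
    proof -
      have "(\<Prod>s\<in>B. r s n) = (\<Sum>\<kappa>\<in>I n. \<Prod>s\<in>B. c s n (\<kappa> s) ^ m s *\<^sub>R (q s n (\<kappa> s) * q s n (\<kappa> s)))"
        unfolding r_def I_def by (rule prod_sum_PiE[OF B(1)]) simp
      also have "\<dots> = (\<Sum>\<kappa>\<in>I n. (\<Prod>s\<in>B. \<omega> n \<kappa> s ^ m s) *\<^sub>R w n \<kappa>)"
      proof (intro sum.cong refl)
        fix \<kappa>
        have "(\<Prod>s\<in>B. u s *\<^sub>R v s) = (\<Prod>s\<in>B. u s) *\<^sub>R (\<Prod>s\<in>B. v s)" for u and v :: "'a \<Rightarrow> 'a"
          using B(1) by (induction B rule: finite_induct) simp_all
        then show "(\<Prod>s\<in>B. c s n (\<kappa> s) ^ m s *\<^sub>R (q s n (\<kappa> s) * q s n (\<kappa> s))) = (\<Prod>s\<in>B. \<omega> n \<kappa> s ^ m s) *\<^sub>R w n \<kappa>"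
          by (simp add: \<omega>_def w_def prod.distrib)
      qed
      finally show ?thesis by (simp add: L_sum L_scale A_def x)
    qed
    ultimately show "x \<in> C" by (simp add: C_def x)
  qed
  ultimately have "span (monomials B) \<subseteq> C" by (intro span_minimal)
  then have "(f, a) \<in> C" using polyrel_in_span_monomials[OF B(1,3)] by blast
  then have lim: "(\<lambda>n. A n (f, a)) \<longlonglongrightarrow> L a" by (simp add: C_def)
  have "0 \<le> f \<omega>" for \<omega>
  proof -
    \<comment> \<open>The nodes are arbitrary assignments of reals to \<open>B\<close>; independence
      realizes each of them by a linear functional, where \<open>f\<close> is known to be
      nonnegative.\<close>
    have "independent B" using S(1) B(2) by (rule independent_mono)
    then obtain g where g: "linear g" "\<forall>x\<in>B. g x = \<omega> x"
      using linear_independent_extend by blast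
    have "f g = f \<omega>" using g(2) by (intro polyrel_cong[OF B(3)]) simp
    then show ?thesis using f_nonneg[OF g(1)] by simp
  qed
  then have "0 \<le> A n (f, a)" for n
    unfolding A_def w_def by (intro sum_nonneg mult_nonneg_nonneg L_square) auto
  then show ?thesis using lim by (intro LIMSEQ_le_const) auto
qed

proposition random_representation:
  fixes L :: "'a::{real_algebra_1, comm_ring_1} \<Rightarrow> real"
  assumes L: "linear L" "L 1 = 1" and S: "independent S"
    and pos: "\<And>f a. polyrel S f a \<Longrightarrow> (\<And>\<omega>. linear \<omega> \<Longrightarrow> 0 \<le> f \<omega>) \<Longrightarrow> 0 \<le> L a"
  obtains M :: "('a \<times> nat \<Rightarrow> real) measure" and V
  where "prob_space M" "\<And>\<xi>. linear (V \<xi>)" "\<And>t. t \<in> span S \<Longrightarrow> (\<lambda>\<xi>. V \<xi> t) \<in> borel_measurable M"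
    "\<And>f a. polyrel (span S) f a \<Longrightarrow> integrable M (\<lambda>\<xi>. f (V \<xi>)) \<and> (\<integral>\<xi>. f (V \<xi>) \<partial>M) = L a"
proof -
  \<comment> \<open>The same function may come from several elements \<open>a\<close>. Positivity
    applied to a difference and to its negative makes \<open>L\<close> agree on them, which the
    extension theorem for graphs takes care of.\<close>
  define G where "G = {(f, L a) |f a. polyrel S f a}"
  obtain W \<Lambda> where W: "dominated_functional {\<omega>. linear \<omega>} W \<Lambda>" "\<And>f r. (f, r) \<in> G \<Longrightarrow> f \<in> W \<and> \<Lambda> f = r"
  proof (rule positive_extension[of G "{\<omega>. linear \<omega>}"])
    show "subspace G"
      unfolding subspace_def
    proof (intro conjI ballI allI)
      have "polyrel S (\<lambda>_. 0) 0" using polyrel.const[of S 0] by simp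
      then show "0 \<in> G" unfolding G_def using linear_0[OF L(1)]
        by (intro CollectI exI[of _ "\<lambda>_. 0"] exI[of _ 0]) (simp add: zero_prod_def zero_fun_def)
      fix x y assume "x \<in> G" "y \<in> G"
      then obtain f a g b where x: "x = (f, L a)" "polyrel S f a" and y: "y = (g, L b)" "polyrel S g b"
        unfolding G_def by blast
      have "x + y = ((\<lambda>\<omega>. f \<omega> + g \<omega>), L (a + b))" by (simp add: x y plus_fun_def linear_add[OF L(1)])
      then show "x + y \<in> G" unfolding G_def using polyrel.add[OF x(2) y(2)] by blast
    next
      fix c x assume "x \<in> G"
      then obtain f a where x: "x = (f, L a)" "polyrel S f a" unfolding G_def by blast
      have "c *\<^sub>R x = ((\<lambda>\<omega>. c * f \<omega>), L (c *\<^sub>R a))" by (simp add: x scaleR_fun_def linear_scale[OF L(1)])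
      then show "c *\<^sub>R x \<in> G" unfolding G_def using polyrel_scale[OF x(2)] by blast
    qed
    have "polyrel S (\<lambda>_. 1) 1" using polyrel.const[of S 1] by simp
    then show "(1, 1) \<in> G" unfolding G_def using L(2) by (force simp: one_fun_def)
    show "f * g \<in> fst ` G" if fg: "(f, r) \<in> G" "(g, t) \<in> G" for f g r t
    proof -
      obtain a b where "polyrel S f a" "polyrel S g b" using fg unfolding G_def by blast
      from polyrel.mult[OF this] have "((\<lambda>\<omega>. f \<omega> * g \<omega>), L (a * b)) \<in> G" unfolding G_def by blast
      then show ?thesis by (force simp: times_fun_def)
    qed
    show "0 \<le> r" if fr: "(f, r) \<in> G" "\<And>\<omega>. \<omega> \<in> {\<omega>. linear \<omega>} \<Longrightarrow> 0 \<le> f \<omega>" for f r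
    proof -
      obtain a where "polyrel S f a" "r = L a" using fr(1) unfolding G_def by blast
      then show ?thesis using pos fr(2) by simp
    qed
  qed blast
  have poly: "f \<in> W \<and> \<Lambda> f = L a" if "polyrel S f a" for f a
    by (rule W(2)) (use that in \<open>auto simp: G_def\<close>)
  obtain M :: "('a \<times> nat \<Rightarrow> real) measure" and V where M: "prob_space M" and V: "\<And>\<xi>. linear (V \<xi>)"
    and meas: "\<And>s. s \<in> S \<Longrightarrow> (\<lambda>\<xi>. V \<xi> s) \<in> borel_measurable M"
    and E: "\<And>f a. polyrel S f a \<Longrightarrow> integrable M (\<lambda>\<xi>. f (V \<xi>)) \<and> (\<integral>\<xi>. f (V \<xi>) \<partial>M) = L a"
    using kolmogorov_realization[where L = L, OF W(1) poly S] by blast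
  have E': "integrable M (\<lambda>\<xi>. f (V \<xi>)) \<and> (\<integral>\<xi>. f (V \<xi>) \<partial>M) = L a" if f: "polyrel (span S) f a" for f a
  proof -
    obtain g where g: "polyrel S g a" "\<forall>\<omega>. linear \<omega> \<longrightarrow> f \<omega> = g \<omega>" using polyrel_span[OF f] by blast
    have "f (V \<xi>) = g (V \<xi>)" for \<xi> using g(2) V by blast
    then show ?thesis using E[OF g(1)] by simp
  qed
  show ?thesis
  proof (rule that[of M V])
    show "(\<lambda>\<xi>. V \<xi> t) \<in> borel_measurable M" if "t \<in> span S" for t
      using E'[OF polyrel.gen[OF that]] by (intro borel_measurable_integrable) (rule conjunct1)
  qed (rule M V E', assumption?)+
qed

section \<open>The moment problem\<close>

theorem theorem12:
  fixes T S :: "'a::{real_algebra_1, comm_ring_1} set"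
    and \<tau> :: "'a topology"
    and L :: "'a \<Rightarrow> real"
  assumes "subspace T"
    and "is_subalgebra hull (T \<union> {1}) = UNIV"
    and "independent S" and "span S = T"
    and "locally_convex_hausdorff \<tau>" and "topspace \<tau> = T"
    and "linear L" and "L 1 = 1"
    and "(\<forall>a\<in>nonneg_on_characters. 0 \<le> L a) \<or>
         ((\<forall>a. 0 \<le> L (a\<^sup>2)) \<and> (\<forall>t\<in>S. carleman L t))"
  shows "(\<exists>\<mu>. cylinder_measure \<tau> \<mu> \<and> represents \<tau> L \<mu>) \<and>
    ((\<exists>q. continuous_seminorm \<tau> q \<and> (\<forall>t\<in>T. L (t\<^sup>2) \<le> (q t)\<^sup>2)) \<longrightarrow>
       (\<exists>\<mu>. continuous_cylinder_measure \<tau> \<mu> \<and> represents \<tau> L \<mu>)) \<and>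
    (continuous_dual \<tau> \<subseteq> (\<lambda>\<phi>. restrict \<phi> T) ` characters \<longrightarrow> moment_functional \<tau> L)"
proof -
  have pos: "0 \<le> L a" if f: "polyrel S f a" and f_nonneg: "\<And>\<omega>. linear \<omega> \<Longrightarrow> 0 \<le> f \<omega>" for f a
    using assms(9)
  proof
    assume L: "\<forall>a\<in>nonneg_on_characters. 0 \<le> L a"
    have "0 \<le> \<phi> a" if "\<phi> \<in> characters" for \<phi>
      using polyrel_character[OF f that] f_nonneg[of \<phi>] that by (simp add: characters_def)
    then show ?thesis using L by (simp add: nonneg_on_characters_def)
  next
    assume L: "(\<forall>a. 0 \<le> L (a\<^sup>2)) \<and> (\<forall>t\<in>S. carleman L t)"
    interpret positive_linear L
    proof
      show "is_subalgebra (UNIV :: 'a set)" by (simp add: is_subalgebra_def)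
    qed (use L assms(7,8) in \<open>auto simp: linear_add linear_scale power2_eq_square\<close>)
    show ?thesis using carleman_nonneg[OF assms(3) _ f f_nonneg] L by blast
  qed
  show ?thesis
  proof (rule random_representation[OF assms(7,8,3) pos])
    fix M :: "('a \<times> nat \<Rightarrow> real) measure" and V
    assume M: "prob_space M" and V: "\<And>\<xi>. linear (V \<xi>)"
      and meas: "\<And>t. t \<in> span S \<Longrightarrow> (\<lambda>\<xi>. V \<xi> t) \<in> borel_measurable M"
      and E: "\<And>f a. polyrel (span S) f a \<Longrightarrow> integrable M (\<lambda>\<xi>. f (V \<xi>)) \<and> (\<integral>\<xi>. f (V \<xi>) \<partial>M) = L a"
    have T: "span S = topspace \<tau>" using assms(4,6) by simp
    \<comment> \<open>A single random functional serves all three claims: continuity and the moment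
      property are proved for the same measure \<open>cyl\<close>.\<close>
    interpret random_functional \<tau> M V
      using assms(5) M V meas unfolding T
      by (intro random_functional.intro locally_convex.intro random_functional_axioms.intro)
    have E': "cylinder_integrable \<tau> cyl k \<and> L a = cylinder_integral \<tau> cyl k"
      if "polyrel (topspace \<tau>) f a" "\<And>l. l \<in> continuous_dual \<tau> \<Longrightarrow> k l = f l" for f a k
      using cylinder_integral_polyrel[OF that(1) _ that(2)] E[of f a] that(1) T by simp
    have rep: "represents \<tau> L cyl"
      unfolding represents_def
    proof (intro allI ballI impI)
      fix k t and p :: real_mpoly assume "p \<in> mpoly_in k" "\<forall>i<k. t i \<in> topspace \<tau>"
      then show "cylinder_integrable \<tau> cyl (\<lambda>\<phi>. mpoly_eval p (\<lambda>i. \<phi> (t i))) \<and>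
          L (mpoly_eval p t) = cylinder_integral \<tau> cyl (\<lambda>\<phi>. mpoly_eval p (\<lambda>i. \<phi> (t i)))"
        by (intro E'[OF polyrel_mpoly_eval]) auto
    qed
    have "continuous_cylinder_measure \<tau> cyl"
      if q: "continuous_seminorm \<tau> q" "\<forall>t\<in>T. L (t\<^sup>2) \<le> (q t)\<^sup>2" for q
    proof (rule continuous_cylinder_measure_cyl[OF q(1)])
      fix t assume t: "t \<in> topspace \<tau>"
      have sq: "polyrel (span S) (\<lambda>\<omega>. (\<omega> t)\<^sup>2) (t\<^sup>2)"
        by (intro polyrel_power polyrel.gen) (use t T in simp)
      show "integrable M (\<lambda>\<xi>. (V \<xi> t)\<^sup>2)" using E[OF sq] by blast
      show "(\<integral>\<xi>. (V \<xi> t)\<^sup>2 \<partial>M) \<le> (q t)\<^sup>2" using E[OF sq] q(2) t assms(6) by simp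
    qed
    moreover have "moment_functional \<tau> L" if dual: "continuous_dual \<tau> \<subseteq> (\<lambda>\<phi>. restrict \<phi> T) ` characters"
      unfolding moment_functional_def
    proof (intro exI[of _ cyl] conjI allI cylinder_measure_cyl)
      fix a
      have gen: "is_subalgebra hull (topspace \<tau> \<union> {1}) = UNIV" using assms(2,6) by simp
      obtain f where f: "polyrel (topspace \<tau>) f a" using polyrel_generates[OF gen] .
      have "character_of \<tau> \<phi> a = f \<phi>" if "\<phi> \<in> continuous_dual \<tau>" for \<phi>
        using character_of_polyrel[OF gen _ f] that dual assms(6) by blast
      from E'[OF f this]
      show "cylinder_integrable \<tau> cyl (\<lambda>\<phi>. character_of \<tau> \<phi> a)"
        "L a = cylinder_integral \<tau> cyl (\<lambda>\<phi>. character_of \<tau> \<phi> a)" by auto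
    qed
    ultimately show ?thesis using cylinder_measure_cyl rep by blast
  qed
qed

end
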